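(* Assume $q>4$. Let $n$ be an effective divisor on the affine line over $\mathbb F_q$ (an ideal of $A=\mathbb F_q[t]$) and let $v$ be a point of the affine line (a prime of $A$) not in the support of $n$. Then for every prime $l$ not dividing $2q$, the homomorphism $$\alpha=(I,I\circ w_v):\overline{\Gamma_0(v)\cap\Gamma(n)}\to\overline{\Gamma(n)}\oplus\overline{\Gamma(n)}$$ is surjective modulo $l$, i.e. $\alpha\otimes\mathbb Z/l$ is surjective.
   Context: $A=\mathbb F_q[t]$. For an ideal $m$ of $A$: $\Gamma(m)=\{\gamma\in\mathrm{SL}(2,A):\gamma\equiv 1\bmod m\}$ and $\Gamma_0(m)=\{\gamma\in\mathrm{SL}(2,A):\gamma\equiv\begin{pmatrix}*&*\\0&*\end{pmatrix}\bmod m\}$. For a group $\Gamma$, $\bar\Gamma=\Gamma^{ab}/\mathrm{torsion}$. $I:\overline{\Gamma_0(v)\cap\Gamma(n)}\to\overline{\Gamma(n)}$ is the map induced by inclusion. Let $\pi_v\in A$ be the monic irreducible generator of $v$, $\tau_v=\begin{pmatrix}\pi_v&0\\0&1\end{pmatrix}$ and $S=\begin{pmatrix}0&1\\-1&0\end{pmatrix}$. The Atkin–Lehner involution $w_v$ of $\overline{\Gamma_0(v)\cap\Gamma(n)}$ is the automorphism obtained by composing the isomorphism $\overline{\Gamma_0(v)\cap\Gamma(n)}\to\overline{\Gamma^0(v)\cap\Gamma(n)}$ induced by conjugation by $\tau_v$ with the inverse of the isomorphism $\overline{\Gamma_0(v)\cap\Gamma(n)}\to\overline{\Gamma^0(v)\cap\Gamma(n)}$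 induced by conjugation by $S$, where $\Gamma^0(v)=\{\gamma\in\mathrm{SL}(2,A):\gamma\equiv\begin{pmatrix}*&0\\ *&*\end{pmatrix}\bmod v\}$. *)

theory Defs
  imports
    "HOL-Analysis.Analysis"
    "HOL-Algebra.Algebra"
    "HOL-Algebra.Algebraic_Closure_Type"
begin

no_notation fps_nth (infixl \<open>$\<close> 75)

subsection \<open>Abelian groups\<close>

text \<open>
  If \<open>f\<close> is a homomorphism into \<open>H\<close>, \<open>N\<close> and \<open>M\<close> are normal subgroups of its domain and of \<open>H\<close>,
  and \<open>f\<close> maps \<open>N\<close> into \<open>M\<close>, then the homomorphism of quotients induced by \<open>f\<close> sends the coset
  \<open>N x\<close> to \<open>M f(x) = M f(N x)\<close>.
\<close>

definition quot_map :: "('b, 'k) monoid_scheme \<Rightarrow> 'b set \<Rightarrow> ('a \<Rightarrow> 'b) \<Rightarrow> 'a set \<Rightarrow> 'b set"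
  where "quot_map H M f C = M <#>\<^bsub>H\<^esub> (f ` C)"

definition abelianization :: "('a, 'k) monoid_scheme \<Rightarrow> 'a set monoid"
  where "abelianization G = G Mod (derived G (carrier G))"

definition abelianization_map ::
    "('b, 'k) monoid_scheme \<Rightarrow> ('a \<Rightarrow> 'b) \<Rightarrow> 'a set \<Rightarrow> 'b set"
  where "abelianization_map H f = quot_map H (derived H (carrier H)) f"

definition torsion :: "('a, 'k) monoid_scheme \<Rightarrow> 'a set"
  where "torsion G = {x \<in> carrier G. \<exists>k::nat. k > 0 \<and> x [^]\<^bsub>G\<^esub> k = \<one>\<^bsub>G\<^esub>}"

definition free_ab :: "('a, 'k) monoid_scheme \<Rightarrow> 'a set set monoid"
  where "free_ab G = abelianization G Mod torsion (abelianization G)"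

definition free_ab_map ::
    "('b, 'k) monoid_scheme \<Rightarrow> ('a \<Rightarrow> 'b) \<Rightarrow> 'a set set \<Rightarrow> 'b set set"
  where "free_ab_map H f =
    quot_map (abelianization H) (torsion (abelianization H)) (abelianization_map H f)"

text \<open>
  For an abelian group \<open>M\<close>, the tensor product of \<open>M\<close> with \<open>\<int>/l\<close> is the quotient \<open>M/lM\<close>;
  groups are written multiplicatively, so that \<open>lM\<close> is the set of \<open>l\<close>-th powers.
\<close>

definition powers :: "nat \<Rightarrow> ('a, 'k) monoid_scheme \<Rightarrow> 'a set"
  where "powers l G = (\<lambda>x. x [^]\<^bsub>G\<^esub> l) ` carrier G"

definition tensor_mod :: "nat \<Rightarrow> ('a, 'k) monoid_scheme \<Rightarrow> 'a set monoid"
  where "tensor_mod l G = G Mod powers l G"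

definition tensor_mod_map ::
    "nat \<Rightarrow> ('b, 'k) monoid_scheme \<Rightarrow> ('a \<Rightarrow> 'b) \<Rightarrow> 'a set \<Rightarrow> 'b set"
  where "tensor_mod_map l H f = quot_map H (powers l H) f"


subsection \<open>Ideals of a polynomial ring over a field\<close>

abbreviation poly_ring_A :: "'a::field poly ring"
  where "poly_ring_A \<equiv> ring_of_type_algebra"

text \<open>The points of the affine line (nonzero primes \<open>v\<close>) dividing the nonzero ideal \<open>n\<close>.\<close>

definition divisor_support :: "'a::field poly set \<Rightarrow> 'a poly set set"
  where "divisor_support n = {v. primeideal v poly_ring_A \<and> v \<noteq> {0} \<and> n \<subseteq> v}"

definition monic_generator :: "'a::field poly set \<Rightarrow> 'a poly"
  where "monic_generator v = (THE p. Polynomial.lead_coeff p = 1 \<and> Factorial_Ring.irreducible p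
    \<and> v = PIdl\<^bsub>poly_ring_A\<^esub> p)"


subsection \<open>Congruence subgroups\<close>

definition SL2 :: "('a::field poly ^ 2 ^ 2) monoid"
  where "SL2 = \<lparr>carrier = {g. det g = 1}, mult = (**), one = mat 1\<rparr>"

definition Gamma_full :: "'a::field poly set \<Rightarrow> ('a poly ^ 2 ^ 2) set"
  where "Gamma_full m = {g \<in> carrier SL2. \<forall>i j. g $ i $ j - mat 1 $ i $ j \<in> m}"

text \<open>
  \<open>Gamma_lower m\<close> is the group usually written \<open>\<Gamma>\<^sub>0(m)\<close> (lower left entry in \<open>m\<close>),
  and \<open>Gamma_upper m\<close> is the one usually written \<open>\<Gamma>\<^sup>0(m)\<close> (upper right entry in \<open>m\<close>).
\<close>

definition Gamma_lower :: "'a::field poly set \<Rightarrow> ('a poly ^ 2 ^ 2) set"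
  where "Gamma_lower m = {g \<in> carrier SL2. g $ 2 $ 1 \<in> m}"

definition Gamma_upper :: "'a::field poly set \<Rightarrow> ('a poly ^ 2 ^ 2) set"
  where "Gamma_upper m = {g \<in> carrier SL2. g $ 1 $ 2 \<in> m}"

abbreviation SL2_sub :: "('a::field poly ^ 2 ^ 2) set \<Rightarrow> ('a poly ^ 2 ^ 2) monoid"
  where "SL2_sub Q \<equiv> SL2\<lparr>carrier := Q\<rparr>"


subsection \<open>Conjugation and the Atkin--Lehner involution\<close>

abbreviation frac_matrix :: "'a::field poly ^ 2 ^ 2 \<Rightarrow> 'a poly fract ^ 2 ^ 2"
  where "frac_matrix \<equiv> map_matrix to_fract"

text \<open>
  Conjugation takes place in \<open>GL\<^sub>2\<close> of the fraction field; \<open>conj_by g h\<close> is the matrix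
  \<open>g h g\<^sup>-\<^sup>1\<close>, and is meaningful only when that matrix has polynomial entries.
\<close>

definition conj_by :: "'a::field poly ^ 2 ^ 2 \<Rightarrow> 'a poly ^ 2 ^ 2 \<Rightarrow> 'a poly ^ 2 ^ 2"
  where "conj_by g h = (THE k.
    frac_matrix k = frac_matrix g ** frac_matrix h ** matrix_inv (frac_matrix g))"

definition tau_matrix :: "'a::field poly set \<Rightarrow> 'a poly ^ 2 ^ 2"
  where "tau_matrix v = vector [vector [monic_generator v, 0], vector [0, 1]]"

definition S_matrix :: "'a::field poly ^ 2 ^ 2"
  where "S_matrix = vector [vector [0, 1], vector [- 1, 0]]"

definition atkin_lehner ::
    "'a::field poly set \<Rightarrow> 'a poly set \<Rightarrow> ('a poly ^ 2 ^ 2) set set \<Rightarrow> ('a poly ^ 2 ^ 2) set set"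
  where "atkin_lehner v n x =
    inv_into (carrier (free_ab (SL2_sub (Gamma_lower v \<inter> Gamma_full n))))
      (free_ab_map (SL2_sub (Gamma_upper v \<inter> Gamma_full n)) (conj_by S_matrix))
      (free_ab_map (SL2_sub (Gamma_upper v \<inter> Gamma_full n)) (conj_by (tau_matrix v)) x)"

definition inclusion_map ::
    "'a::field poly set \<Rightarrow> ('a poly ^ 2 ^ 2) set set \<Rightarrow> ('a poly ^ 2 ^ 2) set set"
  where "inclusion_map n = free_ab_map (SL2_sub (Gamma_full n)) (\<lambda>g. g)"

definition alpha_map ::
    "'a::field poly set \<Rightarrow> 'a poly set \<Rightarrow> ('a poly ^ 2 ^ 2) set set
      \<Rightarrow> ('a poly ^ 2 ^ 2) set set \<times> ('a poly ^ 2 ^ 2) set set"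
  where "alpha_map v n x = (inclusion_map n x, inclusion_map n (atkin_lehner v n x))"

end

theory Submission
  imports Defs "HOL-Number_Theory.Number_Theory"
begin

text \<open>
  Let \<open>M\<close> be the cokernel of \<open>\<alpha> \<otimes> \<int>/l\<close>, an abelian group of exponent \<open>l\<close>. The two summands of the target
  give homomorphisms \<open>\<phi>1, \<phi>2 : \<Gamma>(n) \<rightarrow> M\<close> (the second one composed with conjugation by \<open>S\<close> and inversion), and
  \<open>M\<close> being a cokernel means that \<open>\<phi>1 (\<tau>\<^sup>-\<^sup>1 x \<tau>) = \<phi>2 x\<close> whenever both sides make sense. As for Ihara's
  amalgam, a normal form for words shows that \<open>\<phi>1\<close> and \<open>\<phi>2\<close> glue to a homomorphism \<open>\<Phi>\<close> to \<open>M\<close> from the principal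
  congruence subgroup of level \<open>n\<close> of \<open>SL\<^sub>2(B)\<close>, where \<open>B = A[1/\<pi>]\<close>. It remains to see that \<open>\<Phi> = 1\<close>, which is
  the instance of the congruence subgroup property that is needed here.

  Unipotent elements have order \<open>p\<close>, so \<open>\<Phi>\<close> kills the group \<open>E\<close> generated by those of level \<open>n\<close>.
  Since \<open>\<pi>\<close> is a unit of infinite order in \<open>B\<close>, elementary matrices \<open>e12 x\<close> and \<open>e21 y\<close> whose entries are divisible by
  coprime parts of \<open>n\<close> commute modulo \<open>E\<close>; hence the primes dividing \<open>n\<close> can be treated one at a time. At a prime
  power \<open>s\<^sup>k\<close> the kernel of the map from the group of words in the elementary matrices to \<open>SL\<^sub>2(A/s\<^sup>k)\<close> is central, and is
  generated by the defects \<open>h u h v h(uv)\<^sup>-\<^sup>1\<close> of multiplicativity of the torus. They vanish by Matsumoto's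
  relations for symbols, because \<open>M\<close> has no 2-torsion and no \<open>p\<close>-torsion and \<open>(A/s)\<^sup>\<times>\<close> is cyclic.
\<close>

section \<open>The group type\<close>

text \<open>The homomorphism \<Phi> lives on level n only, and its kernel is not visibly stable
  under SL2(B). Quotients of larger congruence subgroups are therefore formed with the part of the
  kernel that is stable under all conjugations. That part is cut out by equations in M, so the
  absence of 2- and p-torsion in M passes to level n modulo it, and the symbol calculus can use it
  there.

  The delicate input for the symbols is the Weyl relation: w(z) has the entry -1/z, but z is a unit
  only modulo the prime power under consideration. Splitting off the part at that prime leaves
  genuine denominators over B; conjugation by diag(z, 1/z) clears them, at the price of powers of z
  in the levels.

  The size of the constant field enters because one constant has to avoid up to three linear
  conditions modulo a prime; constants serve all residue fields alike. Absence of p-torsion is used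
  twice, to kill unipotents and to make the torus commutative; absence of 2-torsion once, to pass
  from squares of torus elements to the elements themselves.\<close>

typedef (overloaded) 'k sl2 = "{(a, b, c, d). a * d - b * c = (1 :: 'k::field)}"
  by (rule exI[of _ "(1, 0, 0, 1)"]) auto

definition sl2 :: "'k::field \<Rightarrow> 'k \<Rightarrow> 'k \<Rightarrow> 'k \<Rightarrow> 'k sl2"
  where "sl2 a b c d = Abs_sl2 (a, b, c, d)"

definition ent11 :: "'k::field sl2 \<Rightarrow> 'k" where "ent11 g = fst (Rep_sl2 g)"
definition ent12 :: "'k::field sl2 \<Rightarrow> 'k" where "ent12 g = fst (snd (Rep_sl2 g))"
definition ent21 :: "'k::field sl2 \<Rightarrow> 'k" where "ent21 g = fst (snd (snd (Rep_sl2 g)))"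
definition ent22 :: "'k::field sl2 \<Rightarrow> 'k" where "ent22 g = snd (snd (snd (Rep_sl2 g)))"

lemma ent_sl2:
  assumes "a * d - b * c = 1"
  shows "ent11 (sl2 a b c d) = a" "ent12 (sl2 a b c d) = b"
    "ent21 (sl2 a b c d) = c" "ent22 (sl2 a b c d) = d"
  using assms by (auto simp: ent11_def ent12_def ent21_def ent22_def sl2_def Abs_sl2_inverse)

lemma det_ent: "ent11 g * ent22 g - ent12 g * ent21 g = 1"
  using Rep_sl2[of g] by (auto simp: ent11_def ent12_def ent21_def ent22_def split_beta)

lemma sl2_eqI:
  assumes "ent11 g = ent11 h" "ent12 g = ent12 h" "ent21 g = ent21 h" "ent22 g = ent22 h"
  shows "g = h"
  using assms by (metis Rep_sl2_inject ent11_def ent12_def ent21_def ent22_def prod_eq_iff)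

text \<open>
  The multiplication of matrices is written additively: the type classes for groups that are not
  necessarily commutative exist in additive notation only.
\<close>

instantiation sl2 :: (field) group_add
begin

definition "0 = sl2 1 0 0 (1::'a)"
definition "g + h = sl2 (ent11 g * ent11 h + ent12 g * ent21 h) (ent11 g * ent12 h + ent12 g * ent22 h)
    (ent21 g * ent11 h + ent22 g * ent21 h) (ent21 g * ent12 h + ent22 g * ent22 h)" for g h :: "'a sl2"
definition "- g = sl2 (ent22 g) (- ent12 g) (- ent21 g) (ent11 g)" for g :: "'a sl2"
definition "g - h = g + - h" for g h :: "'a sl2"

lemma ent_zero: "ent11 (0::'a sl2) = 1" "ent12 (0::'a sl2) = 0" "ent21 (0::'a sl2) = 0" "ent22 (0::'a sl2) = 1"
  by (simp_all add: zero_sl2_def ent_sl2)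

lemma det_mult:
  "(a * a' + b * c') * (c * b' + d * d') - (a * b' + b * d') * (c * a' + d * c')
    = (a * d - b * c) * (a' * d' - b' * (c'::'b::comm_ring_1))"
  by (simp add: algebra_simps)

lemma ent_plus:
  fixes g h :: "'a sl2"
  shows "ent11 (g + h) = ent11 g * ent11 h + ent12 g * ent21 h"
    "ent12 (g + h) = ent11 g * ent12 h + ent12 g * ent22 h"
    "ent21 (g + h) = ent21 g * ent11 h + ent22 g * ent21 h"
    "ent22 (g + h) = ent21 g * ent12 h + ent22 g * ent22 h"
  using ent_sl2[OF trans[OF det_mult], of "ent11 g" "ent22 g" "ent12 g" "ent21 g" "ent11 h" "ent22 h" "ent12 h" "ent21 h"]
  by (simp_all add: plus_sl2_def det_ent)

lemma ent_uminus:
  fixes g :: "'a sl2"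
  shows "ent11 (- g) = ent22 g" "ent12 (- g) = - ent12 g" "ent21 (- g) = - ent21 g" "ent22 (- g) = ent11 g"
  using ent_sl2[of "ent22 g" "ent11 g" "- ent12 g" "- ent21 g"] det_ent[of g]
  by (simp_all add: uminus_sl2_def mult.commute)

instance
proof
  fix a b c :: "'a sl2"
  show "a + b + c = a + (b + c)"
    by (rule sl2_eqI) (simp_all add: ent_plus algebra_simps)
  show "0 + a = a" "a + 0 = a"
    by (rule sl2_eqI; simp add: ent_plus ent_zero)+
  show "- a + a = 0"
    using det_ent[of a] by (intro sl2_eqI) (simp_all add: ent_plus ent_zero ent_uminus algebra_simps)
  show "a + - b = a - b"
    by (simp add: minus_sl2_def)
qed

end

definition e12 :: "'k::field \<Rightarrow> 'k sl2" where "e12 x = sl2 1 x 0 1"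
definition e21 :: "'k::field \<Rightarrow> 'k sl2" where "e21 x = sl2 1 0 x 1"
definition dg :: "'k::field \<Rightarrow> 'k sl2" where "dg u = sl2 u 0 0 (inverse u)"

lemma ent_e12 [simp]: "ent11 (e12 x) = 1" "ent12 (e12 x) = x" "ent21 (e12 x) = 0" "ent22 (e12 x) = 1"
  by (simp_all add: e12_def ent_sl2)

lemma ent_e21 [simp]: "ent11 (e21 x) = 1" "ent12 (e21 x) = 0" "ent21 (e21 x) = x" "ent22 (e21 x) = 1"
  by (simp_all add: e21_def ent_sl2)

lemma ent_dg [simp]:
  assumes "u \<noteq> 0"
  shows "ent11 (dg u) = u" "ent12 (dg u) = 0" "ent21 (dg u) = 0" "ent22 (dg u) = inverse u"
  using assms by (simp_all add: dg_def ent_sl2)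

lemmas ent_simps = ent_plus ent_uminus ent_zero

lemma e12_add: "e12 (x + y) = e12 x + e12 y" and e21_add: "e21 (x + y) = e21 x + e21 y"
  by (rule sl2_eqI; simp add: ent_simps)+

lemma e12_0 [simp]: "e12 0 = 0" and e21_0 [simp]: "e21 0 = 0"
  by (rule sl2_eqI; simp add: ent_simps)+

lemma e12_uminus: "e12 (- x) = - e12 x" and e21_uminus: "e21 (- x) = - e21 x"
  by (rule sl2_eqI; simp add: ent_simps)+

hide_const (open) Polynomials.degree Divisibility.irreducible Divisibility.prime

section \<open>Polynomials over a finite field\<close>

lemma poly_bezout_gen:
  fixes a b :: "'a::field poly"
  shows "\<exists>x y d. x * a + y * b = d \<and> d dvd a \<and> d dvd b"
\<comment> \<open>The measure ranks 0 below the nonzero constants, whose degree is also 0, so that a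
  vanishing remainder is a strict descent.\<close>
proof (induction "if b = 0 then 0 else Suc (degree b)" arbitrary: a b rule: less_induct)
  case less
  show ?case
  proof (cases "b = 0")
    case True
    then have "1 * a + 0 * b = a \<and> a dvd a \<and> a dvd b" by simp
    then show ?thesis by blast
  next
    case False
    have "a mod b = 0 \<or> degree (a mod b) < degree b"
      using degree_mod_less[OF False] by auto
    then have "(if a mod b = 0 then 0 else Suc (degree (a mod b))) < (if b = 0 then 0 else Suc (degree b))"
      using False by auto
    from less[OF this] obtain x y d where d: "x * b + y * (a mod b) = d" "d dvd b" "d dvd a mod b" by blast
    have "y * a + (x - y * (a div b)) * b = x * b + y * (a - a div b * b)" by (simp add: algebra_simps)
    also have "\<dots> = d" using d(1) by (simp add: minus_div_mult_eq_mod)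
    finally show ?thesis using d(2,3) by (metis dvd_mod_imp_dvd)
  qed
qed

lemma poly_bezout:
  fixes a b :: "'a::field poly"
  assumes "Rings.coprime a b" shows "\<exists>x y. x * a + y * b = 1"
proof -
  obtain x y d where d: "x * a + y * b = d" "d dvd a" "d dvd b" using poly_bezout_gen by blast
  then have "is_unit d" using assms coprime_common_divisor by blast
  then obtain d' where "d' * d = 1" by (metis dvdE mult.commute)
  then have "(d' * x) * a + (d' * y) * b = 1" using d(1) by (simp add: distrib_left[symmetric] mult.assoc)
  then show ?thesis by blast
qed

lemma poly_coprimeI:
  fixes a b :: "'a::field poly"
  assumes "x * a + y * b = 1" shows "Rings.coprime a b"
  by (rule coprimeI) (metis assms dvd_add dvd_mult)

lemma poly_coprime_iff_prime:
  fixes s z :: "'a::field poly"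
  assumes "Factorial_Ring.irreducible s" shows "Rings.coprime s z \<longleftrightarrow> \<not> s dvd z"
proof
  assume "Rings.coprime s z"
  then show "\<not> s dvd z" using assms by (metis coprime_common_divisor dvd_refl Factorial_Ring.irreducible_def)
next
  assume *: "\<not> s dvd z"
  show "Rings.coprime s z"
  proof (rule coprimeI)
    fix c assume c: "c dvd s" "c dvd z"
    then obtain d where d: "s = c * d" by (elim dvdE)
    with assms have "is_unit c \<or> is_unit d" by (simp add: Factorial_Ring.irreducible_def)
    moreover have False if "is_unit d" using that d c(2) * by (metis mult_unit_dvd_iff)
    ultimately show "is_unit c" by blast
  qed
qed

lemma poly_coprime_mult_right:
  fixes a b c :: "'a::field poly"
  shows "Rings.coprime a (b * c) \<longleftrightarrow> Rings.coprime a b \<and> Rings.coprime a c"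
proof
  assume "Rings.coprime a (b * c)"
  then show "Rings.coprime a b \<and> Rings.coprime a c"
    by (meson coprime_divisors dvd_refl dvd_triv_left dvd_triv_right)
next
  assume "Rings.coprime a b \<and> Rings.coprime a c"
  then obtain x y u v where 1: "x * a + y * b = 1" "u * a + v * c = 1" using poly_bezout by meson
  have "(x * u * a + x * v * c + y * u * b) * a + (y * v) * (b * c) = (x * a + y * b) * (u * a + v * c)"
    by (simp add: algebra_simps)
  then show "Rings.coprime a (b * c)" using 1 poly_coprimeI by simp
qed

lemma poly_coprime_mult_left:
  fixes a b c :: "'a::field poly"
  shows "Rings.coprime (b * c) a \<longleftrightarrow> Rings.coprime b a \<and> Rings.coprime c a"
  using poly_coprime_mult_right[of a b c] by (simp add: coprime_commute)

lemma poly_coprime_power: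
  fixes a b :: "'a::field poly"
  shows "Rings.coprime a b \<Longrightarrow> Rings.coprime a (b ^ n)"
  by (induction n) (simp_all add: poly_coprime_mult_right)

lemma poly_coprime_dvd_mult:
  fixes a b c :: "'a::field poly"
  assumes "Rings.coprime a b" "a dvd b * c" shows "a dvd c"
proof -
  obtain x y where "x * a + y * b = 1" using poly_bezout assms by meson
  then have "c = (x * a + y * b) * c" by simp
  also have "\<dots> = a * (x * c) + y * (b * c)" by (simp add: algebra_simps)
  finally have "c = a * (x * c) + y * (b * c)" .
  then show ?thesis using assms(2) by (metis dvd_add dvd_mult dvd_triv_left)
qed

lemma poly_coprime_mult_dvd:
  fixes a b c :: "'a::field poly"
  assumes "Rings.coprime a b" "a dvd c" "b dvd c" shows "a * b dvd c"
proof -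
  obtain d where d: "c = b * d" using assms(3) by (elim dvdE)
  then have "a dvd d" using assms poly_coprime_dvd_mult by blast
  then show ?thesis using d by (simp add: mult.commute mult_dvd_mono)
qed

lemma poly_cong_inverse:
  fixes z m :: "'a::field poly"
  assumes "Rings.coprime z m" shows "\<exists>z'. [z * z' = 1] (mod m)"
proof -
  obtain x y where "x * z + y * m = 1" using poly_bezout assms by meson
  then have "z * x - 1 = - y * m" by (simp add: algebra_simps)
  then have "[z * x = 1] (mod m)" by (simp add: cong_iff_dvd_diff)
  then show ?thesis by blast
qed

lemma poly_crt:
  fixes m n a b :: "'a::field poly"
  assumes "Rings.coprime m n" shows "\<exists>z. [z = a] (mod m) \<and> [z = b] (mod n)"
proof -
  obtain x y where 1: "x * m + y * n = 1" using poly_bezout assms by meson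
  have "a * (y * n) + b * (x * m) - a = (b - a) * x * m + a * (x * m + y * n - 1)"
    "a * (y * n) + b * (x * m) - b = (a - b) * y * n + b * (x * m + y * n - 1)"
    by (simp_all add: algebra_simps)
  then have "[a * (y * n) + b * (x * m) = a] (mod m) \<and> [a * (y * n) + b * (x * m) = b] (mod n)"
    using 1 by (simp add: cong_iff_dvd_diff)
  then show ?thesis by blast
qed

lemma poly_irreducible_factor:
  fixes f :: "'a::field poly"
  assumes "f \<noteq> 0" "\<not> is_unit f" shows "\<exists>r. Factorial_Ring.irreducible r \<and> r dvd f"
  using assms
proof (induction "degree f" arbitrary: f rule: less_induct)
  case less
  show ?case
  proof (cases "Factorial_Ring.irreducible f")
    case False
    then obtain a b where ab: "f = a * b" "\<not> is_unit a" "\<not> is_unit b"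
      using less.prems by (auto simp: Factorial_Ring.irreducible_def)
    then have "degree b > 0" "a \<noteq> 0" "b \<noteq> 0"
      using less.prems by (auto simp: is_unit_iff_degree)
    then have "degree a < degree f" using ab by (simp add: degree_mult_eq)
    with less.hyps[OF this] ab \<open>a \<noteq> 0\<close> show ?thesis by (meson dvd_mult2)
  qed auto
qed

section \<open>Finiteness of residue rings and avoidance of bad residues\<close>

lemma finite_poly_degree_less: "finite {p :: 'a::{field, finite} poly. degree p < n}"
proof (rule finite_subset)
  show "{p :: 'a poly. degree p < n} \<subseteq> Poly ` {xs. set xs \<subseteq> UNIV \<and> length xs \<le> n}"
  proof
    fix p :: "'a poly" assume "p \<in> {p. degree p < n}"
    then have "length (coeffs p) \<le> n" by (cases "p = 0") (auto simp: length_coeffs)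
    moreover have "p = Poly (coeffs p)" by simp
    ultimately show "p \<in> Poly ` {xs. set xs \<subseteq> UNIV \<and> length xs \<le> n}" by blast
  qed
  show "finite (Poly ` {xs :: 'a list. set xs \<subseteq> UNIV \<and> length xs \<le> n})"
    by (intro finite_imageI finite_lists_length_le) simp
qed

lemma finite_poly_residues:
  assumes "f \<noteq> 0" shows "finite (range (\<lambda>p :: 'a::{field, finite} poly. p mod f))"
proof (rule finite_subset)
  show "range (\<lambda>p. p mod f) \<subseteq> insert 0 {p. degree p < degree f}"
    using degree_mod_less[OF assms] by auto
qed (simp add: finite_poly_degree_less)

text \<open>There are finitely many residues, so two powers of p agree modulo f, and coprimality
  cancels the smaller one.\<close>

lemma poly_power_eq_1:
  fixes f p :: "'a::{field, finite} poly"
  assumes "f \<noteq> 0" "Rings.coprime f p" shows "\<exists>n>0. f dvd p ^ n - 1"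
proof -
  have "finite (range (\<lambda>n. p ^ n mod f))"
    by (rule finite_subset[OF _ finite_poly_residues[OF assms(1)]]) auto
  then have "\<not> inj (\<lambda>n::nat. p ^ n mod f)"
    using finite_imageD infinite_UNIV_nat by blast
  then obtain i j where ij: "i < j" "p ^ i mod f = p ^ j mod f"
    unfolding inj_def by (metis linorder_neqE_nat)
  have "f dvd p ^ j - p ^ i" using ij(2) by (metis mod_eq_dvd_iff)
  moreover have "p ^ j - p ^ i = p ^ i * (p ^ (j - i) - 1)"
    using ij(1) by (simp add: right_diff_distrib power_add[symmetric])
  ultimately have "f dvd p ^ (j - i) - 1"
    using poly_coprime_dvd_mult[OF poly_coprime_power[OF assms(2)]] by metis
  then show ?thesis using ij(1) by (intro exI[of _ "j - i"]) simp
qed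

text \<open>Each pair excludes at most one constant: if c and c' were both excluded, s would divide
  \<open>b * [:c - c':]\<close> with a unit as second factor, hence b, and then also a. The pair
  \<open>(0, 1)\<close> is the way to demand that c itself be a unit modulo s.\<close>

lemma const_avoid:
  fixes s :: "'a::{field, finite} poly"
  assumes irr: "Factorial_Ring.irreducible s" and P: "finite P" "card P < CARD('a)"
    and nz: "\<And>a b. (a, b) \<in> P \<Longrightarrow> \<not> (s dvd a \<and> s dvd b)"
  shows "\<exists>c. \<forall>(a, b) \<in> P. \<not> s dvd a + b * [:c:]"
proof -
  define bad where "bad p = {c. s dvd fst p + snd p * [:c:]}" for p
  have "card (bad p) \<le> 1" if p: "p \<in> P" for p
  proof -
    have "c = c'" if "c \<in> bad p" "c' \<in> bad p" for c c'
    proof (rule ccontr)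
      assume "c \<noteq> c'"
      have "s dvd (fst p + snd p * [:c:]) - (fst p + snd p * [:c':])"
        using that by (intro dvd_diff) (auto simp: bad_def)
      also have "\<dots> = snd p * [:c - c':]" by (simp add: algebra_simps smult_diff_left)
      finally have "s dvd snd p * [:c - c':]" .
      moreover have "is_unit [:c - c':]" using \<open>c \<noteq> c'\<close> by (simp add: is_unit_pCons_iff)
      ultimately have 1: "s dvd snd p" by (metis dvd_mult_unit_iff)
      then have "s dvd snd p * [:c:]" by (rule dvd_mult2)
      moreover have "s dvd fst p + snd p * [:c:]" using that by (auto simp: bad_def)
      ultimately have "s dvd fst p" using dvd_add_left_iff by blast
      with 1 nz[of "fst p" "snd p"] p show False by simp
    qed
    then show ?thesis by (simp add: card_le_Suc0_iff_eq)
  qed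
  then have "card (\<Union>p\<in>P. bad p) \<le> card P"
    using card_UN_le[OF P(1), of bad] sum_bounded_above[of P "\<lambda>p. card (bad p)" 1] by simp
  then have "(\<Union>p\<in>P. bad p) \<noteq> UNIV" using P(2) by auto
  then show ?thesis by (fastforce simp: bad_def)
qed

section \<open>Frobenius, and the cyclic unit group of a residue field\<close>

lemma CHAR_poly_eq: "CHAR('a::comm_semiring_1 poly) = CHAR('a)"
proof (rule CHAR_eqI)
  show "of_nat CHAR('a) = (0 :: 'a poly)" by (simp add: of_nat_poly)
  show "CHAR('a) dvd x" if "of_nat x = (0 :: 'a poly)" for x
    using that by (simp add: of_nat_poly of_nat_eq_0_iff_char_dvd)
qed

lemma prime_CHAR: "Factorial_Ring.prime CHAR('a::{field, finite})"
  using prime_CHAR_semidom[where 'a = 'a] finite_imp_CHAR_pos[where 'a = 'a] by simp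

lemma poly_diff_power_CHAR:
  fixes x y :: "'a::{field, finite} poly"
  shows "(x - y) ^ CHAR('a) ^ n = x ^ CHAR('a) ^ n - y ^ CHAR('a) ^ n"
proof -
  have "Factorial_Ring.prime CHAR('a poly)" using prime_CHAR[where 'a = 'a] by (simp add: CHAR_poly_eq)
  then have "((x - y) + y) ^ CHAR('a poly) ^ n = (x - y) ^ CHAR('a poly) ^ n + y ^ CHAR('a poly) ^ n"
    by (rule freshmans_dream') simp
  then show ?thesis by (simp add: CHAR_poly_eq algebra_simps)
qed

text \<open>The remainders modulo s are made into a ring structure so that the theorem on the cyclic
  multiplicative group of a finite field applies to them.\<close>

lemma residue_field_generator:
  fixes s :: "'a::{field, finite} poly"
  assumes irr: "Factorial_Ring.irreducible s"
  shows "\<exists>g. \<not> s dvd g \<and> (\<forall>t. \<not> s dvd t \<longrightarrow> (\<exists>i. [t = g ^ i] (mod s)))"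
proof -
  define R where "R = \<lparr>carrier = range (\<lambda>p. p mod s), monoid.mult = (\<lambda>a b. a * b mod s),
     one = 1 mod s, ring.zero = 0, ring.add = (\<lambda>a b. (a + b) mod s)\<rparr>"
  have R: "carrier R = range (\<lambda>p. p mod s)" "monoid.mult R = (\<lambda>a b. a * b mod s)" "monoid.one R = 1 mod s"
    "ring.zero R = 0" "ring.add R = (\<lambda>a b. (a + b) mod s)" by (simp_all add: R_def)
  have s1: "\<not> s dvd 1" "s \<noteq> 0" using irr by (auto simp: Factorial_Ring.irreducible_def)
  interpret R: cring R
  proof (rule cringI)
    show "abelian_group R"
    proof (rule abelian_groupI)
      fix x assume "x \<in> carrier R"
      then obtain p where p: "x = p mod s" by (auto simp: R)
      have "(- p) mod s \<in> carrier R" unfolding R by blast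
      moreover have "(- p) mod s \<oplus>\<^bsub>R\<^esub> x = \<zero>\<^bsub>R\<^esub>" by (simp add: R p mod_add_eq)
      ultimately show "\<exists>y\<in>carrier R. y \<oplus>\<^bsub>R\<^esub> x = \<zero>\<^bsub>R\<^esub>" ..
    next
      fix x y z
      show "x \<oplus>\<^bsub>R\<^esub> y \<oplus>\<^bsub>R\<^esub> z = x \<oplus>\<^bsub>R\<^esub> (y \<oplus>\<^bsub>R\<^esub> z)"
        unfolding R by (simp add: mod_simps add.assoc)
    qed (auto simp: R add.commute intro: range_eqI[of _ _ 0])
    show "comm_monoid R"
    proof (rule comm_monoidI)
      fix x y z
      show "x \<otimes>\<^bsub>R\<^esub> y \<otimes>\<^bsub>R\<^esub> z = x \<otimes>\<^bsub>R\<^esub> (y \<otimes>\<^bsub>R\<^esub> z)"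
        unfolding R by (simp add: mod_simps mult.assoc)
    qed (auto simp: R mod_simps mult.commute)
  next
    fix x y z
    show "(x \<oplus>\<^bsub>R\<^esub> y) \<otimes>\<^bsub>R\<^esub> z = x \<otimes>\<^bsub>R\<^esub> z \<oplus>\<^bsub>R\<^esub> y \<otimes>\<^bsub>R\<^esub> z"
      unfolding R by (simp add: mod_simps distrib_right)
  qed
  interpret R: field R
  proof (rule R.cring_fieldI2)
    show "\<zero>\<^bsub>R\<^esub> \<noteq> \<one>\<^bsub>R\<^esub>" using s1 by (auto simp: R dvd_eq_mod_eq_0)
    fix a assume "a \<in> carrier R" "a \<noteq> \<zero>\<^bsub>R\<^esub>"
    then have a: "\<not> s dvd a" by (auto simp: R dvd_eq_mod_eq_0)
    then have "Rings.coprime a s" using poly_coprime_iff_prime[OF irr] by (simp add: coprime_commute)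
    from poly_cong_inverse[OF this] obtain b where "[a * b = 1] (mod s)" ..
    then show "\<exists>b\<in>carrier R. a \<otimes>\<^bsub>R\<^esub> b = \<one>\<^bsub>R\<^esub>"
      by (intro bexI[of _ "b mod s"]) (auto simp: R cong_def mod_simps)
  qed
  have "finite (carrier R)" unfolding R using s1 by (intro finite_poly_residues)
  from R.finite_field_mult_group_has_gen[OF this] obtain g where
    g: "g \<in> carrier (Multiplicative_Group.mult_of R)" "carrier (Multiplicative_Group.mult_of R) = {g [^]\<^bsub>R\<^esub> i | i::nat. i \<in> UNIV}"
    by (elim bexE) (rule that)
  have pow: "g [^]\<^bsub>R\<^esub> i = g ^ i mod s" for i :: nat
    by (induction i) (simp_all add: R mod_simps mult.commute)
  have gs: "\<not> s dvd g" using g(1) by (auto simp: R dvd_eq_mod_eq_0)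
  have "\<exists>i. [t = g ^ i] (mod s)" if t: "\<not> s dvd t" for t
  proof -
    have "t mod s \<in> carrier (Multiplicative_Group.mult_of R)" using t by (auto simp: R dvd_eq_mod_eq_0)
    then obtain i :: nat where "t mod s = g ^ i mod s" unfolding g(2) pow by auto
    then show ?thesis by (auto simp: cong_def)
  qed
  with gs show ?thesis by blast
qed

section \<open>Words in elementary matrices modulo a prime power\<close>

text \<open>
  In the abstract group \<open>Q\<close>, the elements \<open>e x\<close> and \<open>e' x\<close> play the role of the two kinds of elementary matrices
  over \<open>A/m\<close>, and \<open>rel g a b c d\<close> says that \<open>g\<close> reduces to the matrix with rows \<open>(a, b)\<close> and \<open>(c, d)\<close> modulo \<open>m\<close>.
\<close>

locale local_symbols = group Q for Q :: "('x, 'y) monoid_scheme" (structure) +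
  fixes s :: "'a::{field, finite} poly" and k :: nat
    and e e' :: "'a poly \<Rightarrow> 'x"
    and rel :: "'x \<Rightarrow> 'a poly \<Rightarrow> 'a poly \<Rightarrow> 'a poly \<Rightarrow> 'a poly \<Rightarrow> bool"
    and m :: "'a poly"
  assumes m_def: "m = s ^ k" and irr: "Factorial_Ring.irreducible s" and k: "k > 0"
    and card: "CARD('a) > 3"
    and e_closed [simp]: "e x \<in> carrier Q" and e'_closed [simp]: "e' x \<in> carrier Q"
    and e_add: "e (x + y) = e x \<otimes> e y" and e'_add: "e' (x + y) = e' x \<otimes> e' y"
    and e_one: "m dvd x \<Longrightarrow> e x = \<one>" and e'_one: "m dvd x \<Longrightarrow> e' x = \<one>"
    and W_rel: "[z * z' = 1] (mod m) \<Longrightarrow>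
      (e z \<otimes> e' (- z') \<otimes> e z) \<otimes> e x = e' (- (z'^2 * x)) \<otimes> (e z \<otimes> e' (- z') \<otimes> e z)"
    and rel_mult: "g \<in> carrier Q \<Longrightarrow> g' \<in> carrier Q \<Longrightarrow> rel g a b c d \<Longrightarrow> rel g' a' b' c' d' \<Longrightarrow>
      rel (g \<otimes> g') (a * a' + b * c') (a * b' + b * d') (c * a' + d * c') (c * b' + d * d')"
    and rel_e: "rel (e x) 1 x 0 1" and rel_e': "rel (e' x) 1 0 x 1"
    and rel_inv: "g \<in> carrier Q \<Longrightarrow> rel g a b c d \<Longrightarrow> rel (inv g) d (- b) (- c) a"
    and rel_one: "rel \<one> 1 0 0 1"
    and rel_unique: "rel g a b c d \<Longrightarrow> rel g a' b' c' d' \<Longrightarrow>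
      [a = a'] (mod m) \<and> [b = b'] (mod m) \<and> [c = c'] (mod m) \<and> [d = d'] (mod m)"
    and rel_cong: "rel g a b c d \<Longrightarrow> [a = a'] (mod m) \<Longrightarrow> [b = b'] (mod m) \<Longrightarrow> [c = c'] (mod m) \<Longrightarrow>
      [d = d'] (mod m) \<Longrightarrow> rel g a' b' c' d'"
    and no_2_torsion: "g \<in> carrier Q \<Longrightarrow> rel g 1 0 0 1 \<Longrightarrow> g \<otimes> g = \<one> \<Longrightarrow> g = \<one>"
    and no_p_torsion: "g \<in> carrier Q \<Longrightarrow> rel g 1 0 0 1 \<Longrightarrow> g [^] CHAR('a) = \<one> \<Longrightarrow> g = \<one>"
begin

section \<open>Units modulo \<open>m\<close> and their inverses\<close>

lemma prime_s: "prime_elem s"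
  using irr by (rule field_poly_irreducible_imp_prime)

lemma s_dvd_m: "s dvd m"
  using k by (simp add: m_def dvd_power)

lemma not_s_dvd_1: "\<not> s dvd 1"
  using irr by (simp add: Factorial_Ring.irreducible_def)

lemma unit_cong: "[a = b] (mod m) \<Longrightarrow> s dvd a \<longleftrightarrow> s dvd b"
  using s_dvd_m by (meson cong_dvd_iff cong_dvd_modulus)

lemma unit_mult: "\<not> s dvd a * b \<longleftrightarrow> \<not> s dvd a \<and> \<not> s dvd b"
  using prime_s by (simp add: prime_elem_dvd_mult_iff)

definition iv :: "'a poly \<Rightarrow> 'a poly" where "iv z = (SOME z'. [z * z' = 1] (mod m))"

lemma iv: assumes "\<not> s dvd z" shows "[z * iv z = 1] (mod m)"
proof -
  have "Rings.coprime z m"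
    using assms irr by (simp add: m_def poly_coprime_power poly_coprime_iff_prime[symmetric] coprime_commute)
  then have "\<exists>z'. [z * z' = 1] (mod m)" by (rule poly_cong_inverse)
  then show ?thesis unfolding iv_def by (rule someI_ex)
qed

lemma unit_of_inverse: "[z * z' = 1] (mod m) \<Longrightarrow> \<not> s dvd z \<and> \<not> s dvd z'"
  using unit_cong[of "z * z'" 1] not_s_dvd_1 unit_mult by blast

lemma unit_iv: "\<not> s dvd z \<Longrightarrow> \<not> s dvd iv z"
  using iv unit_of_inverse by blast

lemma inverse_unique:
  assumes "[z * a = 1] (mod m)" "[z * b = 1] (mod m)" shows "[a = b] (mod m)"
proof -
  have "[a * (z * b) = a * 1] (mod m)" "[(z * a) * b = 1 * b] (mod m)"
    using assms by (blast intro: cong_mult cong_refl)+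
  then show ?thesis
    by (metis cong_sym cong_trans mult.left_commute mult.commute mult_1 mult.right_neutral)
qed

lemma iv_eqI: assumes "[z * a = 1] (mod m)" shows "[iv z = a] (mod m)"
  using inverse_unique[OF iv assms] unit_of_inverse[OF assms] by blast

lemma iv_iv: "\<not> s dvd z \<Longrightarrow> [iv (iv z) = z] (mod m)"
  using iv[of z] by (intro iv_eqI) (simp add: mult.commute)

lemma iv_uminus: "\<not> s dvd z \<Longrightarrow> [iv (- z) = - iv z] (mod m)"
  using iv[of z] by (intro iv_eqI) simp

lemma iv_one: "[iv 1 = 1] (mod m)"
  by (rule iv_eqI) simp

lemma iv_mult:
  assumes "\<not> s dvd a" "\<not> s dvd b" shows "[iv (a * b) = iv a * iv b] (mod m)"
proof (rule iv_eqI)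
  have "[(a * iv a) * (b * iv b) = 1 * 1] (mod m)" using assms by (intro cong_mult iv)
  then show "[a * b * (iv a * iv b) = 1] (mod m)" by (simp add: ac_simps)
qed

lemma sq_iv: assumes "\<not> s dvd a" shows "[a^2 * (iv a)^2 * x = x] (mod m)"
proof -
  have "[(a * iv a)^2 * x = 1^2 * x] (mod m)" using assms by (intro cong_mult cong_pow iv cong_refl)
  then show ?thesis by (simp add: power_mult_distrib)
qed

section \<open>Elementary, Weyl and torus elements\<close>

lemma e_cong: assumes "[x = y] (mod m)" shows "e x = e y"
proof -
  have "m dvd x - y" using assms by (simp add: cong_iff_dvd_diff)
  then have "e (x - y) = \<one>" by (rule e_one)
  moreover have "e x = e (x - y) \<otimes> e y" by (metis diff_add_cancel e_add)
  ultimately show ?thesis by simp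
qed

lemma e'_cong: assumes "[x = y] (mod m)" shows "e' x = e' y"
proof -
  have "m dvd x - y" using assms by (simp add: cong_iff_dvd_diff)
  then have "e' (x - y) = \<one>" by (rule e'_one)
  moreover have "e' x = e' (x - y) \<otimes> e' y" by (metis diff_add_cancel e'_add)
  ultimately show ?thesis by simp
qed

lemma e_0 [simp]: "e 0 = \<one>" and e'_0 [simp]: "e' 0 = \<one>"
  by (simp_all add: e_one e'_one)

lemma e_merge: "e x \<otimes> e y = e (x + y)" "e' x \<otimes> e' y = e' (x + y)"
  "g \<in> carrier Q \<Longrightarrow> e x \<otimes> (e y \<otimes> g) = e (x + y) \<otimes> g"
  "g \<in> carrier Q \<Longrightarrow> e' x \<otimes> (e' y \<otimes> g) = e' (x + y) \<otimes> g"
  by (simp_all add: e_add e'_add m_assoc)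

lemma inv_e [simp]: "inv (e x) = e (- x)" and inv_e' [simp]: "inv (e' x) = e' (- x)"
  by (rule inv_equality; simp add: e_merge)+

lemma cancel [simp]:
  "x \<in> carrier Q \<Longrightarrow> g \<in> carrier Q \<Longrightarrow> inv x \<otimes> (x \<otimes> g) = g"
  "x \<in> carrier Q \<Longrightarrow> g \<in> carrier Q \<Longrightarrow> x \<otimes> (inv x \<otimes> g) = g"
  by (simp_all add: m_assoc[symmetric])

text \<open>A lift of the Weyl element with rows (0, z) and (-1/z, 0).\<close>

definition W :: "'a poly \<Rightarrow> 'x" where "W z = e z \<otimes> e' (- iv z) \<otimes> e z"

lemma W_closed [simp]: "W z \<in> carrier Q"
  by (simp add: W_def)

lemma W_eq: assumes "[z * z' = 1] (mod m)" shows "W z = e z \<otimes> e' (- z') \<otimes> e z"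
proof -
  have "[- iv z = - z'] (mod m)" using iv_eqI[OF assms] by (simp add: cong_minus_minus_iff)
  then show ?thesis unfolding W_def by (simp add: e'_cong)
qed

lemma W_cong: assumes "[z = z'] (mod m)" "\<not> s dvd z" shows "W z = W z'"
proof -
  have "[z' * iv z = 1] (mod m)"
    using iv[OF assms(2)] assms(1) by (meson cong_scalar_right cong_sym cong_trans)
  from W_eq[OF this] show ?thesis by (simp add: W_def e_cong[OF assms(1)])
qed

lemma W_e: "\<not> s dvd z \<Longrightarrow> W z \<otimes> e x = e' (- ((iv z)^2 * x)) \<otimes> W z"
  unfolding W_def by (rule W_rel[OF iv])

lemma inv_W: assumes "\<not> s dvd z" shows "inv (W z) = W (- z)"
proof -
  have "[- z * - iv z = 1] (mod m)" using iv[OF assms] by simp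
  from W_eq[OF this] show ?thesis by (simp add: W_def inv_mult_group m_assoc)
qed

text \<open>The assumption \<open>W_rel\<close> conjugates \<open>e x\<close> only. Replacing z by
  -z inverts \<open>W z\<close>, and the relation read backwards conjugates the other
  family.\<close>

lemma W_e': assumes z: "\<not> s dvd z" shows "W z \<otimes> e' y = e (- (z^2 * y)) \<otimes> W z"
proof -
  define x where "x = - (z^2 * y)"
  have *: "W (- z) \<otimes> e x = e' (- ((iv (- z))^2 * x)) \<otimes> W (- z)"
    using z by (intro W_e) simp
  have "[(iv (- z))^2 = (- iv z)^2] (mod m)"
    using iv_uminus[OF z] by (rule cong_pow)
  then have "[- ((iv (- z))^2 * x) = - ((iv z)^2 * x)] (mod m)"
    by (simp add: cong_minus_minus_iff cong_scalar_right)
  also have "- ((iv z)^2 * x) = z^2 * (iv z)^2 * y" by (simp add: x_def mult.commute)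
  finally have "[- ((iv (- z))^2 * x) = y] (mod m)" using sq_iv[OF z] cong_trans by blast
  with * have "W (- z) \<otimes> e x = e' y \<otimes> W (- z)" by (simp add: e'_cong)
  then have "inv (W z) \<otimes> e x = e' y \<otimes> inv (W z)" using z by (simp add: inv_W)
  then have "W z \<otimes> (inv (W z) \<otimes> e x) \<otimes> W z = W z \<otimes> (e' y \<otimes> inv (W z)) \<otimes> W z" by simp
  then show ?thesis by (simp add: m_assoc x_def)
qed

text \<open>Moving one factor \<open>e z\<close> across \<open>W z\<close> turns it into
  \<open>e' (- iv z)\<close>. Cancelling the last factor of \<open>W z\<close> then leaves the
  factorisation with the two families exchanged.\<close>

lemma W_alt: assumes z: "\<not> s dvd z" shows "W z = e' (- iv z) \<otimes> e z \<otimes> e' (- iv z)"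
proof -
  have "[iv z * (z * iv z) = iv z * 1] (mod m)" using iv[OF z] by (rule cong_scalar_left)
  then have "[- ((iv z)^2 * z) = - iv z] (mod m)"
    by (simp add: cong_minus_minus_iff power2_eq_square ac_simps)
  with W_e[OF z, of z] have "W z \<otimes> e z = e' (- iv z) \<otimes> W z" by (simp add: e'_cong)
  then have "W z \<otimes> e z \<otimes> e (- z) = e' (- iv z) \<otimes> W z \<otimes> e (- z)" by simp
  moreover have "W z \<otimes> e z \<otimes> e (- z) = W z" by (simp add: m_assoc e_merge)
  ultimately have "W z = e' (- iv z) \<otimes> W z \<otimes> e (- z)" by simp
  also have "\<dots> = e' (- iv z) \<otimes> (e z \<otimes> (e' (- iv z) \<otimes> (e z \<otimes> e (- z))))"
    by (simp only: W_def m_assoc m_closed e_closed e'_closed)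
  finally show ?thesis by (simp add: e_merge m_assoc)
qed

text \<open>As \<open>W (- 1)\<close> inverts \<open>W 1\<close>, this is a lift of diag(z, 1/z)
  that is normalised at z = 1.\<close>

definition h :: "'a poly \<Rightarrow> 'x" where "h z = W z \<otimes> W (- 1)"

lemma h_closed [simp]: "h z \<in> carrier Q"
  by (simp add: h_def)

lemma W_m1: "W (- 1) = inv (W 1)"
  using inv_W[of 1] not_s_dvd_1 by simp

lemma rel_W: assumes z: "\<not> s dvd z" shows "rel (W z) 0 z (- iv z) 0"
proof -
  have "rel (W z) ((1 * 1 + z * - iv z) * 1 + (1 * 0 + z * 1) * 0) ((1 * 1 + z * - iv z) * z + (1 * 0 + z * 1) * 1)
     ((0 * 1 + 1 * - iv z) * 1 + (0 * 0 + 1 * 1) * 0) ((0 * 1 + 1 * - iv z) * z + (0 * 0 + 1 * 1) * 1)"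
    unfolding W_def by (intro rel_mult rel_e rel_e' m_closed e_closed e'_closed)
  moreover have *: "[1 - z * iv z = 0] (mod m)"
    using iv[OF z] by (simp add: cong_iff_dvd_diff dvd_diff_commute)
  moreover have "[(1 - z * iv z) * z + z = 0 * z + z] (mod m)"
    using * by (intro cong_add cong_mult cong_refl)
  ultimately show ?thesis by (elim rel_cong) (simp_all add: mult.commute)
qed

lemma rel_h: assumes z: "\<not> s dvd z" shows "rel (h z) z 0 0 (iv z)"
proof -
  have "\<not> s dvd - 1" using not_s_dvd_1 by simp
  from rel_mult[OF _ _ rel_W[OF z] rel_W[OF this]]
  have r: "rel (h z) (0 * 0 + z * - iv (- 1)) (0 * - 1 + z * 0) (- iv z * 0 + 0 * - iv (- 1)) (- iv z * - 1 + 0 * 0)"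
    by (simp add: h_def)
  have "[- iv (- 1) = 1] (mod m)"
    using iv_eqI[of "-1" "-1"] by (metis cong_minus_minus_iff cong_refl minus_minus mult_minus1)
  then have "[z * - iv (- 1) = z * 1] (mod m)" by (rule cong_scalar_left)
  with r show ?thesis by (elim rel_cong) simp_all
qed

lemma h_e: assumes z: "\<not> s dvd z" shows "h z \<otimes> e x = e (z^2 * x) \<otimes> h z"
proof -
  have m1: "\<not> s dvd - 1" using not_s_dvd_1 by simp
  have "[(iv (- 1))^2 * x = x] (mod m)" using sq_iv[OF m1, of x] by simp
  then have 1: "W (- 1) \<otimes> e x = e' (- x) \<otimes> W (- 1)"
    using W_e[OF m1, of x] e'_cong cong_minus_minus_iff by metis
  have "h z \<otimes> e x = W z \<otimes> (W (- 1) \<otimes> e x)" by (simp add: h_def m_assoc)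
  also have "\<dots> = W z \<otimes> e' (- x) \<otimes> W (- 1)" by (simp add: 1 m_assoc)
  also have "\<dots> = e (z^2 * x) \<otimes> W z \<otimes> W (- 1)" by (simp add: W_e'[OF z])
  finally show ?thesis by (simp add: h_def m_assoc)
qed

lemma h_e': assumes z: "\<not> s dvd z" shows "h z \<otimes> e' x = e' ((iv z)^2 * x) \<otimes> h z"
proof -
  have m1: "\<not> s dvd - 1" using not_s_dvd_1 by simp
  have 1: "W (- 1) \<otimes> e' x = e (- x) \<otimes> W (- 1)"
    using W_e'[OF m1, of x] by simp
  have "h z \<otimes> e' x = W z \<otimes> (W (- 1) \<otimes> e' x)" by (simp add: h_def m_assoc)
  also have "\<dots> = W z \<otimes> e (- x) \<otimes> W (- 1)" by (simp add: 1 m_assoc)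
  also have "\<dots> = e' ((iv z)^2 * x) \<otimes> W z \<otimes> W (- 1)" by (simp add: W_e[OF z])
  finally show ?thesis by (simp add: h_def m_assoc)
qed

text \<open>Words in torus elements and their inverses. Multiplicativity of \<open>h\<close> is the
  goal and not yet available, so different words may share a diagonal entry; the first argument
  records that entry as an unreduced product of representatives.\<close>

inductive Hs :: "'a poly \<Rightarrow> 'x \<Rightarrow> bool" where
  Hs_one: "Hs 1 \<one>"
| Hs_h: "\<not> s dvd z \<Longrightarrow> Hs t g \<Longrightarrow> Hs (z * t) (h z \<otimes> g)"
| Hs_inv: "\<not> s dvd z \<Longrightarrow> Hs t g \<Longrightarrow> Hs (iv z * t) (inv (h z) \<otimes> g)"

abbreviation Y :: "'x set" where "Y \<equiv> generate Q (range e \<union> range e')"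

lemma e_Y [simp]: "e x \<in> Y" and e'_Y [simp]: "e' x \<in> Y"
  by (auto intro: generate.incl)

lemma Y_carrier: "g \<in> Y \<Longrightarrow> g \<in> carrier Q"
  using generate_in_carrier[of "range e \<union> range e'" g] by (simp add: image_subset_iff)

lemma Y_mult: "g \<in> Y \<Longrightarrow> g' \<in> Y \<Longrightarrow> g \<otimes> g' \<in> Y"
  by (rule generate.eng)

lemma Y_inv: "g \<in> Y \<Longrightarrow> inv g \<in> Y"
  using generate_m_inv_closed[of "range e \<union> range e'" g] by (simp add: image_subset_iff)

lemma h_Y [simp]: "h z \<in> Y"
  by (simp add: h_def W_def Y_mult)

lemma swap_inv:
  assumes "g \<in> carrier Q" "a \<in> carrier Q" "b \<in> carrier Q" "g \<otimes> a = b \<otimes> g"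
  shows "inv g \<otimes> b = a \<otimes> inv g"
proof -
  have "inv g \<otimes> b = inv g \<otimes> (b \<otimes> g) \<otimes> inv g" using assms(1-3) by (simp add: m_assoc)
  also have "\<dots> = inv g \<otimes> (g \<otimes> a) \<otimes> inv g" by (simp add: assms(4))
  finally show ?thesis using assms(1-3) by (simp add: m_assoc)
qed

lemma Hs_props:
  assumes "Hs t g"
  shows "\<not> s dvd t" "g \<in> Y" "g \<in> carrier Q" "g \<otimes> e x = e (t^2 * x) \<otimes> g"
    "g \<otimes> e' x = e' ((iv t)^2 * x) \<otimes> g" "rel g t 0 0 (iv t)"
proof -
  have "\<not> s dvd t \<and> g \<in> Y \<and> (\<forall>x. g \<otimes> e x = e (t^2 * x) \<otimes> g)
     \<and> (\<forall>x. g \<otimes> e' x = e' ((iv t)^2 * x) \<otimes> g) \<and> rel g t 0 0 (iv t)"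
    using assms
  proof induction
    case Hs_one
    have "e' ((iv 1)^2 * x) = e' (1^2 * x)" for x
      using iv_one by (intro e'_cong cong_mult cong_pow cong_refl)
    moreover have "rel \<one> 1 0 0 (iv 1)"
      by (rule rel_cong[OF rel_one]) (simp_all add: cong_sym[OF iv_one])
    ultimately show ?case using not_s_dvd_1 by (simp add: generate.one)
  next
    case (Hs_h z t g)
    then have g: "g \<in> carrier Q" using Y_carrier by blast
    have iv: "[iv (z * t) = iv z * iv t] (mod m)" using Hs_h by (intro iv_mult) auto
    have 1: "h z \<otimes> g \<otimes> e x = e ((z * t)^2 * x) \<otimes> (h z \<otimes> g)" for x
    proof -
      have "h z \<otimes> g \<otimes> e x = h z \<otimes> e (t^2 * x) \<otimes> g" using Hs_h g by (simp add: m_assoc)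
      also have "\<dots> = e (z^2 * (t^2 * x)) \<otimes> (h z \<otimes> g)" using Hs_h g by (simp add: h_e m_assoc)
      finally show ?thesis by (simp add: power_mult_distrib mult.assoc)
    qed
    have 2: "h z \<otimes> g \<otimes> e' x = e' ((iv (z * t))^2 * x) \<otimes> (h z \<otimes> g)" for x
    proof -
      have "h z \<otimes> g \<otimes> e' x = h z \<otimes> e' ((iv t)^2 * x) \<otimes> g" using Hs_h g by (simp add: m_assoc)
      also have "\<dots> = e' ((iv z)^2 * ((iv t)^2 * x)) \<otimes> (h z \<otimes> g)" using Hs_h g by (simp add: h_e' m_assoc)
      also have "(iv z)^2 * ((iv t)^2 * x) = (iv z * iv t)^2 * x" by (simp add: power_mult_distrib mult.assoc)
      also have "e' \<dots> = e' ((iv (z * t))^2 * x)"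
        using iv by (intro e'_cong cong_mult cong_pow cong_refl) (simp add: cong_sym)
      finally show ?thesis .
    qed
    have "rel (h z \<otimes> g) (z * t + 0 * 0) (z * 0 + 0 * iv t) (0 * t + iv z * 0) (0 * 0 + iv z * iv t)"
      using Hs_h g by (intro rel_mult rel_h h_closed) auto
    then have "rel (h z \<otimes> g) (z * t) 0 0 (iv (z * t))" by (rule rel_cong) (simp_all add: cong_sym iv)
    with 1 2 Hs_h show ?case by (simp add: unit_mult Y_mult del: dvd_mult dvd_mult2)
  next
    case (Hs_inv z t g)
    then have g: "g \<in> carrier Q" using Y_carrier by blast
    have uz: "\<not> s dvd iv z" using Hs_inv by (intro unit_iv)
    have ivz: "[iv (iv z) = z] (mod m)" using Hs_inv by (intro iv_iv) auto
    have iv': "[iv (iv z * t) = iv (iv z) * iv t] (mod m)" using Hs_inv uz by (intro iv_mult) auto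
    then have iv: "[iv (iv z * t) = z * iv t] (mod m)"
      using ivz by (meson cong_scalar_right cong_trans)
    have 1: "inv (h z) \<otimes> g \<otimes> e x = e ((iv z * t)^2 * x) \<otimes> (inv (h z) \<otimes> g)" for x
    proof -
      have "h z \<otimes> e ((iv z)^2 * (t^2 * x)) = e (z^2 * ((iv z)^2 * (t^2 * x))) \<otimes> h z"
        using Hs_inv by (simp add: h_e)
      also have "e (z^2 * ((iv z)^2 * (t^2 * x))) = e (t^2 * x)"
        using sq_iv[of z "t^2 * x"] Hs_inv by (intro e_cong) (simp add: mult.assoc)
      finally have *: "inv (h z) \<otimes> e (t^2 * x) = e ((iv z)^2 * (t^2 * x)) \<otimes> inv (h z)"
        by (intro swap_inv) simp_all
      have "inv (h z) \<otimes> g \<otimes> e x = inv (h z) \<otimes> e (t^2 * x) \<otimes> g" using Hs_inv g by (simp add: m_assoc)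
      also have "\<dots> = e ((iv z)^2 * (t^2 * x)) \<otimes> (inv (h z) \<otimes> g)" using g by (simp add: * m_assoc)
      finally show ?thesis by (simp add: power_mult_distrib mult.assoc)
    qed
    have 2: "inv (h z) \<otimes> g \<otimes> e' x = e' ((iv (iv z * t))^2 * x) \<otimes> (inv (h z) \<otimes> g)" for x
    proof -
      have "h z \<otimes> e' (z^2 * ((iv t)^2 * x)) = e' ((iv z)^2 * (z^2 * ((iv t)^2 * x))) \<otimes> h z"
        using Hs_inv by (simp add: h_e')
      also have "e' ((iv z)^2 * (z^2 * ((iv t)^2 * x))) = e' ((iv t)^2 * x)"
        using sq_iv[of z "(iv t)^2 * x"] Hs_inv by (intro e'_cong) (simp add: ac_simps)
      finally have *: "inv (h z) \<otimes> e' ((iv t)^2 * x) = e' (z^2 * ((iv t)^2 * x)) \<otimes> inv (h z)"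
        by (intro swap_inv) simp_all
      have "inv (h z) \<otimes> g \<otimes> e' x = inv (h z) \<otimes> e' ((iv t)^2 * x) \<otimes> g" using Hs_inv g by (simp add: m_assoc)
      also have "\<dots> = e' (z^2 * ((iv t)^2 * x)) \<otimes> (inv (h z) \<otimes> g)" using g by (simp add: * m_assoc)
      also have "z^2 * ((iv t)^2 * x) = (z * iv t)^2 * x" by (simp add: power_mult_distrib mult.assoc)
      also have "e' \<dots> = e' ((iv (iv z * t))^2 * x)"
        using iv by (intro e'_cong cong_mult cong_pow cong_refl) (simp add: cong_sym)
      finally show ?thesis .
    qed
    have "rel (inv (h z)) (iv z) (- 0) (- 0) z"
      using Hs_inv by (intro rel_inv rel_h h_closed) auto
    then have "rel (inv (h z) \<otimes> g) (iv z * t + - 0 * 0) (iv z * 0 + - 0 * iv t) (- 0 * t + z * 0) (- 0 * 0 + z * iv t)"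
      using Hs_inv g by (intro rel_mult) auto
    then have "rel (inv (h z) \<otimes> g) (iv z * t) 0 0 (iv (iv z * t))" by (rule rel_cong) (simp_all add: cong_sym iv)
    with 1 2 Hs_inv uz show ?case by (simp add: unit_mult Y_mult Y_inv del: dvd_mult dvd_mult2)
  qed
  then show "\<not> s dvd t" "g \<in> Y" "g \<in> carrier Q" "g \<otimes> e x = e (t^2 * x) \<otimes> g"
    "g \<otimes> e' x = e' ((iv t)^2 * x) \<otimes> g" "rel g t 0 0 (iv t)"
    using Y_carrier by blast+
qed

lemma Hs_mult: "Hs t g \<Longrightarrow> Hs t' g' \<Longrightarrow> Hs (t * t') (g \<otimes> g')"
proof (induction rule: Hs.induct)
  case (Hs_h z t g)
  then have "Hs (z * (t * t')) (h z \<otimes> (g \<otimes> g'))" by (intro Hs.Hs_h)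
  then show ?case using Hs_h Hs_props(3) by (simp add: m_assoc mult.assoc)
next
  case (Hs_inv z t g)
  then have "Hs (iv z * (t * t')) (inv (h z) \<otimes> (g \<otimes> g'))" by (intro Hs.Hs_inv)
  then show ?case using Hs_inv Hs_props(3) by (simp add: m_assoc mult.assoc)
qed (simp add: Hs_props(3))

lemma Hs_single: "\<not> s dvd z \<Longrightarrow> Hs z (h z)"
  using Hs_h[OF _ Hs_one, of z] by simp

lemma Hs_inv_ex: assumes "Hs t g" shows "\<exists>t'. [t * t' = 1] (mod m) \<and> Hs t' (inv g)"
  using assms
proof (induction)
  case Hs_one
  then show ?case using Hs.Hs_one by (intro exI[of _ 1]) simp
next
  case (Hs_h z t g)
  then obtain t' where t': "[t * t' = 1] (mod m)" "Hs t' (inv g)" by blast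
  have "Hs (iv z) (inv (h z))" using Hs.Hs_inv[OF _ Hs.Hs_one, of z] Hs_h by simp
  with t' have "Hs (t' * iv z) (inv g \<otimes> inv (h z))" by (intro Hs_mult)
  moreover have "[(t * t') * (z * iv z) = 1 * 1] (mod m)" using t' Hs_h by (intro cong_mult iv)
  ultimately show ?case using Hs_h Hs_props(3)
    by (intro exI[of _ "t' * iv z"]) (simp add: inv_mult_group ac_simps)
next
  case (Hs_inv z t g)
  then obtain t' where t': "[t * t' = 1] (mod m)" "Hs t' (inv g)" by blast
  have "Hs z (h z)" using Hs_inv by (intro Hs_single)
  with t' have "Hs (t' * z) (inv g \<otimes> h z)" by (intro Hs_mult)
  moreover have "[(t * t') * (z * iv z) = 1 * 1] (mod m)" using t' Hs_inv by (intro cong_mult iv)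
  ultimately show ?case using Hs_inv Hs_props(3)
    by (intro exI[of _ "t' * z"]) (simp add: inv_mult_group ac_simps)
qed

section \<open>Normal form of words\<close>

lemma e'_e_units:
  assumes a: "\<not> s dvd a" and ya: "\<not> s dvd 1 + y * a"
  shows "\<exists>p t g q. Hs t g \<and> e' y \<otimes> e a = e p \<otimes> g \<otimes> e' q"
proof -
  \<comment> \<open>\<open>W_alt\<close> writes \<open>e a\<close> with \<open>e' (iv a)\<close> in
    front. That factor is absorbed into y, and the sum is a unit because \<open>a * r\<close> is
    congruent to \<open>1 + y * a\<close>.\<close>
  define r where "r = y + iv a"
  have "[y * a + a * iv a = y * a + 1] (mod m)" using iv[OF a] by (rule cong_add[OF cong_refl])
  then have "[a * r = 1 + y * a] (mod m)" by (simp add: r_def algebra_simps)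
  then have r: "\<not> s dvd r" using ya unit_cong unit_mult by blast
  have ur: "\<not> s dvd - iv r" using unit_iv[OF r] by simp
  have "[- iv (- iv r) = r] (mod m)"
    using iv_uminus[OF unit_iv[OF r]] iv_iv[OF r] by (metis cong_minus_minus_iff cong_trans minus_minus)
  then have er: "e' r = e (iv r) \<otimes> W (- iv r) \<otimes> e (iv r)"
    by (simp add: W_def e_merge m_assoc e'_cong)
  define y0 where "y0 = - ((iv a)^2 * iv r)"
  have "[a^2 * (iv a)^2 * iv r = iv r] (mod m)" by (rule sq_iv[OF a])
  then have "e (- (a^2 * y0)) = e (iv r)" by (intro e_cong) (simp add: y0_def mult.assoc)
  then have swap: "e (iv r) \<otimes> W a = W a \<otimes> e' y0" using W_e'[OF a, of y0] by simp
  \<comment> \<open>Two Weyl elements always combine to a torus word, because the factors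
    \<open>W (- 1)\<close> in the two \<open>h\<close> cancel.\<close>
  have WW: "W (- iv r) \<otimes> W a = h (- iv r) \<otimes> inv (h (- a))"
  proof -
    have "inv (h (- a)) = W 1 \<otimes> W a" using a inv_W[of "-a"] inv_W[of "-1"] not_s_dvd_1
      by (simp add: h_def inv_mult_group)
    then show ?thesis by (simp add: h_def m_assoc W_m1)
  qed
  have "e' y \<otimes> e a = e' r \<otimes> (W a \<otimes> e' (iv a))"
    by (simp add: W_alt[OF a] e_merge m_assoc r_def)
  also have "\<dots> = e (iv r) \<otimes> (W (- iv r) \<otimes> ((e (iv r) \<otimes> W a) \<otimes> e' (iv a)))"
    by (simp add: er m_assoc)
  also have "\<dots> = e (iv r) \<otimes> (W (- iv r) \<otimes> W a) \<otimes> e' (y0 + iv a)"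
    by (simp add: swap m_assoc e_merge)
  also have "\<dots> = e (iv r) \<otimes> (h (- iv r) \<otimes> inv (h (- a))) \<otimes> e' (y0 + iv a)"
    by (simp only: WW)
  finally have "e' y \<otimes> e a = e (iv r) \<otimes> (h (- iv r) \<otimes> inv (h (- a))) \<otimes> e' (y0 + iv a)" .
  moreover have "Hs (- iv r * iv (- a)) (h (- iv r) \<otimes> inv (h (- a)))"
    using Hs_mult[OF Hs_single[OF ur] Hs_inv[OF _ Hs_one, of "-a"]] a by simp
  ultimately show ?thesis by blast
qed

lemma rel_e'_e: "rel (e' y \<otimes> e a) 1 a y (1 + y * a)"
  using rel_mult[OF _ _ rel_e' rel_e, of y a] by (simp add: add.commute)

lemma rel_eHe':
  assumes "Hs t g" shows "rel (e p \<otimes> g \<otimes> e' q) (t + p * iv t * q) (p * iv t) (iv t * q) (iv t)"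
proof -
  have "rel (e p \<otimes> g) (1 * t + p * 0) (1 * 0 + p * iv t) (0 * t + 1 * 0) (0 * 0 + 1 * iv t)"
    using Hs_props[OF assms] by (intro rel_mult rel_e) auto
  then have "rel (e p \<otimes> g \<otimes> e' q) (t * 1 + (p * iv t) * q) (t * 0 + (p * iv t) * 1) (0 * 1 + iv t * q) (0 * 0 + iv t * 1)"
    using Hs_props[OF assms] by (intro rel_mult rel_e') auto
  then show ?thesis by simp
qed

text \<open>The condition that a be a unit is removed by splitting a into c and a - c, with a
  constant c for which \<open>e'_e_units\<close> applies twice.\<close>

lemma e'_e:
  assumes ya: "\<not> s dvd 1 + y * a"
  shows "\<exists>p t g q. Hs t g \<and> e' y \<otimes> e a = e p \<otimes> g \<otimes> e' q"
proof -
  \<comment> \<open>The three pairs demand that c, \<open>a - c\<close> and \<open>1 + y * c\<close>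
    be units.\<close>
  have "card {(0, 1), (a, - 1), (1, y)} < CARD('a)" using card by (simp add: card_insert_if)
  then have "\<exists>c. \<forall>(a, b) \<in> {(0, 1), (a, - 1), (1, y)}. \<not> s dvd a + b * [:c:]"
    using not_s_dvd_1 by (intro const_avoid[OF irr]) auto
  then obtain c' where c': "\<forall>(a, b) \<in> {(0, 1), (a, - 1), (1, y)}. \<not> s dvd a + b * [:c':]" ..
  define c where "c = [:c':]"
  have c: "\<not> s dvd c" "\<not> s dvd a - c" "\<not> s dvd 1 + y * c"
    using c' unfolding c_def[symmetric] by auto
  obtain p t g q where 1: "Hs t g" "e' y \<otimes> e c = e p \<otimes> g \<otimes> e' q"
    using e'_e_units[OF c(1,3)] by blast
  from rel_unique[OF rel_e'_e[of y c, unfolded 1(2)] rel_eHe'[OF 1(1)]]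
  have "[y = iv t * q] (mod m)" "[1 + y * c = iv t] (mod m)" by simp_all
  then have "[1 + y * c + y * (a - c) = iv t + iv t * q * (a - c)] (mod m)"
    by (intro cong_add cong_mult cong_refl)
  then have "[1 + y * a = iv t * (1 + q * (a - c))] (mod m)" by (simp add: algebra_simps)
  then have "\<not> s dvd 1 + q * (a - c)" using ya unit_cong unit_mult by blast
  from e'_e_units[OF c(2) this] obtain p' t' g' q' where
    2: "Hs t' g'" "e' q \<otimes> e (a - c) = e p' \<otimes> g' \<otimes> e' q'" by blast
  have "e' y \<otimes> e a = e' y \<otimes> e c \<otimes> e (a - c)" by (simp add: m_assoc e_merge)
  also have "\<dots> = e p \<otimes> g \<otimes> (e' q \<otimes> e (a - c))"
    using Hs_props(3)[OF 1(1)] by (simp only: 1(2) m_assoc m_closed e_closed e'_closed)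
  also have "\<dots> = e p \<otimes> (g \<otimes> e p') \<otimes> (g' \<otimes> e' q')"
    using Hs_props(3)[OF 1(1)] Hs_props(3)[OF 2(1)] by (simp only: 2(2) m_assoc m_closed e_closed e'_closed)
  also have "\<dots> = e (p + t^2 * p') \<otimes> (g \<otimes> g') \<otimes> e' q'"
    using Hs_props[OF 1(1)] Hs_props(3)[OF 2(1)] by (simp add: m_assoc e_merge)
  finally show ?thesis using Hs_mult[OF 1(1) 2(1)] by blast
qed

lemma e_e':
  assumes "\<not> s dvd 1 + a * b"
  shows "\<exists>p t g q. Hs t g \<and> e a \<otimes> e' b = e' p \<otimes> g \<otimes> e q"
proof -
  have "\<not> s dvd 1 + (- b) * (- a)" using assms by (simp add: mult.commute)
  from e'_e[OF this] obtain p t g q where 1: "Hs t g" "e' (- b) \<otimes> e (- a) = e p \<otimes> g \<otimes> e' q" by blast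
  then have g: "g \<in> carrier Q" by (simp add: Hs_props)
  have "e a \<otimes> e' b = inv (e' (- b) \<otimes> e (- a))" by (simp add: inv_mult_group)
  also have "\<dots> = e' (- q) \<otimes> inv g \<otimes> e (- p)" using g by (simp add: 1 inv_mult_group m_assoc)
  finally show ?thesis using Hs_inv_ex[OF 1(1)] by blast
qed

lemma rel_e_e': "rel (e a \<otimes> e' b) (1 + a * b) a b 1"
  using rel_mult[OF _ _ rel_e rel_e', of a b] by simp

text \<open>Lower-torus-upper factorisation is possible once the upper left entry is a unit. The
  first column \<open>(P, R)\<close> of the product is not zero modulo s, so left multiplication by
  \<open>e c\<close> with a suitable constant c makes that entry \<open>P + R * c\<close> a unit;
  \<open>1 + c * y\<close> is made a unit too, so that the factors can be exchanged one after the
  other.\<close>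

lemma bruhat_step:
  "\<exists>p q t g r. Hs t g \<and> e' y \<otimes> e a \<otimes> e' b = e p \<otimes> e' q \<otimes> g \<otimes> e r"
proof -
  define P where "P = 1 + a * b"
  define R where "R = b + y * P"
  have "\<not> (s dvd P \<and> s dvd R)"
  proof
    assume *: "s dvd P \<and> s dvd R"
    then have "s dvd R - y * P" by (intro dvd_diff dvd_mult) auto
    then have "s dvd b" by (simp add: R_def)
    then have "s dvd P - a * b" using * by (intro dvd_diff dvd_mult) auto
    then show False using not_s_dvd_1 by (simp add: P_def)
  qed
  moreover have "card {(1, y), (P, R)} < CARD('a)" using card by (simp add: card_insert_if)
  ultimately have "\<exists>c. \<forall>(a, b) \<in> {(1, y), (P, R)}. \<not> s dvd a + b * [:c:]"
    using not_s_dvd_1 by (intro const_avoid[OF irr]) auto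
  then obtain c' where c': "\<forall>(a, b) \<in> {(1, y), (P, R)}. \<not> s dvd a + b * [:c':]" ..
  define c where "c = [:c':]"
  have c: "\<not> s dvd 1 + c * y" "\<not> s dvd P + R * c"
    using c' unfolding c_def[symmetric] by (auto simp: mult.commute)
  obtain p t g q where 1: "Hs t g" "e c \<otimes> e' y = e' p \<otimes> g \<otimes> e q" using e_e'[OF c(1)] by blast
  have g: "g \<in> carrier Q" using Hs_props(3)[OF 1(1)] .
  have "rel (e' p \<otimes> g) (1 * t + 0 * 0) (1 * 0 + 0 * iv t) (p * t + 1 * 0) (p * 0 + 1 * iv t)"
    using Hs_props[OF 1(1)] by (intro rel_mult rel_e') auto
  then have "rel (e' p \<otimes> g \<otimes> e q) (t * 1 + 0 * 0) (t * q + 0 * 1) (p * t * 1 + iv t * 0) (p * t * q + iv t * 1)"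
    using g by (intro rel_mult rel_e) auto
  from rel_unique[OF rel_e_e'[of c y, unfolded 1(2)] this]
  have t: "[1 + c * y = t] (mod m)" "[c = t * q] (mod m)" by simp_all
  have "[(1 + c * y) * P + c * b = t * P + (t * q) * b] (mod m)"
    using t by (intro cong_add cong_mult cong_refl)
  moreover have "(1 + c * y) * P + c * b = P + R * c" "t * P + (t * q) * b = t * (1 + (q + a) * b)"
    by (simp_all add: P_def R_def algebra_simps)
  ultimately have "\<not> s dvd 1 + (q + a) * b" using c(2) unit_cong unit_mult by metis
  from e_e'[OF this] obtain p' t' g' q' where
    2: "Hs t' g'" "e (q + a) \<otimes> e' b = e' p' \<otimes> g' \<otimes> e q'" by blast
  have g': "g' \<in> carrier Q" using Hs_props(3)[OF 2(1)] .
  have "e' y \<otimes> e a \<otimes> e' b = e (- c) \<otimes> (e c \<otimes> e' y) \<otimes> (e a \<otimes> e' b)"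
    by (simp add: m_assoc e_merge)
  also have "\<dots> = e (- c) \<otimes> e' p \<otimes> g \<otimes> (e (q + a) \<otimes> e' b)"
    using g unfolding 1(2) by (simp add: m_assoc e_merge)
  also have "\<dots> = e (- c) \<otimes> e' p \<otimes> (g \<otimes> e' p') \<otimes> (g' \<otimes> e q')"
    using g g' unfolding 2(2) by (simp add: m_assoc)
  also have "\<dots> = e (- c) \<otimes> e' (p + (iv t)^2 * p') \<otimes> (g \<otimes> g') \<otimes> e q'"
    using g g' Hs_props(5)[OF 1(1)] by (simp add: m_assoc e_merge)
  finally show ?thesis using Hs_mult[OF 1(1) 2(1)] by blast
qed

text \<open>The set of normal forms contains the identity and is stable under left multiplication by
  both families of generators: for \<open>e\<close> the first factors merge, for \<open>e'\<close>
  this is \<open>bruhat_step\<close>, after which the trailing \<open>e\<close> is moved across the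
  torus word.\<close>

lemma Y_normal_form:
  assumes "x \<in> Y"
  shows "\<exists>p q t g r. Hs t g \<and> x = e p \<otimes> e' q \<otimes> g \<otimes> e r"
proof -
  define S where "S = {x. \<exists>p q t g r. Hs t g \<and> x = e p \<otimes> e' q \<otimes> g \<otimes> e r}"
  have e: "e x \<otimes> z \<in> S" if "z \<in> S" for x z
  proof -
    from that obtain p q t g r where 1: "Hs t g" "z = e p \<otimes> e' q \<otimes> g \<otimes> e r" by (auto simp: S_def)
    then have "e x \<otimes> z = e (x + p) \<otimes> e' q \<otimes> g \<otimes> e r"
      by (simp add: Hs_props m_assoc e_merge)
    with 1 show ?thesis unfolding S_def by blast
  qed
  have e': "e' x \<otimes> z \<in> S" if "z \<in> S" for x z
  proof -
    from that obtain p q t g r where 1: "Hs t g" "z = e p \<otimes> e' q \<otimes> g \<otimes> e r" by (auto simp: S_def)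
    obtain p1 q1 t1 g1 r1 where 2: "Hs t1 g1" "e' x \<otimes> e p \<otimes> e' q = e p1 \<otimes> e' q1 \<otimes> g1 \<otimes> e r1"
      using bruhat_step by blast
    have g: "g \<in> carrier Q" "g1 \<in> carrier Q" using 1 2 Hs_props by auto
    obtain t' where t': "[t * t' = 1] (mod m)" "Hs t' (inv g)" using Hs_inv_ex[OF 1(1)] by blast
    have "inv (inv g) \<otimes> e (t'^2 * r1) = e r1 \<otimes> inv (inv g)"
      using Hs_props(4)[OF t'(2), of r1] g by (intro swap_inv[of "inv g"]; simp)
    then have s: "e r1 \<otimes> g = g \<otimes> e (t'^2 * r1)" using g by simp
    have "e' x \<otimes> z = (e' x \<otimes> e p \<otimes> e' q) \<otimes> g \<otimes> e r" using 1 g by (simp add: m_assoc)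
    also have "\<dots> = e p1 \<otimes> e' q1 \<otimes> g1 \<otimes> (e r1 \<otimes> g) \<otimes> e r" using g by (simp add: 2 m_assoc)
    also have "\<dots> = e p1 \<otimes> e' q1 \<otimes> (g1 \<otimes> g) \<otimes> e (t'^2 * r1 + r)"
      using g by (simp only: s) (simp add: m_assoc e_merge)
    finally show ?thesis using Hs_mult[OF 2(1) 1(1)] unfolding S_def by blast
  qed
  have one: "\<one> \<in> S" using Hs_one unfolding S_def by (intro CollectI exI[of _ 0] exI[of _ 1] exI[of _ \<one>]) simp
  have "\<forall>z \<in> S. x \<otimes> z \<in> S" using assms
  proof induction
    case one
    have "z \<in> carrier Q" if "z \<in> S" for z using that Hs_props(3) by (auto simp: S_def)
    then show ?case by simp
  next
    case (incl x) then show ?case using e e' by auto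
  next
    case (inv x) then show ?case using e e' by auto
  next
    case (eng x y)
    have "z \<in> carrier Q" if "z \<in> S" for z using that Hs_props(3) by (auto simp: S_def)
    then show ?case using eng Y_carrier by (metis m_assoc)
  qed
  with one have "x \<otimes> \<one> \<in> S" by blast
  then show ?thesis using Y_carrier[OF assms] by (simp add: S_def)
qed

section \<open>The kernel of reduction modulo \<open>m\<close>\<close>

lemma kernel_Hs:
  assumes x: "x \<in> Y" and rel: "rel x 1 0 0 1"
  shows "\<exists>t. Hs t x \<and> [t = 1] (mod m)"
proof -
  obtain p q t g r where 1: "Hs t g" "x = e p \<otimes> e' q \<otimes> g \<otimes> e r" using Y_normal_form[OF x] by blast
  note g = Hs_props[OF 1(1)]
  have "rel (e p \<otimes> e' q \<otimes> g) ((1 + p * q) * t + p * 0) ((1 + p * q) * 0 + p * iv t) (q * t + 1 * 0) (q * 0 + 1 * iv t)"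
    using g by (intro rel_mult rel_e_e') auto
  then have "rel x (((1 + p * q) * t) * 1 + (p * iv t) * 0) (((1 + p * q) * t) * r + (p * iv t) * 1)
     ((q * t) * 1 + iv t * 0) ((q * t) * r + iv t * 1)"
    unfolding 1(2) using g by (intro rel_mult rel_e) auto
  \<comment> \<open>Comparison of entries gives t = 1, q = 0 and p + r = 0. The factors
    \<open>e p\<close> and \<open>e r\<close> then cancel, since g with entry 1 commutes with
    \<open>e r\<close>.\<close>
  from rel_unique[OF this rel]
  have c: "[(1 + p * q) * t = 1] (mod m)" "[(1 + p * q) * t * r + p * iv t = 0] (mod m)"
    "[q * t = 0] (mod m)" "[q * t * r + iv t = 1] (mod m)" by simp_all
  have t1: "[t = 1] (mod m)"
  proof -
    have "[t + p * (q * t) = t + p * 0] (mod m)" using c(3) by (intro cong_add cong_mult cong_refl)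
    with c(1) show ?thesis by (simp add: algebra_simps) (metis cong_sym cong_trans)
  qed
  have q0: "[q = 0] (mod m)"
  proof -
    have "[q * t = q * 1] (mod m)" using t1 by (intro cong_mult cong_refl)
    with c(3) show ?thesis by simp (metis cong_sym cong_trans)
  qed
  have ivt: "[iv t = 1] (mod m)" using t1 by (intro iv_eqI) simp
  have "[(1 + p * q) * t * r + p * iv t = 1 * r + p * 1] (mod m)"
    using c(1) ivt by (intro cong_add cong_mult cong_refl)
  with c(2) have pr: "[p + r = 0] (mod m)" by (simp add: add.commute) (metis cong_sym cong_trans)
  have "[t^2 * r = 1^2 * r] (mod m)" using t1 by (intro cong_mult cong_pow cong_refl)
  then have "g \<otimes> e r = e r \<otimes> g" using g(4)[of r] e_cong[of "t^2 * r" r] by simp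
  moreover have "e' q = \<one>" using e'_cong[OF q0] by simp
  ultimately have "x = e (p + r) \<otimes> g" using g(3) by (simp add: 1(2) m_assoc e_merge)
  also have "e (p + r) = \<one>" using e_cong[OF pr] by simp
  finally show ?thesis using 1(1) t1 g(3) by auto
qed

text \<open>By \<open>kernel_Hs\<close> such an element is a torus word with entry 1 modulo m, which
  acts trivially on both families of generators.\<close>

lemma kernel_central:
  assumes x: "x \<in> Y" and rel: "rel x 1 0 0 1" and y: "y \<in> Y"
  shows "x \<otimes> y = y \<otimes> x"
proof -
  obtain t where t: "Hs t x" "[t = 1] (mod m)" using kernel_Hs[OF x rel] by blast
  have ivt: "[iv t = 1] (mod m)" using t by (intro iv_eqI) simp
  have "[t^2 * z = 1^2 * z] (mod m)" for z using t(2) by (intro cong_mult cong_pow cong_refl)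
  moreover have "[(iv t)^2 * z = 1^2 * z] (mod m)" for z using ivt by (intro cong_mult cong_pow cong_refl)
  ultimately have c: "x \<otimes> e z = e z \<otimes> x" "x \<otimes> e' z = e' z \<otimes> x" for z
    using Hs_props(4,5)[OF t(1), of z] e_cong[of "t^2 * z" z] e'_cong[of "(iv t)^2 * z" z] by simp_all
  note xc = Hs_props(3)[OF t(1)]
  show ?thesis using y
  proof induction
    case (eng y z)
    then have "y \<in> carrier Q" "z \<in> carrier Q" using Y_carrier by auto
    then show ?case using eng xc by (metis m_assoc)
  qed (use c xc in auto)
qed

lemma rel_kernel: assumes "Hs t x" "[t = 1] (mod m)" shows "rel x 1 0 0 1"
proof -
  have "[iv t = 1] (mod m)" using assms by (intro iv_eqI) simp
  then show ?thesis using rel_cong[OF Hs_props(6)[OF assms(1)]] assms(2) by simp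
qed

lemma no_p_power_torsion:
  assumes "g \<in> carrier Q" "rel g 1 0 0 1" "g [^] (CHAR('a) ^ n) = \<one>"
  shows "g = \<one>"
  using assms
proof (induction n arbitrary: g)
  case (Suc n)
  have r: "rel (g [^] i) 1 0 0 1" for i :: nat
  proof (induction i)
    case 0 then show ?case by (simp add: rel_one)
  next
    case (Suc i)
    then have "rel (g [^] Suc i) (1 * 1 + 0 * 0) (1 * 0 + 0 * 1) (0 * 1 + 1 * 0) (0 * 0 + 1 * 1)"
      using Suc.prems \<open>g \<in> carrier Q\<close> \<open>rel g 1 0 0 1\<close> unfolding nat_pow_Suc by (intro rel_mult) auto
    then show ?case by simp
  qed
  have "(g [^] CHAR('a)) [^] (CHAR('a) ^ n) = \<one>" using Suc.prems by (simp add: nat_pow_pow)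
  with Suc r have "g [^] CHAR('a) = \<one>" by simp
  then show ?case using Suc.prems no_p_torsion by blast
qed simp

lemma Hs_pow: "Hs t x \<Longrightarrow> Hs (t ^ n) (x [^] n)"
proof (induction n)
  case (Suc n)
  then show ?case using Hs_mult[OF Suc.IH[OF Suc.prems] Suc.prems] by (simp add: mult.commute)
qed (simp add: Hs_one)

section \<open>Commutativity of the torus\<close>

lemma commutator_kernel:
  assumes "Hs t x" "Hs t' y"
  shows "x \<otimes> y \<otimes> inv x \<otimes> inv y \<in> Y" "rel (x \<otimes> y \<otimes> inv x \<otimes> inv y) 1 0 0 1"
proof -
  obtain u u' where u: "[t * u = 1] (mod m)" "Hs u (inv x)" "[t' * u' = 1] (mod m)" "Hs u' (inv y)"
    using Hs_inv_ex assms by meson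
  have H: "Hs (t * t' * u * u') (x \<otimes> y \<otimes> inv x \<otimes> inv y)" using u assms by (intro Hs_mult)
  moreover have "[(t * u) * (t' * u') = 1 * 1] (mod m)" using u by (intro cong_mult)
  ultimately show "rel (x \<otimes> y \<otimes> inv x \<otimes> inv y) 1 0 0 1" by (intro rel_kernel) (simp_all add: ac_simps)
  show "x \<otimes> y \<otimes> inv x \<otimes> inv y \<in> Y" using Hs_props(2)[OF H] .
qed

text \<open>For n a power of p, Frobenius gives \<open>v ^ n - 1 = (v - 1) ^ n\<close>, which is
  divisible by \<open>s ^ n\<close>; the exponent p^k is at least k.\<close>

lemma one_unit_power:
  assumes v: "[v = 1] (mod s)" shows "[v ^ (CHAR('a) ^ k) = 1] (mod m)"
proof -
  define n where "n = CHAR('a) ^ k"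
  have "s ^ n dvd (v - 1) ^ n" using v by (intro dvd_power_same) (simp add: cong_iff_dvd_diff)
  moreover have "k \<le> n"
  proof -
    have "CHAR('a) \<ge> 2" using prime_CHAR[where 'a = 'a] by (rule prime_ge_2_nat)
    then have "2 ^ k \<le> n" unfolding n_def by (rule power_mono) simp
    then show ?thesis using less_exp[of k] by linarith
  qed
  ultimately have "m dvd v ^ n - 1"
    unfolding n_def poly_diff_power_CHAR m_def by (metis dvd_trans le_imp_power_dvd power_one)
  then show ?thesis by (simp add: cong_iff_dvd_diff n_def)
qed

text \<open>The commutator c lies in the kernel, hence is central, so the commutator of
  \<open>x [^] n\<close> with y is \<open>c [^] n\<close>. For n = p^k the power
  \<open>x [^] n\<close> is itself in the central kernel. Thus c has p-power order and is
  trivial.\<close>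

lemma commute_if_1_mod_s:
  assumes x: "Hs v x" and v: "[v = 1] (mod s)" and y: "Hs t y"
  shows "x \<otimes> y = y \<otimes> x"
proof -
  define c where "c = x \<otimes> y \<otimes> inv x \<otimes> inv y"
  note cY = commutator_kernel[OF x y, folded c_def]
  note cc = Hs_props(3)[OF x] Hs_props(3)[OF y] Y_carrier[OF cY(1)]
  have xy: "x \<otimes> y = c \<otimes> y \<otimes> x" using cc(1,2) by (simp add: c_def m_assoc)
  define n where "n = CHAR('a) ^ k"
  have cx: "c [^] i \<otimes> x = x \<otimes> c [^] i" for i :: nat
    using kernel_central[OF cY Hs_props(2)[OF x]] cc by (metis group_commutes_pow)
  have pow: "x [^] i \<otimes> y = c [^] i \<otimes> y \<otimes> x [^] i" for i :: nat
  proof (induction i)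
    case (Suc i)
    have "x [^] Suc i \<otimes> y = x [^] i \<otimes> (c \<otimes> y \<otimes> x)" using cc xy by (simp add: m_assoc)
    also have "\<dots> = x [^] i \<otimes> c \<otimes> y \<otimes> x" using cc by (simp add: m_assoc)
    also have "x [^] i \<otimes> c = c \<otimes> x [^] i"
      using kernel_central[OF cY Hs_props(2)[OF x]] cc by (metis group_commutes_pow)
    also have "c \<otimes> x [^] i \<otimes> y \<otimes> x = c \<otimes> (x [^] i \<otimes> y) \<otimes> x" using cc by (simp add: m_assoc)
    also have "\<dots> = c [^] Suc i \<otimes> y \<otimes> x [^] Suc i"
      unfolding Suc using cc group_commutes_pow[of c c i] by (simp add: m_assoc[symmetric])
    finally show ?case .
  qed (use cc in simp)
  have "[v ^ n = 1] (mod m)" unfolding n_def by (rule one_unit_power[OF v])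
  then have "x [^] n \<otimes> y = y \<otimes> x [^] n"
    using Hs_props(2)[OF Hs_pow[OF x]] rel_kernel[OF Hs_pow[OF x]] Hs_props(2)[OF y] by (intro kernel_central) auto
  with pow[of n] have "c [^] n \<otimes> (y \<otimes> x [^] n) = y \<otimes> x [^] n" using cc by (simp add: m_assoc)
  then have "c [^] n = \<one>" using cc by (metis m_closed nat_pow_closed r_cancel_one')
  then have "c = \<one>" using no_p_power_torsion cY(2) cc(3) by (simp add: n_def)
  then show ?thesis using xy cc by simp
qed

text \<open>The units modulo s form a cyclic group, so each torus word is a power of one fixed
  \<open>h g\<close> times a word with entry 1 modulo s, and words of the latter kind commute with
  the whole torus.\<close>

lemma Hs_commute:
  assumes x: "Hs t x" and y: "Hs t' y"
  shows "x \<otimes> y = y \<otimes> x"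
proof -
  obtain g where g: "\<not> s dvd g" "\<And>t. \<not> s dvd t \<Longrightarrow> \<exists>i. [t = g ^ i] (mod s)"
    using residue_field_generator[OF irr] by blast
  define G where "G = h g"
  have G: "Hs g G" unfolding G_def by (rule Hs_single[OF g(1)])
  have split: "\<exists>i z. x = G [^] (i::nat) \<otimes> z \<and> (\<exists>v. Hs v z \<and> [v = 1] (mod s))" if x: "Hs t x" for t x
  proof -
    obtain i where i: "[t = g ^ i] (mod s)" using g(2) Hs_props(1)[OF x] by blast
    obtain u where u: "[g ^ i * u = 1] (mod m)" "Hs u (inv (G [^] i))" using Hs_inv_ex[OF Hs_pow[OF G]] by blast
    have "Hs (u * t) (inv (G [^] i) \<otimes> x)" by (rule Hs_mult[OF u(2) x])
    moreover have "[u * t = 1] (mod s)"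
    proof -
      have "[u * t = u * g ^ i] (mod s)" using i by (rule cong_scalar_left)
      moreover have "[g ^ i * u = 1] (mod s)" using u(1) s_dvd_m by (rule cong_dvd_modulus)
      ultimately show ?thesis by (simp add: mult.commute) (metis cong_trans)
    qed
    moreover have "x = G [^] i \<otimes> (inv (G [^] i) \<otimes> x)"
      using Hs_props(3)[OF G] Hs_props(3)[OF x] by simp
    ultimately show ?thesis by blast
  qed
  obtain i z v where z: "x = G [^] (i::nat) \<otimes> z" "Hs v z" "[v = 1] (mod s)" using split[OF x] by blast
  obtain j w v' where w: "y = G [^] (j::nat) \<otimes> w" "Hs v' w" "[v' = 1] (mod s)" using split[OF y] by blast
  note c = Hs_props(3)[OF G] Hs_props(3)[OF z(2)] Hs_props(3)[OF w(2)]
  have zy: "z \<otimes> y = y \<otimes> z" by (rule commute_if_1_mod_s[OF z(2,3) y])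
  have wG: "w \<otimes> G [^] i = G [^] i \<otimes> w" by (rule commute_if_1_mod_s[OF w(2,3) Hs_pow[OF G]])
  have "x \<otimes> y = G [^] i \<otimes> (z \<otimes> y)" using c Hs_props(3)[OF y] by (simp add: z m_assoc)
  also have "\<dots> = G [^] i \<otimes> G [^] j \<otimes> w \<otimes> z" unfolding zy using c by (simp add: w m_assoc)
  also have "G [^] i \<otimes> G [^] j = G [^] j \<otimes> G [^] i" using c(1) by (simp add: nat_pow_mult add.commute)
  also have "G [^] j \<otimes> G [^] i \<otimes> w \<otimes> z = G [^] j \<otimes> (G [^] i \<otimes> w) \<otimes> z" using c by (simp add: m_assoc)
  also have "\<dots> = G [^] j \<otimes> (w \<otimes> G [^] i) \<otimes> z" by (simp only: wG)
  also have "\<dots> = y \<otimes> x" using c by (simp add: z w m_assoc)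
  finally show ?thesis .
qed

section \<open>Relations for the symbol
  \<open>h u \<otimes> h v \<otimes> inv (h (u * v))\<close>\<close>

lemma h_commute: "\<not> s dvd u \<Longrightarrow> \<not> s dvd v \<Longrightarrow> h u \<otimes> h v = h v \<otimes> h u"
  using Hs_commute Hs_single by blast

lemma h_cong: "[u = v] (mod m) \<Longrightarrow> \<not> s dvd u \<Longrightarrow> h u = h v"
  unfolding h_def using W_cong by metis

lemma h_one: "h 1 = \<one>"
  by (simp add: h_def W_m1)

lemma conj_W:
  assumes "Hs u x" "\<not> s dvd v"
  shows "x \<otimes> W v = W (u^2 * v) \<otimes> x"
proof -
  note x = Hs_props[OF assms(1)]
  have "[(u * iv u)^2 * (v * iv v) = 1^2 * 1] (mod m)"
    using x assms by (intro cong_mult cong_pow iv)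
  then have "[u^2 * v * ((iv u)^2 * iv v) = 1] (mod m)" by (simp add: power_mult_distrib ac_simps)
  from W_eq[OF this] have W: "W (u^2 * v) = e (u^2 * v) \<otimes> e' (- ((iv u)^2 * iv v)) \<otimes> e (u^2 * v)" .
  have "x \<otimes> W v = (x \<otimes> e v) \<otimes> e' (- iv v) \<otimes> e v" using x(3) by (simp add: W_def m_assoc)
  also have "\<dots> = e (u^2 * v) \<otimes> (x \<otimes> e' (- iv v)) \<otimes> e v" using x(3) by (simp add: x(4) m_assoc)
  also have "\<dots> = e (u^2 * v) \<otimes> e' ((iv u)^2 * - iv v) \<otimes> (x \<otimes> e v)" using x(3) by (simp add: x(5) m_assoc)
  also have "\<dots> = W (u^2 * v) \<otimes> x" using x(3) by (simp add: x(4) W m_assoc)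
  finally show ?thesis .
qed

text \<open>Conjugation by \<open>h u\<close> takes \<open>W v\<close> to \<open>W (u^2 * v)\<close>
  and \<open>W 1\<close> to \<open>W (u^2)\<close>. So the quotient of \<open>h (u^2 * v)\<close> by
  \<open>h (u^2)\<close> is the conjugate of \<open>h v\<close> by \<open>h u\<close>, and the torus
  is commutative.\<close>

lemma h_square_mult:
  assumes u: "\<not> s dvd u" and v: "\<not> s dvd v"
  shows "h (u^2 * v) = h (u^2) \<otimes> h v"
proof -
  have 1: "\<not> s dvd u^2" using u by (simp add: power2_eq_square unit_mult)
  have "h u \<otimes> W v = W (u^2 * v) \<otimes> h u" "h u \<otimes> W 1 = W (u^2) \<otimes> h u"
    using conj_W[OF Hs_single[OF u] v] conj_W[OF Hs_single[OF u] not_s_dvd_1] by simp_all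
  then have a: "W (u^2 * v) = h u \<otimes> W v \<otimes> inv (h u)" "W (u^2) = h u \<otimes> W 1 \<otimes> inv (h u)"
    by (simp_all add: m_assoc)
  have "h (u^2 * v) \<otimes> inv (h (u^2)) = W (u^2 * v) \<otimes> inv (W (u^2))"
    by (simp add: h_def W_m1 inv_mult_group m_assoc)
  also have "\<dots> = h u \<otimes> h v \<otimes> inv (h u)"
    unfolding a by (simp add: h_def[of v] W_m1 inv_mult_group m_assoc)
  also have "\<dots> = h v" unfolding h_commute[OF u v] by (simp add: m_assoc)
  finally have "h (u^2 * v) \<otimes> inv (h (u^2)) \<otimes> h (u^2) = h v \<otimes> h (u^2)" by simp
  then show ?thesis using h_commute[OF v 1] by (simp add: m_assoc)
qed

lemma W1_e: "W 1 \<otimes> e x = e' (- x) \<otimes> W 1" and W1_e': "W 1 \<otimes> e' x = e (- x) \<otimes> W 1"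
proof -
  have "[- ((iv 1)^2 * x) = - (1^2 * x)] (mod m)"
    unfolding cong_minus_minus_iff by (intro cong_mult cong_pow iv_one cong_refl)
  then show "W 1 \<otimes> e x = e' (- x) \<otimes> W 1" using W_e[OF not_s_dvd_1, of x] e'_cong by simp
  show "W 1 \<otimes> e' x = e (- x) \<otimes> W 1" using W_e'[OF not_s_dvd_1, of x] by simp
qed

lemma W1_W: assumes z: "\<not> s dvd z" shows "W 1 \<otimes> W z = W (iv z) \<otimes> W 1"
proof -
  have "W 1 \<otimes> W z = (W 1 \<otimes> e z) \<otimes> e' (- iv z) \<otimes> e z"
    by (simp add: W_def[of z] m_assoc)
  also have "\<dots> = e' (- z) \<otimes> (W 1 \<otimes> e' (- iv z)) \<otimes> e z" by (simp add: W1_e m_assoc)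
  also have "\<dots> = e' (- z) \<otimes> e (iv z) \<otimes> (W 1 \<otimes> e z)" by (simp add: W1_e' m_assoc)
  also have "\<dots> = e' (- z) \<otimes> e (iv z) \<otimes> e' (- z) \<otimes> W 1" by (simp add: W1_e m_assoc)
  also have "e' (- z) \<otimes> e (iv z) \<otimes> e' (- z) = W (iv z)"
  proof -
    have "[- iv (iv z) = - z] (mod m)" using iv_iv[OF z] by (simp add: cong_minus_minus_iff)
    then show ?thesis using W_alt[OF unit_iv[OF z]] by (simp add: e'_cong)
  qed
  finally show ?thesis .
qed

text \<open>The symbol of z and -1/z is trivial. The reason is that \<open>W 1\<close> exchanges the
  two families of elementary elements and therefore conjugates \<open>W (- z)\<close> to
  \<open>W (- iv z)\<close>.\<close>

lemma h_neg_inverse: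
  assumes z: "\<not> s dvd z"
  shows "h z \<otimes> h (- iv z) = h (- 1)"
proof -
  have mz: "\<not> s dvd - z" using z by simp
  have *: "W 1 \<otimes> W (- z) = W (- iv z) \<otimes> W 1"
    using W1_W[OF mz] W_cong[OF iv_uminus[OF z]] unit_iv[OF mz] by simp
  have "inv (h z) = W 1 \<otimes> W (- z)" using z inv_W[OF z] by (simp add: h_def W_m1 inv_mult_group)
  also have "\<dots> = h (- iv z) \<otimes> inv (h (- 1))" unfolding * by (simp add: h_def W_m1 inv_mult_group m_assoc)
  finally have "inv (h z) \<otimes> h (- 1) = h (- iv z)" by (simp add: m_assoc)
  then have "h z \<otimes> h (- iv z) = h z \<otimes> (inv (h z) \<otimes> h (- 1))" by simp
  then show ?thesis by simp
qed

text \<open>The symbol of z and -z is trivial: modulo m, -z is z^2 times -1/z, which reduces the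
  claim to \<open>h_square_mult\<close> and \<open>h_neg_inverse\<close>.\<close>

lemma h_neg:
  assumes z: "\<not> s dvd z"
  shows "h z \<otimes> h (- z) = h (- (z^2))"
proof -
  have i: "\<not> s dvd - iv z" "\<not> s dvd z^2" "\<not> s dvd -1"
    using unit_iv[OF z] z not_s_dvd_1 by (simp_all add: power2_eq_square unit_mult)
  have "[z * (z * - iv z) = z * - 1] (mod m)"
    using iv[OF z] by (intro cong_mult cong_refl) (simp add: cong_minus_minus_iff)
  then have "[z^2 * (- iv z) = - z] (mod m)" by (simp add: power2_eq_square mult.assoc)
  then have "h (- z) = h (z^2 * - iv z)" using z by (intro h_cong[symmetric]) (simp_all add: unit_mult i del: mult_minus_right dvd_minus_iff)
  also have "\<dots> = h (z^2) \<otimes> h (- iv z)" by (rule h_square_mult[OF z i(1)])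
  finally have "h z \<otimes> h (- z) = h z \<otimes> h (z^2) \<otimes> h (- iv z)" by (simp add: m_assoc)
  also have "\<dots> = h (z^2) \<otimes> (h z \<otimes> h (- iv z))" unfolding h_commute[OF z i(2)] by (simp add: m_assoc)
  also have "\<dots> = h (z^2) \<otimes> h (- 1)" unfolding h_neg_inverse[OF z] ..
  also have "\<dots> = h (- (z^2))" using h_square_mult[OF z i(3)] by simp
  finally show ?thesis .
qed

text \<open>The Steinberg relation, for u and 1/v. In \<open>W u \<otimes> W v\<close> the two inner
  factors merge to \<open>e 1\<close> because u + v = 1. Rewriting \<open>e 1\<close> through
  \<open>W 1\<close> and collecting the remaining factors turns the product into
  \<open>W 1 \<otimes> W r\<close> with r = v/u.\<close>

lemma steinberg:
  assumes u: "\<not> s dvd u" and v: "\<not> s dvd v" and uv: "u + v = 1"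
  shows "h u \<otimes> h (iv v) = h (u * iv v)"
proof -
  have iu: "[u * iv u = 1] (mod m)" and ivv: "[v * iv v = 1] (mod m)" using u v iv by blast+
  have uu: "\<not> s dvd iv u" "\<not> s dvd iv v" using u v unit_iv by blast+
  have ivm1: "[- iv 1 = - 1] (mod m)" using iv_one by (simp add: cong_minus_minus_iff)
  have e1: "e 1 = e' 1 \<otimes> W 1 \<otimes> e' 1"
    unfolding W_alt[OF not_s_dvd_1] e'_cong[OF ivm1] by (simp add: m_assoc e_merge)
  have 2: "[- iv u + 1 = - (v * iv u)] (mod m)"
  proof -
    have "- iv u + 1 - (- (v * iv u)) = 1 - (1 - v) * iv u" by (simp add: algebra_simps)
    also have "1 - v = u" using uv by (simp add: algebra_simps)
    also have "1 - u * iv u = - (u * iv u - 1)" by simp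
    finally have eq: "- iv u + 1 - (- (v * iv u)) = - (u * iv u - 1)" .
    show ?thesis using iu unfolding cong_iff_dvd_diff eq by (simp only: dvd_minus_iff)
  qed
  have 3: "[1 - iv v = - (u * iv v)] (mod m)"
  proof -
    have "1 - iv v - (- (u * iv v)) = 1 - (1 - u) * iv v" by (simp add: algebra_simps)
    also have "1 - u = v" using uv by (simp add: algebra_simps)
    also have "1 - v * iv v = - (v * iv v - 1)" by simp
    finally have eq: "1 - iv v - (- (u * iv v)) = - (v * iv v - 1)" .
    show ?thesis using ivv unfolding cong_iff_dvd_diff eq by (simp only: dvd_minus_iff)
  qed
  define r where "r = v * iv u"
  have r: "\<not> s dvd r" using uu v by (simp add: r_def unit_mult)
  have rr: "[r * (u * iv v) = 1] (mod m)"
  proof -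
    have "[(u * iv u) * (v * iv v) = 1 * 1] (mod m)" by (intro cong_mult iu ivv)
    then show ?thesis by (simp add: r_def ac_simps)
  qed
  have Wr: "W r = e r \<otimes> e' (- (u * iv v)) \<otimes> e r" by (rule W_eq[OF rr])
  have swap: "e (v - r) = e (- (v * r))"
  proof (rule e_cong)
    have "v - r - (- (v * r)) = v * (1 - (1 - v) * iv u)" by (simp add: r_def algebra_simps)
    also have "1 - v = u" using uv by (simp add: algebra_simps)
    also have "v * (1 - u * iv u) = - v * (u * iv u - 1)" by (simp add: algebra_simps)
    finally show "[v - r = - (v * r)] (mod m)" using iu by (simp add: cong_iff_dvd_diff dvd_mult)
  qed
  have Wrs: "W r \<otimes> e (- (v * r)) = e' u \<otimes> W r"
  proof -
    have "[(iv r)^2 * (v * r) = (u * iv v)^2 * (v * r)] (mod m)"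
      by (intro cong_mult cong_pow cong_refl iv_eqI rr)
    also have "(u * iv v)^2 * (v * r) = u * (v * iv v) * (r * (u * iv v))" by (simp add: power2_eq_square ac_simps)
    also have "[\<dots> = u * 1 * 1] (mod m)" by (intro cong_mult cong_refl ivv rr)
    finally have "[- ((iv r)^2 * - (v * r)) = u] (mod m)" by simp
    then show ?thesis using W_e[OF r, of "- (v * r)"] e'_cong by metis
  qed
  have "W u \<otimes> W v = e u \<otimes> e' (- iv u) \<otimes> e (u + v) \<otimes> e' (- iv v) \<otimes> e v"
    by (simp add: W_def m_assoc e_merge)
  also have "\<dots> = e u \<otimes> e' (- iv u) \<otimes> (e' 1 \<otimes> W 1 \<otimes> e' 1) \<otimes> e' (- iv v) \<otimes> e v"
    unfolding uv e1 ..
  also have "\<dots> = e u \<otimes> e' (- iv u + 1) \<otimes> W 1 \<otimes> e' (1 - iv v) \<otimes> e v"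
    by (simp add: m_assoc e_merge)
  also have "\<dots> = e u \<otimes> e' (- r) \<otimes> W 1 \<otimes> e' (- (u * iv v)) \<otimes> e v"
    unfolding e'_cong[OF 2] e'_cong[OF 3] r_def ..
  also have "\<dots> = e u \<otimes> (W 1 \<otimes> e r) \<otimes> e' (- (u * iv v)) \<otimes> e v"
    by (simp add: W1_e m_assoc)
  also have "\<dots> = e u \<otimes> W 1 \<otimes> (W r \<otimes> e (v - r))"
    by (simp add: Wr m_assoc e_merge)
  also have "\<dots> = e u \<otimes> (W 1 \<otimes> e' u) \<otimes> W r"
    unfolding swap Wrs by (simp add: m_assoc)
  also have "\<dots> = W 1 \<otimes> W r" by (simp add: W1_e' m_assoc e_merge)
  finally have *: "W u \<otimes> W v = W 1 \<otimes> W r" .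
  have W_h: "W 1 \<otimes> W z = h (iv z) \<otimes> W 1 \<otimes> W 1" if "\<not> s dvd z" for z
    using W1_W[OF that] by (simp add: h_def W_m1 m_assoc)
  have "W u \<otimes> W v = h u \<otimes> (W 1 \<otimes> W v)" by (simp add: h_def W_m1 m_assoc)
  then have "h u \<otimes> h (iv v) \<otimes> (W 1 \<otimes> W 1) = h (iv r) \<otimes> (W 1 \<otimes> W 1)"
    using * W_h[OF v] W_h[OF r] by (simp add: m_assoc)
  then have "h u \<otimes> h (iv v) = h (iv r)" by (metis h_closed W_closed m_closed r_cancel)
  also have "\<dots> = h (u * iv v)" by (rule h_cong[OF iv_eqI[OF rr] unit_iv[OF r]])
  finally show ?thesis .
qed

text \<open>A unit z that is 1 modulo s satisfies z^(p^k) = 1 modulo m. As p^k is odd, z is the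
  square of \<open>z ^ j\<close> with 2j = p^k + 1; the powers of g take care of the residue modulo
  s.\<close>

lemma unit_eq_generator_square:
  assumes p: "odd CHAR('a)" and g: "\<forall>t. \<not> s dvd t \<longrightarrow> (\<exists>i. [t = g ^ i] (mod s))"
    and gs: "\<not> s dvd g" and t: "\<not> s dvd t"
  shows "\<exists>i w. [t = g ^ i * w^2] (mod m)"
proof -
  obtain i where i: "[t = g ^ i] (mod s)" using g t by blast
  have gi: "\<not> s dvd g ^ i" using gs prime_s prime_elem_dvd_power by blast
  define z where "z = iv (g ^ i) * t"
  have iv1: "[g ^ i * iv (g ^ i) = 1] (mod m)" using iv[OF gi] .
  have "[z = iv (g ^ i) * g ^ i] (mod s)" unfolding z_def using i by (rule cong_scalar_left)
  also have "[iv (g ^ i) * g ^ i = 1] (mod s)" using iv1 s_dvd_m by (simp add: mult.commute cong_dvd_modulus)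
  finally have z: "[z ^ (CHAR('a) ^ k) = 1] (mod m)" by (rule one_unit_power)
  have "odd (CHAR('a) ^ k)" using p by simp
  then obtain j where j: "CHAR('a) ^ k + 1 = 2 * j" by (metis evenE odd_even_add odd_one)
  have "[(g ^ i * iv (g ^ i)) * t = 1 * t] (mod m)" using iv1 by (rule cong_scalar_right)
  then have 1: "[t = g ^ i * z] (mod m)" by (simp add: z_def mult.assoc cong_sym)
  have "[z ^ (CHAR('a) ^ k) * z = 1 * z] (mod m)" using z by (rule cong_scalar_right)
  moreover have "z ^ (CHAR('a) ^ k) * z = (z ^ j)^2"
    unfolding power_even_eq[symmetric] by (metis j power_add power_one_right)
  ultimately have "[z = (z ^ j)^2] (mod m)" by (simp add: cong_sym)
  then have "[g ^ i * z = g ^ i * (z ^ j)^2] (mod m)" by (rule cong_scalar_left)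
  with 1 show ?thesis using cong_trans by blast
qed

text \<open>Walk through the prime field from 1, a square, to p - 1 = -1, a nonsquare. Somewhere n
  is a square and n + 1 is not; then n + 1 is minus a square.\<close>

lemma minus_one_sum_of_squares:
  assumes p: "odd CHAR('a)" and ns: "\<not> (\<exists>x. [- 1 = x^2] (mod m))"
    and pm: "\<forall>t. \<not> s dvd t \<longrightarrow> (\<exists>x. [t = x^2] (mod m) \<or> [t = - (x^2)] (mod m))"
  shows "\<exists>x y. \<not> s dvd x \<and> \<not> s dvd y \<and> [1 + x^2 = - (y^2)] (mod m)"
proof -
  define p where "p = CHAR('a)"
  have p3: "p \<ge> 3" using prime_ge_2_nat[OF prime_CHAR[where 'a = 'a]] \<open>odd CHAR('a)\<close>
    by (cases "p = 2") (auto simp: p_def)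
  define Sq where "Sq n = (\<exists>y. [of_nat n = y^2] (mod m))" for n
  have unit: "\<not> s dvd of_nat n" if "0 < n" "n < p" for n
  proof -
    have "of_nat n \<noteq> (0 :: 'a)" using that by (auto simp: of_nat_eq_0_iff_char_dvd p_def dest: dvd_imp_le)
    then have "is_unit (of_nat n :: 'a poly)" by (simp add: of_nat_poly is_unit_pCons_iff)
    then show ?thesis using not_s_dvd_1 dvd_trans by blast
  qed
  have "of_nat (p - 1) = (- 1 :: 'a poly)"
  proof -
    have "of_nat p = (0 :: 'a poly)" unfolding p_def by (metis CHAR_poly_eq of_nat_CHAR)
    moreover have "of_nat p = of_nat (p - 1) + (1 :: 'a poly)" using p3 by (simp add: of_nat_diff)
    ultimately show ?thesis by (simp add: eq_neg_iff_add_eq_0)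
  qed
  then have nSq: "\<not> Sq (p - 1)" using ns by (simp add: Sq_def)
  have "Sq 1" unfolding Sq_def by (intro exI[of _ 1]) simp
  have "\<exists>n\<ge>1. n < p - 1 \<and> Sq n \<and> \<not> Sq (Suc n)"
  proof (rule ccontr)
    assume *: "\<not> ?thesis"
    have "Sq n" if "1 \<le> n" "n \<le> p - 1" for n
      using that
    proof (induction n rule: dec_induct)
      case (step n) then show ?case using * by auto
    qed (rule \<open>Sq 1\<close>)
    then show False using nSq p3 by simp
  qed
  then obtain n where n: "n \<ge> 1" "n < p - 1" "Sq n" "\<not> Sq (Suc n)" by blast
  obtain x where x: "[of_nat n = x^2] (mod m)" using n(3) by (auto simp: Sq_def)
  have u: "\<not> s dvd of_nat n" "\<not> s dvd of_nat (Suc n)" using n unit by (simp_all del: of_nat_Suc)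
  obtain y where y: "[of_nat (Suc n) = - (y^2)] (mod m)" using pm[rule_format, OF u(2)] n(4) by (auto simp: Sq_def)
  have "\<not> s dvd x^2" "\<not> s dvd - (y^2)" using u unit_cong[OF x] unit_cong[OF y] by simp_all
  then have "\<not> s dvd x" "\<not> s dvd y" by (auto simp: power2_eq_square)
  moreover have "[1 + x^2 = - (y^2)] (mod m)"
  proof -
    have "[1 + x^2 = 1 + of_nat n] (mod m)" using x by (intro cong_add cong_refl) (simp add: cong_sym)
    then show ?thesis using y cong_trans by simp
  qed
  ultimately show ?thesis by blast
qed

lemma unit_power2: "\<not> s dvd x \<Longrightarrow> \<not> s dvd x^2"
  by (simp add: power2_eq_square unit_mult)

text \<open>The obstacle is the sign in \<open>h_neg\<close>. In characteristic 2 there is none; if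
  -1 is a square, \<open>h_square_mult\<close> strips it off. Otherwise every unit is plus or minus
  a square, and \<open>h_square_mult\<close> reduces the claim to \<open>h (- 1)\<close> having
  square 1, which needs the Steinberg relation.\<close>

lemma h_double:
  assumes x: "\<not> s dvd x"
  shows "h x \<otimes> h x = h (x^2)"
proof -
  have m1: "\<not> s dvd - 1" using not_s_dvd_1 by simp
  have "CHAR('a) = 2 \<or> odd CHAR('a)"
    using prime_odd_nat[OF prime_CHAR[where 'a = 'a]] prime_ge_2_nat[OF prime_CHAR[where 'a = 'a]] by linarith
  then consider "CHAR('a) = 2" | e where "[- 1 = e^2] (mod m)"
    | "odd CHAR('a)" "\<not> (\<exists>e. [- 1 = e^2] (mod m))"
    by blast
  then show ?thesis
  proof cases
    case 1
    then have "of_nat 2 = (0 :: 'a poly)" by (metis CHAR_poly_eq of_nat_CHAR)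
    then have "y + y = 0" for y :: "'a poly" by (metis mult_2 mult_zero_left of_nat_numeral)
    then have neg: "- y = y" for y :: "'a poly" by (simp add: minus_unique)
    show ?thesis using h_neg[OF x] unfolding neg .
  next
    case (2 e)
    have "\<not> s dvd e^2" using m1 unfolding unit_cong[OF 2] .
    then have e: "\<not> s dvd e" by (auto simp: power2_eq_square)
    have neg: "h (- y) = h (e^2) \<otimes> h y" if "\<not> s dvd y" for y
    proof -
      have "[- 1 * y = e^2 * y] (mod m)" using 2 by (rule cong_scalar_right)
      then have "h (- y) = h (e^2 * y)" using that by (intro h_cong) simp_all
      then show ?thesis by (simp add: h_square_mult[OF e that])
    qed
    have "h (e^2) \<otimes> (h x \<otimes> h x) = h x \<otimes> (h (e^2) \<otimes> h x)"
      using h_commute[OF x unit_power2[OF e]] by (simp add: m_assoc[symmetric])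
    also have "\<dots> = h (e^2) \<otimes> h (x^2)" using h_neg[OF x] neg[OF x] neg[OF unit_power2[OF x]] by simp
    finally show ?thesis by (simp add: l_cancel)
  next
    case 3
    obtain g where g: "\<not> s dvd g" "\<forall>t. \<not> s dvd t \<longrightarrow> (\<exists>i. [t = g ^ i] (mod s))"
      using residue_field_generator[OF irr] by blast
    note gsq = unit_eq_generator_square[OF 3(1) g(2) g(1)]
    have even_sq: "\<exists>x. [t = x^2] (mod m)" if "[t = g ^ i * w^2] (mod m)" "even i" for t i w
    proof -
      from \<open>even i\<close> obtain j where "i = 2 * j" by (elim evenE)
      then have "g ^ i * w^2 = (g ^ j * w)^2" by (simp add: power_mult_distrib power_even_eq)
      with that(1) show ?thesis by auto
    qed
    obtain j v where j: "[- 1 = g ^ j * v^2] (mod m)" using gsq[OF m1] by blast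
    have "odd j" using even_sq[OF j] 3(2) by blast
    \<comment> \<open>The exponent of the generator in -1 is odd, so multiplication by -1 makes an
      odd exponent even.\<close>
    have pm: "\<exists>x. [t = x^2] (mod m) \<or> [t = - (x^2)] (mod m)" if t: "\<not> s dvd t" for t
    proof -
      obtain i w where i: "[t = g ^ i * w^2] (mod m)" using gsq[OF t] by blast
      show ?thesis
      proof (cases "even i")
        case False
        have "[t * - 1 = (g ^ i * w^2) * (g ^ j * v^2)] (mod m)" using i j by (rule cong_mult)
        also have "(g ^ i * w^2) * (g ^ j * v^2) = g ^ (i + j) * (w * v)^2"
          by (simp add: power_add power_mult_distrib ac_simps)
        finally have "\<exists>x. [- t = x^2] (mod m)" using False \<open>odd j\<close> even_sq[of "- t" "i + j" "w * v"] by simp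
        then show ?thesis by (metis cong_minus_minus_iff minus_minus)
      qed (use even_sq[OF i] in blast)
    qed
    obtain a b where ab: "\<not> s dvd a" "\<not> s dvd b" "[1 + a^2 = - (b^2)] (mod m)"
      using minus_one_sum_of_squares[OF 3] pm by blast
    have neg: "h (- (y^2)) = h (y^2) \<otimes> h (- 1)" if "\<not> s dvd y" for y
      using h_square_mult[OF that m1] by simp
    have u1: "\<not> s dvd - (a^2)" using ab(1) unit_power2 by simp
    have u2: "\<not> s dvd 1 + a^2" using unit_cong[OF ab(3)] ab(2) unit_power2 by simp
    have ib: "\<not> s dvd iv b" using unit_iv[OF ab(2)] .
    have iv2: "[iv (1 + a^2) = - ((iv b)^2)] (mod m)"
    proof (rule iv_eqI)
      have "[(1 + a^2) * - ((iv b)^2) = - (b^2) * - ((iv b)^2)] (mod m)" using ab(3) by (rule cong_scalar_right)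
      also have "- (b^2) * - ((iv b)^2) = b^2 * (iv b)^2 * 1" by simp
      also have "[\<dots> = 1] (mod m)" by (rule sq_iv[OF ab(2)])
      finally show "[(1 + a^2) * - ((iv b)^2) = 1] (mod m)" .
    qed
    \<comment> \<open>The Steinberg relation for -a^2 and 1 + a^2 = -b^2. Once
      \<open>h_square_mult\<close> has separated the signs from the squares, exactly the square of
      \<open>h (- 1)\<close> remains.\<close>
    have "h (- (a^2)) \<otimes> h (- ((iv b)^2)) = h (a^2 * (iv b)^2)"
    proof -
      have "h (iv (1 + a^2)) = h (- ((iv b)^2))" using iv2 unit_iv[OF u2] by (rule h_cong)
      moreover have "[- (a^2) * iv (1 + a^2) = - (a^2) * - ((iv b)^2)] (mod m)" using iv2 by (rule cong_scalar_left)
      then have "h (- (a^2) * iv (1 + a^2)) = h (- (a^2) * - ((iv b)^2))"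
        by (rule h_cong) (use u1 unit_iv[OF u2] unit_mult in blast)
      ultimately show ?thesis using steinberg[OF u1 u2] by simp
    qed
    then have "h (a^2) \<otimes> h (- 1) \<otimes> (h ((iv b)^2) \<otimes> h (- 1)) = h (a^2) \<otimes> h ((iv b)^2)"
      by (simp add: neg[OF ab(1)] neg[OF ib] h_square_mult[OF ab(1) unit_power2[OF ib]])
    moreover have "h (- 1) \<otimes> (h ((iv b)^2) \<otimes> h (- 1)) = h ((iv b)^2) \<otimes> (h (- 1) \<otimes> h (- 1))"
      using h_commute[OF m1 unit_power2[OF ib]] by (simp add: m_assoc[symmetric])
    ultimately have "h ((iv b)^2) \<otimes> (h (- 1) \<otimes> h (- 1)) = h ((iv b)^2)"
      by (simp add: m_assoc)
    then have hm1: "h (- 1) \<otimes> h (- 1) = \<one>" by (simp add: l_cancel_one)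
    have sq: "h (y^2) \<otimes> h (y^2) = h ((y^2)^2)" if "\<not> s dvd y" for y
      using h_square_mult[OF that unit_power2[OF that]] by (simp add: power2_eq_square mult.assoc)
    obtain y where y: "[x = y^2] (mod m) \<or> [x = - (y^2)] (mod m)" using pm[OF x] by blast
    then have uy: "\<not> s dvd y" using unit_cong x by (auto simp: power2_eq_square)
    have x2: "[x^2 = (y^2)^2] (mod m)" using y cong_pow[of x _ m 2] by fastforce
    then have hx2: "h (x^2) = h ((y^2)^2)" using unit_power2[OF x] by (rule h_cong)
    from y show ?thesis
    proof
      assume "[x = y^2] (mod m)"
      then have "h x = h (y^2)" using x by (rule h_cong)
      then show ?thesis by (simp add: sq[OF uy] hx2)
    next
      assume "[x = - (y^2)] (mod m)"
      then have "h x = h (y^2) \<otimes> h (- 1)" using h_cong[OF _ x] neg[OF uy] by simp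
      moreover have "h (y^2) \<otimes> h (- 1) \<otimes> (h (y^2) \<otimes> h (- 1)) = h (y^2) \<otimes> h (y^2) \<otimes> (h (- 1) \<otimes> h (- 1))"
        using h_commute[OF m1 unit_power2[OF uy]] by (simp add: m_assoc) (simp add: m_assoc[symmetric])
      ultimately show ?thesis by (simp add: hm1 sq[OF uy] hx2)
    qed
  qed
qed

text \<open>By \<open>h_double\<close> and commutativity, \<open>h x \<otimes> h y\<close> and
  \<open>h (x * y)\<close> have the same square. Their quotient c lies in the kernel and commutes
  with \<open>h (x * y)\<close>, so c has square 1 and is trivial.\<close>

lemma h_mult:
  assumes x: "\<not> s dvd x" and y: "\<not> s dvd y"
  shows "h (x * y) = h x \<otimes> h y"
proof -
  have xy: "\<not> s dvd x * y" using x y by (simp add: unit_mult)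
  define c where "c = h x \<otimes> h y \<otimes> inv (h (x * y))"
  have H: "Hs (x * y * (iv (x * y) * 1)) c"
    unfolding c_def using Hs_mult[OF Hs_mult[OF Hs_single[OF x] Hs_single[OF y]] Hs_inv[OF xy Hs_one]] by simp
  have c: "c \<in> carrier Q" "rel c 1 0 0 1"
    using Hs_props(3)[OF H] rel_kernel[OF H] iv[OF xy] by simp_all
  have s: "h x \<otimes> h y = c \<otimes> h (x * y)" by (simp add: c_def m_assoc)
  have comm: "c \<otimes> h (x * y) = h (x * y) \<otimes> c" by (rule Hs_commute[OF H Hs_single[OF xy]])
  have "h x \<otimes> h y \<otimes> (h x \<otimes> h y) = h x \<otimes> (h y \<otimes> h x) \<otimes> h y" by (simp add: m_assoc)
  also have "\<dots> = (h x \<otimes> h x) \<otimes> (h y \<otimes> h y)" unfolding h_commute[OF y x] by (simp add: m_assoc)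
  also have "\<dots> = h (x^2) \<otimes> h (y^2)" by (simp add: h_double x y)
  also have "\<dots> = h ((x * y)^2)" by (simp add: h_square_mult[OF x unit_power2[OF y]] power_mult_distrib)
  also have "\<dots> = h (x * y) \<otimes> h (x * y)" by (simp add: h_double[OF xy])
  finally have "(c \<otimes> h (x * y)) \<otimes> (c \<otimes> h (x * y)) = h (x * y) \<otimes> h (x * y)" by (simp add: s)
  moreover have "(c \<otimes> h (x * y)) \<otimes> (c \<otimes> h (x * y)) = (c \<otimes> c) \<otimes> (h (x * y) \<otimes> h (x * y))"
  proof -
    have "(c \<otimes> h (x * y)) \<otimes> (c \<otimes> h (x * y)) = c \<otimes> (h (x * y) \<otimes> c) \<otimes> h (x * y)" using c by (simp add: m_assoc)
    then show ?thesis using c by (simp add: comm[symmetric] m_assoc)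
  qed
  ultimately have "c \<otimes> c = \<one>" using c by (metis h_closed m_closed r_cancel_one')
  then have "c = \<one>" using c no_2_torsion by blast
  then show ?thesis using s by simp
qed

lemma Hs_eq_h: "Hs t x \<Longrightarrow> x = h t"
proof (induction rule: Hs.induct)
  case (Hs_h z t g)
  then show ?case using h_mult[OF Hs_h(1) Hs_props(1)[OF Hs_h(2)]] by simp
next
  case (Hs_inv z t g)
  have i: "\<not> s dvd iv z" using Hs_inv unit_iv by blast
  have zi: "\<not> s dvd z * iv z" using Hs_inv(1) i unit_mult by blast
  have "h z \<otimes> h (iv z) = \<one>"
    using h_mult[OF Hs_inv(1) i] h_cong[OF iv[OF Hs_inv(1)] zi] h_one by simp
  then have "inv (h z) \<otimes> (h z \<otimes> h (iv z)) = inv (h z)" by simp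
  then have "h (iv z) = inv (h z)" by simp
  then show ?case using h_mult[OF i Hs_props(1)[OF Hs_inv(2)]] Hs_inv by simp
qed (simp add: h_one)

text \<open>By now a torus word is determined by its diagonal entry modulo m, so the words form a
  subgroup of SL2(A/m) and no central extension is left.\<close>

theorem kernel_trivial:
  assumes "x \<in> Y" "rel x 1 0 0 1" shows "x = \<one>"
proof -
  obtain t where t: "Hs t x" "[t = 1] (mod m)" using kernel_Hs[OF assms] by blast
  then show ?thesis using Hs_eq_h h_cong[OF t(2) Hs_props(1)[OF t(1)]] h_one by simp
qed

end

section \<open>Congruence subgroups over the ring \<open>A[1/\<pi>]\<close>\<close>

locale s_arith =
  fixes \<pi> :: "'a::{field, finite} poly"
  assumes irr_pi: "Factorial_Ring.irreducible \<pi>" and card: "CARD('a) > 3"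
begin

section \<open>The ring \<open>B\<close> and its principal ideals\<close>

abbreviation \<iota> :: "'a poly \<Rightarrow> 'a poly fract" where "\<iota> \<equiv> to_fract"

definition B :: "'a poly fract set" where "B = {x. \<exists>a k. x * \<iota> \<pi> ^ k = \<iota> a}"

definition J :: "'a poly fract \<Rightarrow> 'a poly fract set" where "J f = (*) f ` B"

lemma pi_nz [simp]: "\<pi> \<noteq> 0"
  using irr_pi by (auto simp: Factorial_Ring.irreducible_def)

lemma to_fract_power: "\<iota> (a ^ n) = \<iota> a ^ n"
  by (induction n) simp_all

lemma B_iota [simp]: "\<iota> a \<in> B"
  unfolding B_def by (intro CollectI exI[of _ a] exI[of _ 0]) simp

lemma B_0 [simp]: "0 \<in> B" and B_1 [simp]: "1 \<in> B"
  using B_iota[of 0] B_iota[of 1] by simp_all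

lemma B_add [simp]: assumes "x \<in> B" "y \<in> B" shows "x + y \<in> B"
proof -
  obtain a k b l where 1: "x * \<iota> \<pi> ^ k = \<iota> a" "y * \<iota> \<pi> ^ l = \<iota> b" using assms by (auto simp: B_def)
  have "(x + y) * \<iota> \<pi> ^ (k + l) = (x * \<iota> \<pi> ^ k) * \<iota> \<pi> ^ l + (y * \<iota> \<pi> ^ l) * \<iota> \<pi> ^ k"
    by (simp add: power_add algebra_simps)
  also have "\<dots> = \<iota> (a * \<pi> ^ l + b * \<pi> ^ k)" by (simp add: 1 to_fract_power)
  finally show ?thesis unfolding B_def by blast
qed

lemma B_mult [simp]: assumes "x \<in> B" "y \<in> B" shows "x * y \<in> B"
proof -
  obtain a k b l where 1: "x * \<iota> \<pi> ^ k = \<iota> a" "y * \<iota> \<pi> ^ l = \<iota> b" using assms by (auto simp: B_def)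
  have "(x * y) * \<iota> \<pi> ^ (k + l) = (x * \<iota> \<pi> ^ k) * (y * \<iota> \<pi> ^ l)"
    by (simp add: power_add algebra_simps)
  also have "\<dots> = \<iota> (a * b)" by (simp add: 1)
  finally show ?thesis unfolding B_def by blast
qed

lemma B_uminus [simp]: "x \<in> B \<Longrightarrow> - x \<in> B"
  using B_mult[of "\<iota> (- 1)" x] B_iota[of "-1"] by simp

lemma B_diff [simp]: "x \<in> B \<Longrightarrow> y \<in> B \<Longrightarrow> x - y \<in> B"
  using B_add[of x "- y"] by simp

lemma B_power [simp]: "x \<in> B \<Longrightarrow> x ^ n \<in> B"
  by (induction n) simp_all

lemma B_inverse_pi [simp]: "inverse (\<iota> \<pi>) \<in> B"
  unfolding B_def by (intro CollectI exI[of _ 1] exI[of _ 1]) simp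

lemma J_I: "b \<in> B \<Longrightarrow> x = f * b \<Longrightarrow> x \<in> J f"
  by (auto simp: J_def)

lemma J_1 [simp]: "J 1 = B"
  by (simp add: J_def)

lemma J_self [simp]: "f \<in> J f"
  by (rule J_I[OF B_1]) simp

lemma J_0 [simp]: "0 \<in> J f"
  by (rule J_I[OF B_0]) simp

lemma J_add [simp]: "x \<in> J f \<Longrightarrow> y \<in> J f \<Longrightarrow> x + y \<in> J f"
  by (auto simp: J_def distrib_left[symmetric])

lemma J_uminus [simp]: assumes "x \<in> J f" shows "- x \<in> J f"
proof -
  obtain b where "b \<in> B" "x = f * b" using assms by (auto simp: J_def)
  then show ?thesis by (intro J_I[of "- b"]) simp_all
qed

lemma J_diff [simp]: "x \<in> J f \<Longrightarrow> y \<in> J f \<Longrightarrow> x - y \<in> J f"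
  using J_add[of x f "- y"] by simp

lemma J_mult: "x \<in> J f \<Longrightarrow> y \<in> J g \<Longrightarrow> x * y \<in> J (f * g)"
proof -
  assume "x \<in> J f" "y \<in> J g"
  then obtain a b where "a \<in> B" "b \<in> B" "x = f * a" "y = g * b" by (auto simp: J_def)
  then show ?thesis by (intro J_I[of "a * b"]) simp_all
qed

lemma J_mult_B: "b \<in> B \<Longrightarrow> x \<in> J f \<Longrightarrow> b * x \<in> J f"
  using J_mult[of b 1 x f] by simp

lemma J_B_mult: "b \<in> B \<Longrightarrow> x \<in> J f \<Longrightarrow> x * b \<in> J f"
  using J_mult[of x f b 1] by simp

lemma J_mono: "f \<in> J g \<Longrightarrow> J f \<subseteq> J g"
  by (auto simp: J_def mult.assoc)

lemma J_iota_B: "x \<in> J (\<iota> f) \<Longrightarrow> x \<in> B"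
  by (auto simp: J_def)

lemma J_dvd: assumes "g dvd f" shows "J (\<iota> f) \<subseteq> J (\<iota> g)"
proof -
  obtain c where "f = g * c" using assms by (elim dvdE)
  then have "\<iota> f \<in> J (\<iota> g)" by (intro J_I[of "\<iota> c"]) simp_all
  then show ?thesis by (rule J_mono)
qed

lemma J_iota_I: "f dvd a \<Longrightarrow> \<iota> a \<in> J (\<iota> f)"
  using J_dvd J_self by blast

lemma J_iota_iff:
  assumes "Rings.coprime f \<pi>" shows "\<iota> a \<in> J (\<iota> f) \<longleftrightarrow> f dvd a"
proof
  assume "\<iota> a \<in> J (\<iota> f)"
  then obtain b where "b \<in> B" "\<iota> a = \<iota> f * b" by (auto simp: J_def)
  then obtain c k where "\<iota> a * \<iota> \<pi> ^ k = \<iota> f * \<iota> c" by (auto simp: B_def mult.assoc)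
  then have "\<iota> (a * \<pi> ^ k) = \<iota> (f * c)" by (simp add: to_fract_power)
  then have "\<pi> ^ k * a = f * c" by (simp only: to_fract_eq_iff mult.commute)
  then have "f dvd \<pi> ^ k * a" by simp
  then show "f dvd a" using assms poly_coprime_dvd_mult poly_coprime_power by blast
qed (rule J_iota_I)

lemma J_iota_cong:
  assumes "Rings.coprime f \<pi>" shows "\<iota> a - \<iota> b \<in> J (\<iota> f) \<longleftrightarrow> [a = b] (mod f)"
  using J_iota_iff[OF assms, of "a - b"] by (simp add: cong_iff_dvd_diff)

text \<open>As \<open>\<pi>\<close> is invertible modulo f, a denominator can be traded for a
  polynomial inverse; so A surjects onto B/fB.\<close>

lemma B_approx:
  assumes "Rings.coprime f \<pi>" "b \<in> B" shows "\<exists>a. b - \<iota> a \<in> J (\<iota> f)"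
proof -
  obtain c k where c: "b * \<iota> \<pi> ^ k = \<iota> c" using assms by (auto simp: B_def)
  have "Rings.coprime f (\<pi> ^ k)" using assms by (simp add: poly_coprime_power)
  then obtain x y where xy: "x * f + y * \<pi> ^ k = 1" using poly_bezout by meson
  have "b = b * \<iota> (x * f + y * \<pi> ^ k)" by (simp only: xy) simp
  also have "\<dots> = b * \<iota> x * \<iota> f + \<iota> y * (b * \<iota> \<pi> ^ k)" by (simp add: to_fract_power algebra_simps)
  also have "\<dots> = \<iota> f * (b * \<iota> x) + \<iota> (y * c)" by (simp add: c)
  finally have "b - \<iota> (y * c) = \<iota> f * (b * \<iota> x)" by (metis add_diff_cancel_right')
  moreover have "b * \<iota> x \<in> B" using assms by simp
  ultimately show ?thesis by (intro exI[of _ "y * c"] J_I)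
qed

lemma J_split:
  assumes "Rings.coprime f1 f2" "x \<in> J (\<iota> g)"
  shows "\<exists>x1 x2. x1 \<in> J (\<iota> (f1 * g)) \<and> x2 \<in> J (\<iota> (f2 * g)) \<and> x = x1 + x2"
proof -
  obtain a b where ab: "a * f1 + b * f2 = 1" using poly_bezout[OF assms(1)] by blast
  have "x = x * \<iota> (a * f1 + b * f2)" by (simp only: ab) simp
  also have "\<dots> = \<iota> a * (\<iota> f1 * x) + \<iota> b * (\<iota> f2 * x)" by (simp add: algebra_simps)
  finally have "x = \<iota> a * (\<iota> f1 * x) + \<iota> b * (\<iota> f2 * x)" .
  moreover have "\<iota> a * (\<iota> f1 * x) \<in> J (\<iota> (f1 * g))" "\<iota> b * (\<iota> f2 * x) \<in> J (\<iota> (f2 * g))"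
    using assms(2) by (simp_all add: J_mult_B J_mult)
  ultimately show ?thesis by blast
qed

lemma J_coprime_Int:
  assumes "Rings.coprime f1 f2" "x \<in> J (\<iota> f1)" "x \<in> J (\<iota> f2)"
  shows "x \<in> J (\<iota> (f1 * f2))"
proof -
  obtain a b where ab: "a * f1 + b * f2 = 1" using poly_bezout[OF assms(1)] by blast
  have "x = x * \<iota> (a * f1 + b * f2)" by (simp only: ab) simp
  also have "\<dots> = \<iota> a * (\<iota> f1 * x) + \<iota> b * (x * \<iota> f2)" by (simp add: algebra_simps)
  finally show ?thesis using assms J_mult[of "\<iota> f1" "\<iota> f1" x "\<iota> f2"] J_mult[of x "\<iota> f1" "\<iota> f2" "\<iota> f2"]
    by (metis B_iota J_add J_mult_B J_self to_fract_mult)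
qed

section \<open>Principal congruence subgroups of SL2(B), unipotents and elementary words\<close>

definition Lv :: "'a poly fract \<Rightarrow> 'a poly fract sl2 set" where
  "Lv f = {g. ent11 g - 1 \<in> J f \<and> ent12 g \<in> J f \<and> ent21 g \<in> J f \<and> ent22 g - 1 \<in> J f}"

lemma Lv_mono: "f \<in> J g \<Longrightarrow> Lv f \<subseteq> Lv g"
  using J_mono by (auto simp: Lv_def)

lemma Lv_1: "Lv 1 = {g. ent11 g \<in> B \<and> ent12 g \<in> B \<and> ent21 g \<in> B \<and> ent22 g \<in> B}"
proof -
  have "x - 1 \<in> B \<longleftrightarrow> x \<in> B" for x using B_add[of "x - 1" 1] B_diff[of x 1] by auto
  then show ?thesis by (auto simp: Lv_def)
qed

lemma Lv_subset_1: "f \<in> B \<Longrightarrow> Lv f \<subseteq> Lv 1"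
  by (rule Lv_mono) simp

lemma J_B: "f \<in> B \<Longrightarrow> x \<in> J f \<Longrightarrow> x \<in> B"
  by (auto simp: J_def)

lemma Lv_0 [simp]: "0 \<in> Lv f"
  by (simp add: Lv_def ent_simps)

lemma Lv_add [simp]:
  assumes f: "f \<in> B" and g: "g \<in> Lv f" and h: "h \<in> Lv f" shows "g + h \<in> Lv f"
proof -
  have B: "ent11 h \<in> B" "ent12 h \<in> B" "ent21 h \<in> B" "ent22 h \<in> B"
    using h Lv_subset_1[OF f] unfolding Lv_1 by blast+
  have "ent11 (g + h) - 1 = (ent11 g - 1) * ent11 h + (ent11 h - 1) + ent12 g * ent21 h"
    "ent12 (g + h) = (ent11 g - 1) * ent12 h + ent12 h + ent12 g * ent22 h"
    "ent21 (g + h) = ent21 g * ent11 h + (ent22 g - 1) * ent21 h + ent21 h"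
    "ent22 (g + h) - 1 = ent21 g * ent12 h + (ent22 g - 1) * ent22 h + (ent22 h - 1)"
    by (simp_all add: ent_plus algebra_simps)
  then show ?thesis using g h B unfolding Lv_def mem_Collect_eq
    by (metis J_add J_B_mult)
qed

lemma Lv_uminus [simp]: "g \<in> Lv f \<Longrightarrow> - g \<in> Lv f"
  by (simp add: Lv_def ent_simps)

lemma Lv_diff [simp]: "f \<in> B \<Longrightarrow> g \<in> Lv f \<Longrightarrow> h \<in> Lv f \<Longrightarrow> g - h \<in> Lv f"
  using Lv_add[of f g "- h"] by simp

text \<open>Every entry is arranged as a combination of the entries of h - 1, so that an ideal
  containing the latter visibly contains the former. On the diagonal this uses that g has
  determinant 1.\<close>

lemma ent_conj:
  fixes g h :: "'k::field sl2"
  shows "ent11 (g + h - g) - 1 = ent11 g * ent22 g * (ent11 h - 1) + ent12 g * ent22 g * ent21 h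
      - ent11 g * ent21 g * ent12 h - ent12 g * ent21 g * (ent22 h - 1)"
    "ent12 (g + h - g) = - (ent11 g * ent12 g * (ent11 h - 1)) - ent12 g * ent12 g * ent21 h
      + ent11 g * ent11 g * ent12 h + ent12 g * ent11 g * (ent22 h - 1)"
    "ent21 (g + h - g) = ent21 g * ent22 g * (ent11 h - 1) + ent22 g * ent22 g * ent21 h
      - ent21 g * ent21 g * ent12 h - ent22 g * ent21 g * (ent22 h - 1)"
    "ent22 (g + h - g) - 1 = - (ent21 g * ent12 g * (ent11 h - 1)) - ent22 g * ent12 g * ent21 h
      + ent21 g * ent11 g * ent12 h + ent22 g * ent11 g * (ent22 h - 1)"
proof -
  have "ent11 (g + h - g) - (ent11 g * ent22 g - ent12 g * ent21 g)
    = ent11 g * ent22 g * (ent11 h - 1) + ent12 g * ent22 g * ent21 h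
      - ent11 g * ent21 g * ent12 h - ent12 g * ent21 g * (ent22 h - 1)"
    by (simp add: diff_conv_add_uminus[of _ g] ent_plus ent_uminus algebra_simps del: add_uminus_conv_diff)
  then show "ent11 (g + h - g) - 1 = ent11 g * ent22 g * (ent11 h - 1) + ent12 g * ent22 g * ent21 h
      - ent11 g * ent21 g * ent12 h - ent12 g * ent21 g * (ent22 h - 1)" by (simp add: det_ent)
  have "ent22 (g + h - g) - (ent11 g * ent22 g - ent12 g * ent21 g)
    = - (ent21 g * ent12 g * (ent11 h - 1)) - ent22 g * ent12 g * ent21 h
      + ent21 g * ent11 g * ent12 h + ent22 g * ent11 g * (ent22 h - 1)"
    by (simp add: diff_conv_add_uminus[of _ g] ent_plus ent_uminus algebra_simps del: add_uminus_conv_diff)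
  then show "ent22 (g + h - g) - 1 = - (ent21 g * ent12 g * (ent11 h - 1)) - ent22 g * ent12 g * ent21 h
      + ent21 g * ent11 g * ent12 h + ent22 g * ent11 g * (ent22 h - 1)" by (simp add: det_ent)
qed (simp_all add: diff_conv_add_uminus[of _ g] ent_plus ent_uminus algebra_simps del: add_uminus_conv_diff)

lemma trace_conj: "ent11 (g + h - g) + ent22 (g + h - g) = ent11 h + ent22 (h :: 'k::field sl2)"
proof -
  have "ent11 (g + h - g) - 1 + (ent22 (g + h - g) - 1)
    = (ent11 g * ent22 g - ent12 g * ent21 g) * (ent11 h - 1) + (ent11 g * ent22 g - ent12 g * ent21 g) * (ent22 h - 1)"
    unfolding ent_conj by (simp add: algebra_simps)
  then show ?thesis by (simp add: det_ent algebra_simps)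
qed

lemma Lv_conj:
  assumes g: "g \<in> Lv 1" and h: "h \<in> Lv f" shows "g + h - g \<in> Lv f"
  using g h unfolding Lv_def[of f] mem_Collect_eq ent_conj Lv_1
  by (intro conjI) (auto intro!: J_add J_diff J_uminus J_mult_B)

text \<open>In SL2, trace 2 means unipotent. The trace is invariant under every conjugation, which
  makes this subgroup normal in SL2(B) and lets it survive conjugation by other diagonal matrices as
  well.\<close>

inductive_set E :: "'a poly fract \<Rightarrow> 'a poly fract sl2 set" for f where
  E_0 [simp]: "0 \<in> E f"
| E_step: "g \<in> Lv f \<Longrightarrow> ent11 g + ent22 g = 2 \<Longrightarrow> h \<in> E f \<Longrightarrow> g + h \<in> E f"

lemma E_I: "g \<in> Lv f \<Longrightarrow> ent11 g + ent22 g = 2 \<Longrightarrow> g \<in> E f"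
  using E_step[OF _ _ E_0, of g f] by simp

lemma E_add [simp]: "g \<in> E f \<Longrightarrow> h \<in> E f \<Longrightarrow> g + h \<in> E f"
  by (induction rule: E.induct) (simp_all add: add.assoc E_step)

lemma E_uminus [simp]: "g \<in> E f \<Longrightarrow> - g \<in> E f"
proof (induction rule: E.induct)
  case (E_step g h)
  have "- g \<in> E f" using E_step by (intro E_I) (simp_all add: ent_uminus add.commute)
  then show ?case using E_step E_add[of "- h" f "- g"] by (simp add: minus_add)
qed simp

lemma E_diff [simp]: "g \<in> E f \<Longrightarrow> h \<in> E f \<Longrightarrow> g - h \<in> E f"
  using E_add[of g f "- h"] by simp

lemma E_Lv: assumes f: "f \<in> B" and "g \<in> E f" shows "g \<in> Lv f"
  using assms(2)
proof (induction rule: E.induct)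
  case (E_step g h)
  then show ?case by (intro Lv_add[OF f])
qed simp

lemma conj_add: "c + (g + h) - c = (c + g - c) + (c + h - (c :: 'g::group_add))"
  by (simp only: diff_conv_add_uminus add.assoc minus_add_cancel)

text \<open>Here c may lie outside SL2(B), for instance diag(z, 1/z) with z not invertible in B;
  only its effect on levels matters.\<close>

lemma E_conj_gen:
  assumes "\<And>g. g \<in> Lv f \<Longrightarrow> c + g - c \<in> Lv f'" "g \<in> E f"
  shows "c + g - c \<in> E f'"
  using assms(2)
proof (induction rule: E.induct)
  case (E_step g h)
  have "c + g - c \<in> E f'" using E_step assms(1) by (intro E_I) (simp_all add: trace_conj)
  then show ?case using E_step unfolding conj_add by simp
qed simp

lemma E_conj: "c \<in> Lv 1 \<Longrightarrow> g \<in> E f \<Longrightarrow> c + g - c \<in> E f"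
  using E_conj_gen Lv_conj by blast

lemma E_conj': "c \<in> Lv 1 \<Longrightarrow> g \<in> E f \<Longrightarrow> - c + g + c \<in> E f"
  using E_conj[of "- c" g f] by simp

lemma E_mono: assumes "f \<in> J g" shows "E f \<subseteq> E g"
proof
  fix x assume "x \<in> E f"
  then have "0 + x - 0 \<in> E g" using Lv_mono[OF assms] by (intro E_conj_gen[of f 0 g]) auto
  then show "x \<in> E g" by simp
qed

lemma e12_Lv: "x \<in> J f \<Longrightarrow> e12 x \<in> Lv f" and e21_Lv: "x \<in> J f \<Longrightarrow> e21 x \<in> Lv f"
  by (simp_all add: Lv_def)

lemma e12_E: "x \<in> J f \<Longrightarrow> e12 x \<in> E f" and e21_E: "x \<in> J f \<Longrightarrow> e21 x \<in> E f"
  by (intro E_I; simp add: e12_Lv e21_Lv)+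

text \<open>Words in elementary matrices of level f, built letter by letter. For f = 1 they exhaust
  SL2(B), see \<open>Lv_1_Fg\<close>.\<close>

inductive_set Fg :: "'a poly fract \<Rightarrow> 'a poly fract sl2 set" for f where
  Fg_0 [simp]: "0 \<in> Fg f"
| Fg_12: "x \<in> J f \<Longrightarrow> h \<in> Fg f \<Longrightarrow> e12 x + h \<in> Fg f"
| Fg_21: "x \<in> J f \<Longrightarrow> h \<in> Fg f \<Longrightarrow> e21 x + h \<in> Fg f"

lemma Fg_e12: "x \<in> J f \<Longrightarrow> e12 x \<in> Fg f" and Fg_e21: "x \<in> J f \<Longrightarrow> e21 x \<in> Fg f"
  using Fg_12[OF _ Fg_0, of x f] Fg_21[OF _ Fg_0, of x f] by simp_all

lemma Fg_add [simp]: "g \<in> Fg f \<Longrightarrow> h \<in> Fg f \<Longrightarrow> g + h \<in> Fg f"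
  by (induction rule: Fg.induct) (simp_all add: add.assoc Fg_12 Fg_21)

lemma Fg_uminus [simp]: "g \<in> Fg f \<Longrightarrow> - g \<in> Fg f"
proof (induction rule: Fg.induct)
  case (Fg_12 x h)
  then have "e12 (- x) \<in> Fg f" by (intro Fg_e12) simp
  with Fg_12 show ?case using Fg_add[of "- h" f "e12 (- x)"] by (simp add: minus_add e12_uminus)
next
  case (Fg_21 x h)
  then have "e21 (- x) \<in> Fg f" by (intro Fg_e21) simp
  with Fg_21 show ?case using Fg_add[of "- h" f "e21 (- x)"] by (simp add: minus_add e21_uminus)
qed simp

lemma Fg_mono: assumes "f \<in> J g" shows "Fg f \<subseteq> Fg g"
proof
  fix x assume "x \<in> Fg f"
  then show "x \<in> Fg g" using J_mono[OF assms] by (induction rule: Fg.induct) (auto intro: Fg_12 Fg_21)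
qed

lemma Fg_E: "g \<in> Fg f \<Longrightarrow> g \<in> E f"
  by (induction rule: Fg.induct) (simp_all add: e12_E e21_E)

end

section \<open>Squarefree polynomials in residue classes\<close>

text \<open>F1 collects the primes of F that divide f, with full multiplicity; common divisors are
  removed one after the other.\<close>

lemma poly_coprime_splitting:
  fixes F f :: "'a::field poly"
  assumes "F \<noteq> 0"
  shows "\<exists>F1 F2 N. F = F1 * F2 \<and> F1 dvd f ^ N \<and> Rings.coprime F2 f"
  using assms
proof (induction "degree F" arbitrary: F rule: less_induct)
  case less
  show ?case
  proof (cases "Rings.coprime F f")
    case True
    then have "F = 1 * F \<and> 1 dvd f ^ 0 \<and> Rings.coprime F f" by simp
    then show ?thesis by blast
  next
    case False
    then obtain d where d: "d dvd F" "d dvd f" "\<not> is_unit d" by (auto simp: Rings.coprime_def)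
    obtain G where G: "F = d * G" using d(1) by (elim dvdE)
    have nz: "d \<noteq> 0" "G \<noteq> 0" using less.prems G by auto
    then have "degree d > 0" using d(3) by (auto simp: is_unit_iff_degree)
    then have "degree G < degree F" using nz by (simp add: G degree_mult_eq)
    from less.hyps[OF this nz(2)] obtain F1 F2 N where
      F: "G = F1 * F2" "F1 dvd f ^ N" "Rings.coprime F2 f" by blast
    have "F = (d * F1) * F2" "d * F1 dvd f ^ Suc N" using F d by (simp_all add: G mult_dvd_mono mult.assoc)
    with F(3) show ?thesis by blast
  qed
qed

lemma poly_coprime_add_mult:
  fixes x y c :: "'a::field poly"
  assumes "Rings.coprime x y" shows "Rings.coprime x (y + x * c)"
proof -
  obtain u v where "u * x + v * y = 1" using poly_bezout[OF assms] by blast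
  then have "(u - v * c) * x + v * (y + x * c) = 1" by (simp add: algebra_simps)
  then show ?thesis by (rule poly_coprimeI)
qed

text \<open>For s take the part of D that is prime to a. A prime of this part divides the added term
  but not a; any other prime of D divides a, but neither G nor s.\<close>

lemma poly_make_coprime:
  fixes a G D :: "'a::field poly"
  assumes "Rings.coprime a G" "D \<noteq> 0" "n > 0" shows "\<exists>s. Rings.coprime D (a + G * s ^ n)"
proof -
  obtain D1 D2 N where D: "D = D1 * D2" "D1 dvd a ^ N" "Rings.coprime D2 a"
    using poly_coprime_splitting[OF assms(2)] by blast
  have "Rings.coprime a (G * D2 ^ n)"
    using assms(1) D(3) by (simp add: poly_coprime_mult_right poly_coprime_power coprime_commute)
  from poly_coprime_add_mult[OF this, of 1] have "Rings.coprime (a + G * D2 ^ n) a"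
    by (simp add: coprime_commute add.commute)
  then have "Rings.coprime (a + G * D2 ^ n) (a ^ N)" by (rule poly_coprime_power)
  then have 1: "Rings.coprime (a + G * D2 ^ n) D1" using D(2) by (meson coprime_divisors dvd_refl)
  have eq: "G * D2 ^ n = D2 * (G * D2 ^ (n - 1))" using assms(3) by (simp add: power_eq_if)
  have "Rings.coprime D2 (a + G * D2 ^ n)" unfolding eq by (rule poly_coprime_add_mult[OF D(3)])
  with 1 show ?thesis unfolding D(1) by (intro exI[of _ D2]) (simp add: poly_coprime_mult_left coprime_commute)
qed

lemma pderiv_power_CHAR: "pderiv (f ^ CHAR('a)) = (0 :: 'a::{field, finite} poly)"
  by (simp add: pderiv_power)

text \<open>Adding G times a p-th power leaves the derivative unchanged, since both factors have
  derivative 0. So the derivative is a fixed nonzero polynomial, and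
  \<open>poly_make_coprime\<close> finds a representative prime to it.\<close>

lemma separable_in_residue_class:
  fixes a G :: "'a::{field, finite} poly"
  assumes "Rings.coprime a G" "G \<noteq> 0" "pderiv G = 0"
  shows "\<exists>x. [x = a] (mod G) \<and> Rings.coprime x (pderiv x)"
proof -
  \<comment> \<open>If a has derivative 0, shifting it by G times the variable gives it the
    derivative G.\<close>
  define b where "b = (if pderiv a = 0 then a + G * [:0, 1:] else a)"
  have d: "pderiv b \<noteq> 0" using assms by (auto simp: b_def pderiv_add pderiv_mult pderiv_pCons)
  have ba: "[b = a] (mod G)" by (auto simp: b_def cong_iff_dvd_diff simp del: mult_pCons_right)
  have "Rings.coprime b G"
  proof -
    obtain u v where uv: "u * a + v * G = 1" using assms(1) poly_bezout by blast
    obtain c where "b = a + G * c" using ba by (metis cong_iff_dvd_diff dvdE add_diff_cancel_left' diff_add_cancel add.commute)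
    then have "u * b + (v - u * c) * G = 1" using uv by (simp add: algebra_simps)
    then show ?thesis by (rule poly_coprimeI)
  qed
  moreover have "CHAR('a) > 0" using finite_imp_CHAR_pos[where 'a = 'a] by simp
  ultimately obtain s where
    s: "Rings.coprime (pderiv b) (b + G * s ^ CHAR('a))" using poly_make_coprime[OF _ d] by blast
  have "pderiv (b + G * s ^ CHAR('a)) = pderiv b" by (simp add: pderiv_add pderiv_mult assms(3) pderiv_power_CHAR)
  moreover have "[b + G * s ^ CHAR('a) = a] (mod G)"
    using ba by (simp add: cong_iff_dvd_diff) (metis add_diff_eq diff_add_eq dvd_add dvd_triv_left)
  ultimately show ?thesis using s by (metis coprime_commute)
qed

lemma separable_dvd_power:
  fixes x y :: "'a::field poly"
  assumes "Rings.coprime x (pderiv x)" "x \<noteq> 0" "x dvd y ^ n" shows "x dvd y"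
  using assms
proof (induction "degree x" arbitrary: x rule: less_induct)
  case less
  show ?case
  proof (cases "is_unit x")
    case False
    then obtain r where r: "Factorial_Ring.irreducible r" "r dvd x"
      using poly_irreducible_factor less.prems by blast
    obtain z where z: "x = r * z" using r by (elim dvdE)
    have nz: "r \<noteq> 0" "z \<noteq> 0" using z less.prems by auto
    have nu: "\<not> is_unit r" using r by (simp add: Factorial_Ring.irreducible_def)
    have "\<not> r dvd z"
    proof
      assume "r dvd z"
      then have "r dvd pderiv x" by (simp add: z pderiv_mult)
      then show False using less.prems(1) r(2) nu coprime_common_divisor by blast
    qed
    then have rz: "Rings.coprime r z" using poly_coprime_iff_prime[OF r(1)] by simp
    have "Rings.coprime z (pderiv z)"
    proof (rule coprimeI)
      fix c assume c: "c dvd z" "c dvd pderiv z"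
      then have "c dvd x" "c dvd pderiv x" by (simp_all add: z pderiv_mult)
      then show "is_unit c" using less.prems(1) coprime_common_divisor by blast
    qed
    moreover have "degree z < degree x" using nz nu by (simp add: z degree_mult_eq is_unit_iff_degree)
    moreover have "z dvd y ^ n" using less.prems(3) z dvd_trans dvd_triv_right by blast
    ultimately have "z dvd y" using less.hyps nz by blast
    moreover have "r dvd y ^ n" using less.prems(3) r(2) dvd_trans by blast
    then have "r dvd y" using r(1) prime_elem_dvd_power field_poly_irreducible_imp_prime by blast
    ultimately show ?thesis using poly_coprime_mult_dvd[OF rz] by (simp add: z)
  qed (use unit_imp_dvd in blast)
qed

text \<open>Take q to be the full power of p in an exponent n = q k with y^n = 1 modulo x. Then y^n
  - 1 is the q-th power of y^k - 1, and a separable divisor of a power divides the base.\<close>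

lemma separable_order:
  fixes x y :: "'a::{field, finite} poly"
  assumes x: "Rings.coprime x (pderiv x)" "x \<noteq> 0" and xy: "Rings.coprime x y"
  shows "\<exists>k. \<not> CHAR('a) dvd k \<and> x dvd y ^ k - 1"
proof -
  obtain n where n: "n > 0" "x dvd y ^ n - 1" using poly_power_eq_1[OF x(2) xy] by blast
  obtain k where k: "n = CHAR('a) ^ multiplicity CHAR('a) n * k" "\<not> CHAR('a) dvd k"
    using multiplicity_decompose'[of n "CHAR('a)"] n(1) prime_CHAR[where 'a = 'a]
    by (metis gr_implies_not0 not_prime_unit)
  define q where "q = CHAR('a) ^ multiplicity CHAR('a) n"
  have "(y ^ k - 1) ^ q = y ^ (k * q) - 1" unfolding q_def poly_diff_power_CHAR by (simp add: power_mult)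
  also have "k * q = n" unfolding q_def using k(1) by (metis mult.commute)
  finally have "x dvd (y ^ k - 1) ^ q" using n(2) by simp
  then show ?thesis using separable_dvd_power x k(2) by blast
qed

text \<open>One prime at a time: a solution for G stays one when shifted by a constant multiple of
  G, and the shift avoids the two bad classes at the new prime r. If r divides G already, the old
  solution serves.\<close>

lemma sum_of_two_units:
  fixes F a :: "'a::{field, finite} poly"
  assumes card: "CARD('a) > 2" and "F \<noteq> 0"
  shows "\<exists>t. Rings.coprime F t \<and> Rings.coprime F (a - t)"
  using assms(2)
proof (induction "degree F" arbitrary: F rule: less_induct)
  case less
  show ?case
  proof (cases "is_unit F")
    case True
    then show ?thesis by (intro exI[of _ 0]) (meson is_unit_left_imp_coprime)
  next
    case False
    then obtain r where r: "Factorial_Ring.irreducible r" "r dvd F"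
      using poly_irreducible_factor less.prems by blast
    obtain G where G: "F = r * G" using r by (elim dvdE)
    have nz: "r \<noteq> 0" "G \<noteq> 0" using G less.prems by auto
    have nu: "\<not> is_unit r" using r by (simp add: Factorial_Ring.irreducible_def)
    have "degree G < degree F" using nz nu by (simp add: G degree_mult_eq is_unit_iff_degree)
    from less.hyps[OF this nz(2)] obtain t0 where
      t0: "Rings.coprime G t0" "Rings.coprime G (a - t0)" by blast
    have goal: ?thesis if "Rings.coprime G t" "Rings.coprime G (a - t)" "\<not> r dvd t" "\<not> r dvd a - t" for t
      using that by (intro exI[of _ t]) (simp add: G poly_coprime_mult_left poly_coprime_iff_prime[OF r(1)])
    show ?thesis
    proof (cases "r dvd G")
      case True
      then have "\<not> r dvd t0" "\<not> r dvd a - t0" using t0 nu coprime_common_divisor by blast+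
      with t0 show ?thesis by (rule goal)
    next
      case False
      have "card {(t0, G), (a - t0, - G)} < CARD('a)" using card by (simp add: card_insert_if)
      then have "\<exists>c. \<forall>(a, b) \<in> {(t0, G), (a - t0, - G)}. \<not> r dvd a + b * [:c:]"
        using False by (intro const_avoid[OF r(1)]) auto
      then obtain c where c: "\<not> r dvd t0 + G * [:c:]" "\<not> r dvd a - t0 + - G * [:c:]" by auto
      have e: "a - (t0 + G * [:c:]) = (a - t0) + G * (- [:c:])" by (simp add: algebra_simps)
      show ?thesis
      proof (rule goal)
        show "Rings.coprime G (t0 + G * [:c:])" by (rule poly_coprime_add_mult[OF t0(1)])
        show "Rings.coprime G (a - (t0 + G * [:c:]))" unfolding e by (rule poly_coprime_add_mult[OF t0(2)])
        show "\<not> r dvd a - (t0 + G * [:c:])" unfolding e using c(2) by (simp only: mult_minus_left mult_minus_right not_False_eq_True)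
      qed (rule c(1))
    qed
  qed
qed

lemma one_minus_power:
  fixes F :: "'a::comm_ring_1"
  shows "\<exists>c. (1 - F) ^ k = 1 - of_nat k * F + F * F * c"
proof (induction k)
  case 0
  then show ?case by (intro exI[of _ 0]) simp
next
  case (Suc k)
  then obtain c where c: "(1 - F) ^ k = 1 - of_nat k * F + F * F * c" ..
  have "(1 - F) ^ Suc k = 1 - of_nat (Suc k) * F + F * F * (of_nat k + c - F * c)"
    by (simp add: c algebra_simps)
  then show ?case ..
qed

section \<open>Elementary matrices of coprime levels commute modulo \<open>E\<close>\<close>

context s_arith
begin

text \<open>The conjugate has upper left entry u; for invertible u this is its factorisation into a
  lower triangular, a diagonal and an upper triangular matrix.\<close>

lemma unit_decomposition:
  fixes x y u :: "'k::field"
  assumes "x * y = 1 - u" "u \<noteq> 0"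
  shows "e21 y + e12 x - e21 y = e21 (- (x * y * y / u)) + dg u + e12 (x / u)"
proof (rule sl2_eqI)
  have u: "1 - x * y = u" using assms(1) by simp
  have L: "ent11 (e21 y + e12 x - e21 y) = 1 - x * y" "ent12 (e21 y + e12 x - e21 y) = x"
    "ent21 (e21 y + e12 x - e21 y) = - (x * y * y)" "ent22 (e21 y + e12 x - e21 y) = 1 + x * y"
    by (simp_all add: diff_conv_add_uminus ent_plus ent_uminus del: add_uminus_conv_diff)
      (simp_all add: algebra_simps)
  have R: "ent11 (e21 (- (x * y * y / u)) + dg u + e12 (x / u)) = u"
    "ent12 (e21 (- (x * y * y / u)) + dg u + e12 (x / u)) = x"
    "ent21 (e21 (- (x * y * y / u)) + dg u + e12 (x / u)) = - (x * y * y)"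
    "ent22 (e21 (- (x * y * y / u)) + dg u + e12 (x / u)) = (1 - x * y * y * x) / u"
    using assms(2) by (simp_all add: ent_plus) (simp_all add: field_simps)
  show "ent11 (e21 y + e12 x - e21 y) = ent11 (e21 (- (x * y * y / u)) + dg u + e12 (x / u))"
    "ent12 (e21 y + e12 x - e21 y) = ent12 (e21 (- (x * y * y / u)) + dg u + e12 (x / u))"
    "ent21 (e21 y + e12 x - e21 y) = ent21 (e21 (- (x * y * y / u)) + dg u + e12 (x / u))"
    unfolding L R using u by simp_all
  have "(1 + x * y) * u = 1 - x * y * y * x" unfolding u[symmetric] by (simp add: algebra_simps)
  then show "ent22 (e21 y + e12 x - e21 y) = ent22 (e21 (- (x * y * y / u)) + dg u + e12 (x / u))"
    unfolding L R using assms(2) by (simp add: eq_divide_eq)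
qed

lemma minus_one_dvd_power: "x - 1 dvd x ^ n - (1 :: 'k::comm_ring_1)"
proof (induction n)
  case (Suc n)
  have eq: "x ^ Suc n - 1 = x * (x ^ n - 1) + (x - 1)" by (simp add: algebra_simps)
  show ?case unfolding eq using Suc by (intro dvd_add dvd_mult) simp_all
qed simp

text \<open>In \<open>unit_decomposition\<close> with y = 1 and x = 1 - u, the conjugate is
  unipotent of level f and both triangular factors have level f, so the diagonal factor is left in
  \<open>E f\<close>.\<close>

lemma dg_E:
  assumes u: "u \<noteq> 0" "inverse u \<in> B" "u - 1 \<in> J f" and f: "f \<in> B"
  shows "dg u \<in> E f"
proof -
  have u1: "1 - u \<in> J f" using J_uminus[OF u(3)] by simp
  have J: "(1 - u) * 1 * 1 / u \<in> J f" "(1 - u) / u \<in> J f"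
    using J_mult_B[OF u(2) u1] by (simp_all add: divide_inverse mult.commute)
  have "e21 1 \<in> Lv 1" by (simp add: e21_Lv)
  then have c: "e21 1 + e12 (1 - u) - e21 1 \<in> E f" using u1 by (intro E_conj e12_E)
  have "dg u = - e21 (- ((1 - u) * 1 * 1 / u)) + (e21 1 + e12 (1 - u) - e21 1) + - e12 ((1 - u) / u)"
    unfolding unit_decomposition[of "1 - u" 1 u, OF _ u(1), simplified] by (simp add: add.assoc)
  then show ?thesis using c J by (metis E_add E_uminus J_uminus e12_E e21_E)
qed

definition commutes :: "'a poly fract \<Rightarrow> 'a poly fract \<Rightarrow> 'a poly fract \<Rightarrow> bool" where
  "commutes f x y \<longleftrightarrow> e21 y + e12 x - e21 y - e12 x \<in> E f"

text \<open>In \<open>unit_decomposition\<close> the lower factor has entry -x y^2/u, the diagonal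
  one is congruent to 1, and x/u differs from x by x (x y)/u. Every deviation from
  \<open>e12 x\<close> contains the factor x y, which has level f.\<close>

lemma commutes_base:
  assumes B: "x \<in> B" "y \<in> B" and u: "x * y = 1 - u" "u \<noteq> 0" "inverse u \<in> B" and f: "x * y \<in> J f" "f \<in> B"
  shows "commutes f x y"
proof -
  have "u - 1 \<in> J f" using J_uminus[OF f(1)] u(1) by simp
  then have 1: "dg u \<in> E f" using u f by (intro dg_E)
  have "(inverse u * y) * (x * y) \<in> J f" using B u by (intro J_mult_B[OF _ f(1)]) simp
  then have 2: "x * y * y / u \<in> J f" by (simp add: divide_inverse ac_simps)
  have "x / u - x = x * (1 - u) / u" using u(2) by (simp add: divide_simps algebra_simps)
  also have "\<dots> = (x * inverse u) * (x * y)" by (simp add: u(1) divide_inverse ac_simps)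
  also have "\<dots> \<in> J f" using B u by (intro J_mult_B[OF _ f(1)]) simp
  finally have 3: "x / u - x \<in> J f" .
  have "e21 y + e12 x - e21 y - e12 x = (e21 y + e12 x - e21 y) + e12 (- x)" by (simp add: e12_uminus)
  also have "\<dots> = e21 (- (x * y * y / u)) + dg u + (e12 (x / u) + e12 (- x))"
    unfolding unit_decomposition[OF u(1,2)] by (simp only: add.assoc)
  also have "e12 (x / u) + e12 (- x) = e12 (x / u - x)" by (simp only: e12_add[symmetric] add_uminus_conv_diff)
  finally have "e21 y + e12 x - e21 y - e12 x = e21 (- (x * y * y / u)) + dg u + e12 (x / u - x)" .
  then show ?thesis unfolding commutes_def using 1 2 3 by (simp add: e21_E e12_E)
qed

lemma commutes_add_left:
  assumes "commutes f x y" "commutes f x' y" "x \<in> B" shows "commutes f (x + x') y"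
proof -
  define A where "A = e21 y + e12 x - e21 y - e12 x"
  define A' where "A' = e21 y + e12 x' - e21 y - e12 x'"
  have "e21 y + e12 (x + x') - e21 y - e12 (x + x') = A + (e12 x + A' - e12 x)"
    by (simp add: A_def A'_def e12_add diff_conv_add_uminus minus_add add.assoc del: add_uminus_conv_diff)
  moreover have "e12 x + A' - e12 x \<in> E f" using assms by (intro E_conj) (simp_all add: e12_Lv commutes_def A'_def)
  ultimately show ?thesis using assms(1) by (simp add: commutes_def A_def)
qed

lemma commutes_add_right:
  assumes "commutes f x y" "commutes f x y'" "y \<in> B" shows "commutes f x (y + y')"
proof -
  define A where "A = e21 y + e12 x - e21 y - e12 x"
  define A' where "A' = e21 y' + e12 x - e21 y' - e12 x"
  have "e21 (y + y') + e12 x - e21 (y + y') - e12 x = (e21 y + A' - e21 y) + A"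
    by (simp add: A_def A'_def e21_add diff_conv_add_uminus minus_add add.assoc del: add_uminus_conv_diff)
  moreover have "e21 y + A' - e21 y \<in> E f" using assms by (intro E_conj) (simp_all add: e21_Lv commutes_def A'_def)
  ultimately show ?thesis using assms(1) by (simp add: commutes_def A_def)
qed

lemma commutes_J_left: assumes "x \<in> J f" "y \<in> B" shows "commutes f x y"
proof -
  have "e21 y + e12 x - e21 y \<in> E f" using assms by (intro E_conj e12_E) (simp_all add: e21_Lv)
  then show ?thesis using assms e12_E by (simp add: commutes_def)
qed

lemma commutes_J_right: assumes "y \<in> J f" "x \<in> B" shows "commutes f x y"
proof -
  have "e12 x + - e21 y - e12 x \<in> E f"
    using assms by (intro E_conj E_uminus e21_E) (simp_all add: e12_Lv)
  then have "e21 y + (e12 x + - e21 y - e12 x) \<in> E f" using assms e21_E by simp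
  then show ?thesis by (simp add: commutes_def diff_conv_add_uminus add.assoc del: add_uminus_conv_diff)
qed

lemma commutes_of_nat: assumes "commutes f x y" "x \<in> B" "y \<in> B" shows "commutes f x (of_nat n * y)"
proof (induction n)
  case 0
  then show ?case using commutes_J_right[of 0] assms by simp
next
  case (Suc n)
  then show ?case using commutes_add_right[OF assms(1) Suc] assms by (simp add: algebra_simps)
qed

lemma commutes_mono: "commutes f x y \<Longrightarrow> f \<in> J g \<Longrightarrow> commutes g x y"
  unfolding commutes_def using E_mono by blast

lemma commutes_cong:
  assumes "commutes f x y" "x' - x \<in> J f" "y' - y \<in> J f" and B: "x \<in> B" "y \<in> B" "f \<in> B"
  shows "commutes f x' y'"
proof -
  have B': "x' - x \<in> B" "y' - y \<in> B" using assms J_B by blast+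
  have 1: "commutes f (x + (x' - x)) y"
    by (rule commutes_add_left[OF assms(1) commutes_J_left[OF assms(2) B(2)] B(1)])
  have x': "x' \<in> B" using B_add[OF B(1) B'(1)] by simp
  have "commutes f x' (y + (y' - y))"
    by (rule commutes_add_right[OF _ commutes_J_right[OF assms(3) x'] B(2)]) (use 1 in simp)
  then show ?thesis by simp
qed

lemma coprime_one_minus_pi_power: assumes "m > 0" shows "Rings.coprime (1 - \<pi> ^ m) \<pi>"
proof (rule poly_coprimeI)
  show "1 * (1 - \<pi> ^ m) + \<pi> ^ (m - 1) * \<pi> = 1" using assms by (simp add: power_eq_if mult.commute)
qed

text \<open>
  If \<open>xy = 1 - u\<close> for a unit \<open>u\<close>, then \<open>e12 x\<close> and \<open>e21 y\<close> commute modulo \<open>E f\<close> as soon as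
  \<open>u \<equiv> 1\<close> modulo \<open>f\<close>. The prescribed residues of \<open>x\<close> and \<open>y\<close> are realised by choosing \<open>x\<close>
  squarefree, so that it divides \<open>1 - \<pi>\<^sup>k\<close> for some \<open>k\<close> prime to the characteristic.
\<close>

lemma commutes_core:
  assumes m: "m > 0" and F: "F = 1 - \<pi> ^ (CHAR('a) * m)" "F = F1 * F2" "Rings.coprime F1 F2"
    and a: "Rings.coprime a F2" and w0: "Rings.coprime w0 F1"
  shows "commutes (\<iota> F) (\<iota> (F1 * a)) (\<iota> (F2 * w0))"
proof -
  define p where "p = CHAR('a)"
  have p: "p > 0" using finite_imp_CHAR_pos[where 'a = 'a] by (simp add: p_def)
  have pm: "p * m > 0" using p m by simp
  have F\<pi>: "Rings.coprime F \<pi>" unfolding F(1) by (rule coprime_one_minus_pi_power[OF pm[unfolded p_def]])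
  have F_nz: "F \<noteq> 0"
  proof
    assume "F = 0"
    with F\<pi> have "is_unit \<pi>" by simp
    then show False using irr_pi by (simp add: Factorial_Ring.irreducible_def)
  qed
  \<comment> \<open>The extra \<pi>^p makes \<xi> prime to \<pi> as well and keeps G a p-th power,
    as F is by the choice of its exponent; hence G has derivative 0.\<close>
  define G where "G = F * \<pi> ^ p"
  have "F = (1 - \<pi> ^ m) ^ p"
    using poly_diff_power_CHAR[of 1 "\<pi> ^ m" 1] by (simp add: F(1) p_def power_mult[symmetric] mult.commute)
  then have "G = ((1 - \<pi> ^ m) * \<pi>) ^ p" by (simp add: G_def power_mult_distrib)
  then have dG: "pderiv G = 0" unfolding p_def by (simp only: pderiv_power_CHAR)
  have G_nz: "G \<noteq> 0" using F_nz by (simp add: G_def)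
  obtain w1 where w1: "[w0 * w1 = 1] (mod F1)" using poly_cong_inverse[OF w0] ..
  \<comment> \<open>The residue of \<xi> is a modulo F2 and 1/w0 modulo F1. As
    \<open>\<xi> * w\<close> will be congruent to k modulo F, the cofactor w becomes k w0 modulo
    F1.\<close>
  obtain b where b: "[b = w1] (mod F1)" "[b = a] (mod F2)" using poly_crt[OF F(3)] by blast
  obtain c where c: "[c = b] (mod F)" "[c = 1] (mod \<pi> ^ p)"
    using poly_crt[of F "\<pi> ^ p" b 1] F\<pi> poly_coprime_power by blast
  have cop_cong: "Rings.coprime x q" if "[x = y] (mod q)" "Rings.coprime y q" for x y q :: "'a poly"
    using that by (meson coprime_cong_cong_left)
  have cF: "[c = b] (mod F1)" "[c = b] (mod F2)" using c(1) F(2) by (simp_all add: cong_modulus_mult mult.commute) (metis cong_modulus_mult mult.commute)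
  have "Rings.coprime c F1"
  proof (rule cop_cong)
    show "[c = w1] (mod F1)" using cF(1) b(1) cong_trans by blast
    have "Rings.coprime (w0 * w1) F1" using w1 by (rule cop_cong) simp
    then show "Rings.coprime w1 F1" by (simp add: poly_coprime_mult_left)
  qed
  moreover have "Rings.coprime c F2" using cF(2) b(2) a cop_cong cong_trans by blast
  moreover have "Rings.coprime c (\<pi> ^ p)" using c(2) by (rule cop_cong) simp
  ultimately have cG: "Rings.coprime c G" by (simp add: G_def F(2) poly_coprime_mult_right)
  obtain \<xi> where \<xi>: "[\<xi> = c] (mod G)" "Rings.coprime \<xi> (pderiv \<xi>)"
    using separable_in_residue_class[OF cG G_nz dG] by blast
  have \<xi>G: "Rings.coprime \<xi> G" using \<xi>(1) cG cop_cong by blast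
  then have \<xi>F: "Rings.coprime F \<xi>" and "Rings.coprime \<xi> (\<pi> ^ p)"
    by (simp_all add: G_def poly_coprime_mult_right coprime_commute)
  then have \<xi>\<pi>: "Rings.coprime \<xi> \<pi>" using p by (meson coprime_divisors dvd_power dvd_refl)
  have \<xi>_nz: "\<xi> \<noteq> 0"
  proof
    assume "\<xi> = 0"
    with \<xi>\<pi> have "is_unit \<pi>" by simp
    then show False using irr_pi by (simp add: Factorial_Ring.irreducible_def)
  qed
  obtain k where k: "\<not> p dvd k" "\<xi> dvd \<pi> ^ k - 1"
    using separable_order[OF \<xi>(2) \<xi>_nz \<xi>\<pi>] unfolding p_def by blast
  \<comment> \<open>With u = \<pi>^(pmk) = (1 - F)^k, the quotient of 1 - u by F is k modulo F. It
    is prime to every prime of F because p does not divide k.\<close>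
  obtain d where d: "(1 - F) ^ k = 1 - of_nat k * F + F * F * d" using one_minus_power by blast
  have u: "\<pi> ^ (p * m * k) = (1 - F) ^ k" by (simp add: F(1) p_def power_mult)
  have Fd: "1 - \<pi> ^ (p * m * k) = F * (of_nat k - F * d)" unfolding u d by (simp add: algebra_simps)
  have "\<xi> dvd \<pi> ^ (p * m * k) - 1"
  proof -
    have "\<pi> ^ k - 1 dvd (\<pi> ^ k) ^ (p * m) - 1" by (rule minus_one_dvd_power)
    then show ?thesis using k(2) dvd_trans by (simp add: power_mult[symmetric] mult.commute)
  qed
  then have "\<xi> dvd F * (of_nat k - F * d)" unfolding Fd[symmetric] by (metis dvd_minus_iff minus_diff_eq)
  then have "\<xi> dvd of_nat k - F * d" using \<xi>F poly_coprime_dvd_mult coprime_commute by metis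
  then obtain w where w: "of_nat k - F * d = \<xi> * w" by (elim dvdE)
  define v where "v = \<iota> (\<pi> ^ (p * m * k))"
  have xy: "\<iota> (F1 * \<xi>) * \<iota> (F2 * w) = 1 - v"
  proof -
    have "F1 * \<xi> * (F2 * w) = 1 - \<pi> ^ (p * m * k)" unfolding Fd w by (simp add: F(2) ac_simps)
    then show ?thesis by (simp add: v_def flip: to_fract_mult to_fract_diff to_fract_1)
  qed
  have "inverse v \<in> B"
  proof -
    have "inverse v = inverse (\<iota> \<pi>) ^ (p * m * k)" by (simp add: v_def to_fract_power power_inverse)
    then show ?thesis by simp
  qed
  moreover have "\<iota> (F1 * \<xi>) * \<iota> (F2 * w) \<in> J (\<iota> F)"
  proof -
    have "F dvd (F1 * \<xi>) * (F2 * w)" unfolding F(2) by (intro mult_dvd_mono) simp_all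
    from J_iota_I[OF this] show ?thesis by simp
  qed
  ultimately have "commutes (\<iota> F) (\<iota> (F1 * \<xi>)) (\<iota> (F2 * w))"
    using xy by (intro commutes_base) (simp_all add: v_def del: to_fract_mult)
  then have 1: "commutes (\<iota> F) (\<iota> (F1 * a)) (\<iota> (F2 * (of_nat k * w0)))"
  proof (rule commutes_cong)
    have \<xi>F1: "[\<xi> = c] (mod F)" using \<xi>(1) unfolding G_def by (rule cong_modulus_mult)
    have \<xi>12: "[\<xi> = c] (mod F1)" "[\<xi> = c] (mod F2)"
      using \<xi>F1 F(2) by (simp_all add: cong_modulus_mult mult.commute) (metis cong_modulus_mult mult.commute)
    have "[a = \<xi>] (mod F2)" using \<xi>12(2) cF(2) b(2) by (meson cong_sym cong_trans)
    then have "F2 dvd a - \<xi>" by (simp add: cong_iff_dvd_diff)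
    then have "F dvd F1 * a - F1 * \<xi>" unfolding F(2) by (simp add: right_diff_distrib[symmetric])
    from J_iota_I[OF this] show "\<iota> (F1 * a) - \<iota> (F1 * \<xi>) \<in> J (\<iota> F)" by simp
    have x1: "[\<xi> = w1] (mod F1)" using \<xi>12(1) cF(1) b(1) cong_trans by blast
    have "[w0 * (\<xi> * w) = w0 * of_nat k] (mod F1)"
    proof (rule cong_scalar_left)
      have "F1 dvd of_nat k - \<xi> * w" unfolding w[symmetric] F(2) by simp
      then show "[\<xi> * w = of_nat k] (mod F1)" by (simp add: cong_iff_dvd_diff dvd_diff_commute)
    qed
    moreover have "[w0 * \<xi> * w = 1 * w] (mod F1)"
      using x1 w1 by (meson cong_scalar_left cong_scalar_right cong_trans)
    ultimately have "[of_nat k * w0 = w] (mod F1)" by (simp add: ac_simps) (metis cong_sym cong_trans)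
    then have "F1 dvd of_nat k * w0 - w" by (simp add: cong_iff_dvd_diff)
    then have "F dvd F2 * (of_nat k * w0) - F2 * w" unfolding F(2)
      by (simp add: right_diff_distrib[symmetric] mult.commute)
    from J_iota_I[OF this] show "\<iota> (F2 * (of_nat k * w0)) - \<iota> (F2 * w) \<in> J (\<iota> F)" by simp
  qed simp_all
  \<comment> \<open>Commutation is known for k w0 in place of w0. In characteristic p an integer
    multiple of k w0 equals w0, and \<open>commutes\<close> is additive.\<close>
  have "Rings.coprime p k" unfolding p_def by (rule prime_imp_coprime[OF prime_CHAR k(1)[unfolded p_def]])
  then have "Rings.coprime k p" using coprime_commute by blast
  then obtain k' where "[k * k' = Suc 0] (mod p)" using cong_solve_coprime_nat by blast
  then have kk: "of_nat (k * k') = (1 :: 'a poly)"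
    using of_nat_eq_iff_cong_CHAR[where 'a = "'a poly", of "k * k'" "Suc 0"] by (simp add: p_def CHAR_poly_eq)
  have iota_nat: "of_nat n = \<iota> (of_nat n)" for n by (induction n) simp_all
  have "of_nat k' * \<iota> (F2 * (of_nat k * w0)) = \<iota> (F2 * (of_nat (k * k') * w0))"
    by (simp add: iota_nat ac_simps)
  also have "\<dots> = \<iota> (F2 * w0)" unfolding kk by simp
  finally have eq: "of_nat k' * \<iota> (F2 * (of_nat k * w0)) = \<iota> (F2 * w0)" .
  show ?thesis using commutes_of_nat[OF 1 B_iota B_iota, of k'] unfolding eq .
qed

text \<open>Reduction to \<open>commutes_core\<close>. The product f1 f2 divides some F = 1 -
  \<pi>^(pm), and the primes of F are divided between F1 and F2. Coefficients in B are replaced by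
  polynomials, and these by sums of two units. An entry of level f1 is one of level F1 plus one of
  level f1 f2, and likewise for f2.\<close>

theorem commutes_coprime:
  assumes f: "Rings.coprime f1 f2" "Rings.coprime (f1 * f2) \<pi>"
    and x: "x \<in> J (\<iota> f1)" and y: "y \<in> J (\<iota> f2)"
  shows "commutes (\<iota> (f1 * f2)) x y"
proof -
  define p where "p = CHAR('a)"
  have p: "p > 0" using finite_imp_CHAR_pos[where 'a = 'a] by (simp add: p_def)
  have nz: "f1 * f2 \<noteq> 0" using f(2) irr_pi by (auto simp: Factorial_Ring.irreducible_def)
  obtain m where m: "m > 0" "f1 * f2 dvd \<pi> ^ m - 1" using poly_power_eq_1[OF nz f(2)] by blast
  define F where "F = 1 - \<pi> ^ (p * m)"
  have fF: "f1 * f2 dvd F"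
  proof -
    have "\<pi> ^ m - 1 dvd (\<pi> ^ m) ^ p - 1" by (rule minus_one_dvd_power)
    then have "\<pi> ^ m - 1 dvd - F" by (simp add: F_def power_mult[symmetric] mult.commute)
    then show ?thesis using m(2) dvd_trans by simp
  qed
  have F\<pi>: "Rings.coprime F \<pi>" unfolding F_def using m p by (intro coprime_one_minus_pi_power) simp
  have F_nz: "F \<noteq> 0" using F\<pi> irr_pi by (auto simp: Factorial_Ring.irreducible_def)
  obtain F1 F2 N where F: "F = F1 * F2" "F1 dvd f1 ^ N" "Rings.coprime F2 f1"
    using poly_coprime_splitting[OF F_nz] by blast
  have cop1: "Rings.coprime F1 g" if "Rings.coprime f1 g" for g
  proof -
    have "Rings.coprime (f1 ^ N) g" using that poly_coprime_power[of g f1 N] by (simp add: coprime_commute)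
    then show ?thesis using F(2) by (meson coprime_divisors dvd_refl)
  qed
  have F12: "Rings.coprime F1 F2" using F(3) by (intro cop1) (simp only: coprime_commute)
  have f1: "f1 dvd F1"
  proof (rule poly_coprime_dvd_mult)
    show "f1 dvd F2 * F1" using fF F(1) by (metis dvd_mult_left mult.commute)
  qed (use F(3) in \<open>simp add: coprime_commute\<close>)
  have f2: "f2 dvd F2"
  proof (rule poly_coprime_dvd_mult)
    show "f2 dvd F1 * F2" using fF F(1) by (metis dvd_mult_right)
    show "Rings.coprime f2 F1" using cop1[OF f(1)] by (simp only: coprime_commute)
  qed
  have core: "commutes (\<iota> F) (\<iota> (F1 * a)) (\<iota> (F2 * b))" for a b
  proof -
    have card2: "CARD('a) > 2" using card by simp
    obtain s where s: "Rings.coprime F s" "Rings.coprime F (a - s)" using sum_of_two_units[OF card2 F_nz] by blast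
    obtain t where t: "Rings.coprime F t" "Rings.coprime F (b - t)" using sum_of_two_units[OF card2 F_nz] by blast
    have c: "commutes (\<iota> F) (\<iota> (F1 * x)) (\<iota> (F2 * y))" if "Rings.coprime F x" "Rings.coprime F y" for x y
    proof (rule commutes_core[OF m(1) F_def[unfolded p_def] F(1) F12])
      show "Rings.coprime x F2" "Rings.coprime y F1"
        using that unfolding F(1) poly_coprime_mult_left by (metis coprime_commute)+
    qed
    have "commutes (\<iota> F) (\<iota> (F1 * x)) (\<iota> (F2 * b))" if "Rings.coprime F x" for x
    proof -
      have "commutes (\<iota> F) (\<iota> (F1 * x)) (\<iota> (F2 * t) + \<iota> (F2 * (b - t)))"
        using c that t by (intro commutes_add_right) (simp_all del: to_fract_mult)
      then show ?thesis by (simp add: algebra_simps)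
    qed
    then have "commutes (\<iota> F) (\<iota> (F1 * s) + \<iota> (F1 * (a - s))) (\<iota> (F2 * b))"
      using s by (intro commutes_add_left) (simp_all del: to_fract_mult)
    then show ?thesis by (simp add: algebra_simps)
  qed
  have main: "commutes (\<iota> F) x y" if xy: "x \<in> J (\<iota> F1)" "y \<in> J (\<iota> F2)" for x y
  proof -
    obtain b c where bc: "b \<in> B" "x = \<iota> F1 * b" "c \<in> B" "y = \<iota> F2 * c" using xy by (auto simp: J_def)
    have cop: "Rings.coprime F1 \<pi>" "Rings.coprime F2 \<pi>" using F\<pi> F(1) by (simp_all add: poly_coprime_mult_left)
    obtain b' where b': "b - \<iota> b' \<in> J (\<iota> F2)" using B_approx[OF cop(2) bc(1)] ..
    obtain c' where c': "c - \<iota> c' \<in> J (\<iota> F1)" using B_approx[OF cop(1) bc(3)] ..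
    have "x - \<iota> (F1 * b') \<in> J (\<iota> F)" "y - \<iota> (F2 * c') \<in> J (\<iota> F)"
      using J_mult[OF J_self b', of "\<iota> F1"] J_mult[OF J_self c', of "\<iota> F2"]
      by (simp_all add: bc F(1) algebra_simps)
    with core show ?thesis by (rule commutes_cong) simp_all
  qed
  obtain x1 x2 where x12: "x1 \<in> J (\<iota> (F1 * f1))" "x2 \<in> J (\<iota> (F2 * f1))" "x = x1 + x2"
    using J_split[OF F12 x] by blast
  obtain y1 y2 where y12: "y1 \<in> J (\<iota> (F1 * f2))" "y2 \<in> J (\<iota> (F2 * f2))" "y = y1 + y2"
    using J_split[OF F12 y] by blast
  have "J (\<iota> (F1 * f1)) \<subseteq> J (\<iota> F1)" "J (\<iota> (F2 * f1)) \<subseteq> J (\<iota> (f1 * f2))"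
    "J (\<iota> (F1 * f2)) \<subseteq> J (\<iota> (f1 * f2))" "J (\<iota> (F2 * f2)) \<subseteq> J (\<iota> F2)"
    using f1 f2 by (intro J_dvd; simp add: mult_dvd_mono mult.commute[of f1])+
  then have J: "x1 \<in> J (\<iota> F1)" "x2 \<in> J (\<iota> (f1 * f2))" "y1 \<in> J (\<iota> (f1 * f2))" "y2 \<in> J (\<iota> F2)"
    using x12 y12 by blast+
  have "\<iota> F \<in> J (\<iota> (f1 * f2))" using fF by (rule J_iota_I)
  from commutes_mono[OF main[OF J(1,4)] this] show ?thesis
    by (rule commutes_cong) (use J x12 y12 J_iota_B in \<open>simp_all del: to_fract_mult\<close>)
qed

section \<open>Words of coprime levels, denominators and the Weyl relation\<close>

definition near :: "'a poly fract \<Rightarrow> 'a poly fract sl2 \<Rightarrow> 'a poly fract sl2 \<Rightarrow> bool" where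
  "near f c g \<longleftrightarrow> - g + (c + g - c) \<in> E f"

lemma near_add:
  assumes "near f c g" "near f c h" "h \<in> Lv 1" shows "near f c (g + h)"
proof -
  have "- (g + h) + (c + (g + h) - c) = (- h + (- g + (c + g - c)) + h) + (- h + (c + h - c))"
    unfolding conj_add by (simp add: add.assoc minus_add diff_conv_add_uminus del: add_uminus_conv_diff)
  then show ?thesis using assms E_conj' by (simp add: near_def)
qed

lemma near_0 [simp]: "near f c 0"
  by (simp add: near_def)

lemma e12_commute: "e12 x + e12 y = e12 y + e12 x" and e21_commute: "e21 x + e21 y = e21 y + e21 x"
  by (simp_all add: add.commute flip: e12_add e21_add)

lemma near_e12_e12: "near f (e12 x) (e12 y)" and near_e21_e21: "near f (e21 x) (e21 y)"
  using e12_commute[of x y] e21_commute[of x y] by (simp_all add: near_def)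

lemma near_e12_e21:
  assumes "commutes f x y" "y \<in> B" shows "near f (e12 x) (e21 y)"
proof -
  have "- e21 y + (- (e21 y + e12 x - e21 y - e12 x)) + e21 y \<in> E f"
    using assms by (intro E_conj' E_uminus) (simp_all add: e21_Lv commutes_def)
  then show ?thesis
    by (simp add: near_def minus_add add.assoc diff_conv_add_uminus del: add_uminus_conv_diff)
qed

lemma near_e21_e12:
  assumes "commutes f x y" "x \<in> B" shows "near f (e21 y) (e12 x)"
proof -
  have "- e12 x + (e21 y + e12 x - e21 y - e12 x) + e12 x \<in> E f"
    using assms by (intro E_conj') (simp_all add: e12_Lv commutes_def)
  then show ?thesis
    by (simp add: near_def minus_add add.assoc diff_conv_add_uminus del: add_uminus_conv_diff)
qed

lemma Fg_Lv: "f \<in> B \<Longrightarrow> g \<in> Fg f \<Longrightarrow> g \<in> Lv f"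
  using E_Lv Fg_E by blast

lemma Fg_Lv1: "f \<in> B \<Longrightarrow> g \<in> Fg f \<Longrightarrow> g \<in> Lv 1"
  using Fg_Lv Lv_subset_1 by blast

lemma near_Fg:
  assumes f: "Rings.coprime f1 f2" "Rings.coprime (f1 * f2) \<pi>" and t: "t \<in> J (\<iota> f1)" and W: "W \<in> Fg (\<iota> f2)"
  shows "near (\<iota> (f1 * f2)) (e12 t) W" "near (\<iota> (f1 * f2)) (e21 t) W"
proof -
  have "near (\<iota> (f1 * f2)) (e12 t) W \<and> near (\<iota> (f1 * f2)) (e21 t) W" using W
  proof (induction rule: Fg.induct)
    case (Fg_12 x h)
    have f': "Rings.coprime f2 f1" "Rings.coprime (f2 * f1) \<pi>" using f by (simp_all add: coprime_commute mult.commute)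
    have "commutes (\<iota> (f1 * f2)) x t" using commutes_coprime[OF f' Fg_12(1) t] by (simp add: mult.commute)
    then show ?case using Fg_12 Fg_Lv1[OF B_iota Fg_12(2)] J_iota_B
      by (auto intro!: near_add near_e12_e12 near_e21_e12)
  next
    case (Fg_21 x h)
    have "commutes (\<iota> (f1 * f2)) t x" by (rule commutes_coprime[OF f t Fg_21(1)])
    then show ?case using Fg_21 Fg_Lv1[OF B_iota Fg_21(2)] J_iota_B
      by (auto intro!: near_add near_e21_e21 near_e12_e21)
  qed simp
  then show "near (\<iota> (f1 * f2)) (e12 t) W" "near (\<iota> (f1 * f2)) (e21 t) W" by blast+
qed

lemma dg_conj:
  fixes u :: "'k::field"
  assumes "u \<noteq> 0"
  shows "- dg u + e12 x + dg u = e12 (x / u^2)" "- dg u + e21 x + dg u = e21 (u^2 * x)"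
  using assms by (intro sl2_eqI; simp add: ent_plus ent_uminus field_simps power2_eq_square)+

lemma ent_dg_conj:
  fixes u :: "'k::field"
  assumes "u \<noteq> 0"
  shows "ent11 (dg u + g - dg u) = ent11 g" "ent12 (dg u + g - dg u) = u^2 * ent12 g"
    "ent21 (dg u + g - dg u) = ent21 g / u^2" "ent22 (dg u + g - dg u) = ent22 g"
proof -
  have "ent11 (dg u + g - dg u) = u * ent11 g * inverse u" "ent12 (dg u + g - dg u) = u * ent12 g * u"
    "ent21 (dg u + g - dg u) = inverse u * ent21 g * inverse u" "ent22 (dg u + g - dg u) = inverse u * ent22 g * u"
    unfolding diff_conv_add_uminus using assms by (simp_all add: ent_plus ent_uminus del: add_uminus_conv_diff)
  then show "ent11 (dg u + g - dg u) = ent11 g" "ent12 (dg u + g - dg u) = u^2 * ent12 g"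
    "ent21 (dg u + g - dg u) = ent21 g / u^2" "ent22 (dg u + g - dg u) = ent22 g"
    using assms by (simp_all add: power2_eq_square divide_simps)
qed

text \<open>Conjugation by diag(z, 1/z) divides lower left entries by z^2; this is what the factor
  z^2 in the level pays for.\<close>

lemma E_dg_conj:
  assumes z: "z \<noteq> 0" and g: "g \<in> E (\<iota> (f * z^2))"
  shows "dg (\<iota> z) + g - dg (\<iota> z) \<in> E (\<iota> f)"
proof (rule E_conj_gen[OF _ g])
  fix g assume g: "g \<in> Lv (\<iota> (f * z^2))"
  have sub: "J (\<iota> (f * z^2)) \<subseteq> J (\<iota> f)" by (rule J_dvd) simp
  have "x / (\<iota> z)^2 \<in> J (\<iota> f)" if x: "x \<in> J (\<iota> (f * z^2))" for x
  proof -
    obtain b where "b \<in> B" "x = \<iota> (f * z^2) * b" using x unfolding J_def by blast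
    then have "x / (\<iota> z)^2 = \<iota> f * b" using z by (simp add: to_fract_power field_simps)
    then show ?thesis using \<open>b \<in> B\<close> by (intro J_I)
  qed
  moreover have "(\<iota> z)^2 * x \<in> J (\<iota> f)" if "x \<in> J (\<iota> (f * z^2))" for x
    using that sub by (intro J_mult_B) auto
  ultimately show "dg (\<iota> z) + g - dg (\<iota> z) \<in> Lv (\<iota> f)"
    using g sub z unfolding Lv_def by (auto simp: ent_dg_conj)
qed

lemma conj_add': "- d + (g + h) + d = (- d + g + d) + (- d + h + (d :: 'g::group_add))"
  by (simp add: add.assoc)

text \<open>Conjugation by diag(z, 1/z) clears the denominator of t. This takes a factor z^2 from
  the level of W, and conjugating the resulting relation back takes another, whence the exponent
  4.\<close>

lemma near_denominator:
  assumes f: "Rings.coprime f1 f2" "Rings.coprime (f1 * f2) \<pi>"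
    and z: "Rings.coprime z f1" "Rings.coprime z \<pi>" "z \<noteq> 0"
    and t: "\<iota> z * t \<in> J (\<iota> f1)" and W: "W \<in> Fg (\<iota> (f2 * z^4))"
  shows "near (\<iota> (f1 * f2)) (e21 t) W"
proof -
  define d where "d = dg (\<iota> z)"
  have zn: "\<iota> z \<noteq> 0" using z by simp
  define W' where "W' = - d + W + d"
  have W': "W' \<in> Fg (\<iota> (f2 * z^2))" unfolding W'_def using W
  proof (induction rule: Fg.induct)
    case (Fg_12 x h)
    obtain b where b: "b \<in> B" "x = \<iota> (f2 * z^4) * b" using Fg_12(1) unfolding J_def by blast
    have "f2 * z^4 = f2 * z^2 * z^2" by (simp flip: power_add add: mult.assoc)
    then have "x = \<iota> (f2 * z^2) * b * (\<iota> z)^2" unfolding b(2) by (simp only: to_fract_mult to_fract_power mult_ac)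
    then have "x / (\<iota> z)^2 = \<iota> (f2 * z^2) * b" using zn by simp
    then have "x / (\<iota> z)^2 \<in> J (\<iota> (f2 * z^2))" using b(1) by (intro J_I)
    then show ?case using Fg_12(3) unfolding conj_add' d_def dg_conj[OF zn] by (intro Fg.Fg_12)
  next
    case (Fg_21 x h)
    have "J (\<iota> (f2 * z^4)) \<subseteq> J (\<iota> (f2 * z^2))" by (rule J_dvd) (simp add: le_imp_power_dvd mult_dvd_mono)
    then have "(\<iota> z)^2 * x \<in> J (\<iota> (f2 * z^2))" using Fg_21(1) by (intro J_mult_B) auto
    then show ?case using Fg_21(3) unfolding conj_add' d_def dg_conj[OF zn] by (intro Fg.Fg_21)
  qed simp
  have z2: "Rings.coprime f1 (f2 * z^2)" "Rings.coprime (f1 * (f2 * z^2)) \<pi>"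
    using f z by (simp_all add: poly_coprime_mult_right poly_coprime_mult_left poly_coprime_power coprime_commute
       power2_eq_square)
  have eq: "(\<iota> z)^2 * t = \<iota> z * (\<iota> z * t)" by (simp add: power2_eq_square)
  have "(\<iota> z)^2 * t \<in> J (\<iota> f1)" unfolding eq by (rule J_mult_B[OF B_iota t])
  from near_Fg(2)[OF z2 this W'] have "- W' + (e21 ((\<iota> z)^2 * t) + W' - e21 ((\<iota> z)^2 * t)) \<in> E (\<iota> (f1 * f2 * z^2))"
    by (simp add: near_def mult.assoc)
  from E_dg_conj[OF z(3) this] have
    "d + (- W' + (e21 ((\<iota> z)^2 * t) + W' - e21 ((\<iota> z)^2 * t))) - d \<in> E (\<iota> (f1 * f2))" by (simp add: d_def)
  moreover have "e21 ((\<iota> z)^2 * t) = - d + e21 t + d" unfolding d_def dg_conj[OF zn] ..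
  ultimately show ?thesis unfolding near_def W'_def
    by (simp add: add.assoc minus_add diff_conv_add_uminus del: add_uminus_conv_diff)
qed

text \<open>Conjugation by w(z), spelt out factor by factor so that each factor can be split
  separately.\<close>

lemma weyl_exact:
  fixes z :: "'k::field"
  assumes "z \<noteq> 0"
  shows "e12 z + (e21 (- 1 / z) + (e12 z + e12 y - e12 z) - e21 (- 1 / z)) - e12 z = e21 (- y / z^2)"
proof -
  have "e12 z + e12 y - e12 z = e12 y" by (simp add: e12_commute)
  moreover have "e12 z + (e21 (- 1 / z) + e12 y - e21 (- 1 / z)) - e12 z = e21 (- y / z^2)"
    unfolding diff_conv_add_uminus e12_uminus[symmetric] e21_uminus[symmetric]
    using assms by (intro sl2_eqI; simp add: ent_plus; simp add: field_simps power2_eq_square)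
  ultimately show ?thesis by simp
qed

lemma near_conj:
  assumes "near f c W" shows "\<exists>h \<in> E f. c + W - c = W + h"
  using assms by (intro bexI[of _ "- W + (c + W - c)"]) (simp_all add: near_def)

text \<open>
  The Weyl element \<open>w(z) = e12 z + e21 (-1/z) + e12 z\<close> has a denominator at \<open>z\<close>. Its factors are split
  into a part supported at \<open>f1\<close> (the multiples of \<open>\<epsilon>\<close>) and a part which is trivial modulo \<open>f1\<close>; the
  latter commutes with words supported at \<open>f1\<close>, also in presence of the denominator.
\<close>

lemma weyl_relation:
  assumes f: "Rings.coprime f1 f2" "Rings.coprime (f1 * f2) \<pi>"
    and z: "Rings.coprime z f1" "Rings.coprime z \<pi>" "z \<noteq> 0"
    and \<epsilon>: "[\<epsilon> = 1] (mod f1)" "f2 * z^4 dvd \<epsilon>"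
  shows "\<exists>h \<in> E (\<iota> (f1 * f2)). e21 (- (\<iota> \<epsilon> * \<iota> x) / (\<iota> z)^2)
    = (e12 (\<iota> \<epsilon> * \<iota> z) + e21 (- \<iota> \<epsilon> / \<iota> z) + e12 (\<iota> \<epsilon> * \<iota> z)) + e12 (\<iota> \<epsilon> * \<iota> x)
      - (e12 (\<iota> \<epsilon> * \<iota> z) + e21 (- \<iota> \<epsilon> / \<iota> z) + e12 (\<iota> \<epsilon> * \<iota> z)) + h"
proof -
  define y where "y = \<iota> \<epsilon> * \<iota> x"
  define A where "A = e12 (\<iota> \<epsilon> * \<iota> z)"
  define C where "C = e21 (- \<iota> \<epsilon> / \<iota> z)"
  have zn: "\<iota> z \<noteq> 0" using z by simp
  \<comment> \<open>Divisibility by z^4 makes \<epsilon>/z a polynomial and gives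
    \<open>e12 y\<close> the level \<open>f2 * z^4\<close> that \<open>near_denominator\<close> asks
    for.\<close>
  obtain c where c: "\<epsilon> = f2 * z^4 * c" using \<epsilon>(2) by (elim dvdE)
  have "1 - \<iota> \<epsilon> = \<iota> (1 - \<epsilon>)" by simp
  moreover have "f1 dvd 1 - \<epsilon>" using \<epsilon>(1) by (simp add: cong_iff_dvd_diff dvd_diff_commute)
  ultimately have \<epsilon>1: "1 - \<iota> \<epsilon> \<in> J (\<iota> f1)" by (metis J_iota_I)
  have B: "A \<in> Lv 1" "C \<in> Fg (\<iota> f2)"
  proof -
    show "A \<in> Lv 1" unfolding A_def by (intro e12_Lv) simp
    have z4: "\<iota> z ^ 4 = \<iota> z * \<iota> z ^ 3" by (simp flip: power_Suc)
    have "- \<iota> \<epsilon> / \<iota> z = \<iota> (f2 * (- (z^3 * c)))" using zn by (simp add: c to_fract_power z4)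
    then have "- \<iota> \<epsilon> / \<iota> z \<in> J (\<iota> f2)" by (simp add: J_iota_I del: to_fract_mult)
    then show "C \<in> Fg (\<iota> f2)" unfolding C_def by (rule Fg_e21)
  qed
  then have C1: "C \<in> Lv 1" using Fg_Lv1[OF B_iota] by blast
  have W0: "e12 y \<in> Fg (\<iota> (f2 * z^4))"
  proof -
    have "y = \<iota> (f2 * z^4 * (c * x))" by (simp add: y_def c)
    then have "y \<in> J (\<iota> (f2 * z^4))" by (simp add: J_iota_I del: to_fract_mult)
    then show ?thesis by (rule Fg_e12)
  qed
  have W0': "e12 y \<in> Fg (\<iota> f2)"
  proof -
    have "\<iota> (f2 * z^4) \<in> J (\<iota> f2)" by (rule J_iota_I) simp
    then show ?thesis using W0 Fg_mono by blast
  qed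
  \<comment> \<open>The rest of -1/z after its multiple of \<epsilon>: still with denominator z, but
    of level f1 once multiplied by z.\<close>
  define t2 where "t2 = - (1 - \<iota> \<epsilon>) / \<iota> z"
  have "\<iota> z * t2 \<in> J (\<iota> f1)" using J_uminus[OF \<epsilon>1] zn by (simp add: t2_def)
  from near_conj[OF near_denominator[OF f z this W0]] obtain h1 where
    h1: "h1 \<in> E (\<iota> (f1 * f2))" "e21 t2 + e12 y - e21 t2 = e12 y + h1" by blast
  have "- 1 / \<iota> z = - \<iota> \<epsilon> / \<iota> z + t2" using zn by (simp add: t2_def field_simps)
  then have s2: "e21 (- 1 / \<iota> z) = C + e21 t2" by (simp only: C_def e21_add)
  define W2 where "W2 = C + e12 y - C"
  have W2: "W2 \<in> Fg (\<iota> f2)"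
    unfolding W2_def diff_conv_add_uminus using B W0' by (intro Fg_add Fg_uminus)
  define h2 where "h2 = C + h1 - C"
  have h2: "h2 \<in> E (\<iota> (f1 * f2))" unfolding h2_def using C1 h1 by (intro E_conj)
  have Y2: "e21 (- 1 / \<iota> z) + e12 y - e21 (- 1 / \<iota> z) = W2 + h2"
  proof -
    have "e21 (- 1 / \<iota> z) + e12 y - e21 (- 1 / \<iota> z) = C + (e21 t2 + e12 y - e21 t2) - C"
      unfolding s2 by (simp add: add.assoc minus_add diff_conv_add_uminus del: add_uminus_conv_diff)
    also have "\<dots> = W2 + h2" unfolding h1 conj_add W2_def h2_def ..
    finally show ?thesis .
  qed
  define t3 where "t3 = (1 - \<iota> \<epsilon>) * \<iota> z"
  have "t3 \<in> J (\<iota> f1)" unfolding t3_def by (rule J_B_mult[OF B_iota \<epsilon>1])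
  from near_conj[OF near_Fg(1)[OF f this W2]] obtain h3 where
    h3: "h3 \<in> E (\<iota> (f1 * f2))" "e12 t3 + W2 - e12 t3 = W2 + h3" by blast
  have "\<iota> z = \<iota> \<epsilon> * \<iota> z + t3" by (simp add: t3_def algebra_simps)
  then have s3: "e12 (\<iota> z) = A + e12 t3" unfolding A_def by (metis e12_add)
  have "e21 (- y / (\<iota> z)^2) = e12 (\<iota> z) + (W2 + h2) - e12 (\<iota> z)"
    using weyl_exact[OF zn, of y] Y2 by (simp add: e12_commute)
  also have "\<dots> = A + (e12 t3 + W2 - e12 t3) - A + (e12 (\<iota> z) + h2 - e12 (\<iota> z))"
    unfolding conj_add s3 by (simp add: add.assoc minus_add diff_conv_add_uminus del: add_uminus_conv_diff)
  also have "\<dots> = (A + W2 - A) + ((A + h3 - A) + (e12 (\<iota> z) + h2 - e12 (\<iota> z)))"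
    unfolding h3 conj_add by (simp only: add.assoc)
  also have "A + W2 - A = (A + C + A) + e12 y - (A + C + A)"
  proof -
    have "A + e12 y - A = e12 y" unfolding A_def by (simp add: e12_commute)
    then have "A + W2 - A = A + (C + (A + e12 y - A) - C) - A" by (simp add: W2_def)
    then show ?thesis by (simp add: add.assoc minus_add diff_conv_add_uminus del: add_uminus_conv_diff)
  qed
  finally have *: "e21 (- y / (\<iota> z)^2) = (A + C + A) + e12 y - (A + C + A)
    + ((A + h3 - A) + (e12 (\<iota> z) + h2 - e12 (\<iota> z)))" .
  have "(A + h3 - A) + (e12 (\<iota> z) + h2 - e12 (\<iota> z)) \<in> E (\<iota> (f1 * f2))"
    using B h2 h3 by (intro E_add E_conj) (simp_all add: e12_Lv)
  with * show ?thesis unfolding y_def A_def C_def by blast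
qed

end

section \<open>Homomorphisms to groups without 2-torsion and p-torsion\<close>

fun nsum :: "nat \<Rightarrow> 'g::group_add \<Rightarrow> 'g" where
  "nsum 0 g = 0"
| "nsum (Suc n) g = g + nsum n g"

text \<open>Trace 2 gives (g - 1)^2 = 0, so the n-th power of g is 1 + n (g - 1). In characteristic
  p its p-th power is trivial.\<close>

lemma unipotent_nsum:
  fixes g :: "'k::field sl2"
  assumes "ent11 g + ent22 g = 2"
  shows "ent11 (nsum n g) = 1 + of_nat n * (ent11 g - 1) \<and> ent12 (nsum n g) = of_nat n * ent12 g
    \<and> ent21 (nsum n g) = of_nat n * ent21 g \<and> ent22 (nsum n g) = 1 + of_nat n * (ent22 g - 1)"
proof (induction n)
  case 0
  then show ?case by (simp add: ent_zero)
next
  case (Suc n)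
  have d: "ent22 g = 2 - ent11 g" using assms by (simp add: algebra_simps)
  have bc: "ent12 g * ent21 g = - ((ent11 g - 1) * (ent11 g - 1))"
    using det_ent[of g] unfolding d by (simp add: algebra_simps)
  have cb: "ent21 g * ent12 g = - ((ent11 g - 1) * (ent11 g - 1))" using bc by (simp add: mult.commute)
  have "ent11 g * (1 + of_nat n * (ent11 g - 1)) + ent12 g * (of_nat n * ent21 g)
     = ent11 g * (1 + of_nat n * (ent11 g - 1)) + of_nat n * (ent12 g * ent21 g)"
    "ent21 g * (of_nat n * ent12 g) + (2 - ent11 g) * (1 + of_nat n * (2 - ent11 g - 1))
     = of_nat n * (ent21 g * ent12 g) + (2 - ent11 g) * (1 + of_nat n * (2 - ent11 g - 1))"
    by (simp_all add: ac_simps)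
  then show ?case using Suc by (simp add: ent_plus d) (simp add: bc cb algebra_simps)
qed

definition grp :: "'g::group_add set \<Rightarrow> 'g monoid" where
  "grp S = \<lparr>carrier = S, monoid.mult = (+), monoid.one = 0\<rparr>"

lemma grp_simps [simp]: "carrier (grp S) = S" "monoid.mult (grp S) = (+)" "monoid.one (grp S) = 0"
  by (simp_all add: grp_def)

lemma group_grp:
  assumes "0 \<in> S" "\<And>x y. x \<in> S \<Longrightarrow> y \<in> S \<Longrightarrow> x + y \<in> S" "\<And>x. x \<in> S \<Longrightarrow> - x \<in> S"
  shows "group (grp S)"
proof (rule groupI)
  fix x assume "x \<in> carrier (grp S)"
  then show "\<exists>y\<in>carrier (grp S). y \<otimes>\<^bsub>grp S\<^esub> x = \<one>\<^bsub>grp S\<^esub>" using assms by (intro bexI[of _ "- x"]) auto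
qed (use assms in \<open>auto simp: add.assoc\<close>)

text \<open>\<Phi> stands for the glued homomorphism and M for the cokernel; \<open>M_2\<close> and
  \<open>M_p\<close> are what is used of the exponent l being prime to 2 and p.\<close>

locale s_arith_hom = s_arith \<pi> + M: comm_group M
  for \<pi> :: "'a::{field, finite} poly" and M :: "('m, 'n) monoid_scheme" +
  fixes f :: "'a poly" and \<Phi> :: "'a poly fract sl2 \<Rightarrow> 'm"
  assumes f_pi: "Rings.coprime f \<pi>"
    and \<Phi>_closed [simp]: "g \<in> Lv (\<iota> f) \<Longrightarrow> \<Phi> g \<in> carrier M"
    and \<Phi>_add: "g \<in> Lv (\<iota> f) \<Longrightarrow> h \<in> Lv (\<iota> f) \<Longrightarrow> \<Phi> (g + h) = \<Phi> g \<otimes>\<^bsub>M\<^esub> \<Phi> h"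
    and M_2: "x \<in> carrier M \<Longrightarrow> x \<otimes>\<^bsub>M\<^esub> x = \<one>\<^bsub>M\<^esub> \<Longrightarrow> x = \<one>\<^bsub>M\<^esub>"
    and M_p: "x \<in> carrier M \<Longrightarrow> x [^]\<^bsub>M\<^esub> CHAR('a) = \<one>\<^bsub>M\<^esub> \<Longrightarrow> x = \<one>\<^bsub>M\<^esub>"
begin

lemma \<Phi>_0: "\<Phi> 0 = \<one>\<^bsub>M\<^esub>"
proof -
  have "\<Phi> 0 \<otimes>\<^bsub>M\<^esub> \<Phi> 0 = \<Phi> 0" using \<Phi>_add[of 0 0] by simp
  then show ?thesis by simp
qed

lemma nsum_Lv: "g \<in> Lv (\<iota> f) \<Longrightarrow> nsum n g \<in> Lv (\<iota> f)"
  by (induction n) simp_all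

lemma \<Phi>_nsum: "g \<in> Lv (\<iota> f) \<Longrightarrow> \<Phi> (nsum n g) = \<Phi> g [^]\<^bsub>M\<^esub> n"
proof (induction n)
  case (Suc n)
  then show ?case using nsum_Lv by (simp add: \<Phi>_add M.m_comm)
qed (simp add: \<Phi>_0)

lemma \<Phi>_unipotent:
  assumes g: "g \<in> Lv (\<iota> f)" "ent11 g + ent22 g = 2" shows "\<Phi> g = \<one>\<^bsub>M\<^esub>"
proof -
  have iota_nat: "of_nat n = \<iota> (of_nat n)" for n by (induction n) simp_all
  have "(of_nat CHAR('a) :: 'a poly) = 0" using of_nat_CHAR[where 'a = "'a poly"] by (simp add: CHAR_poly_eq)
  then have z: "(of_nat CHAR('a) :: 'a poly fract) = 0" using iota_nat[of "CHAR('a)"] by simp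
  have "nsum CHAR('a) g = 0"
    using unipotent_nsum[OF g(2), of "CHAR('a)"] unfolding z by (intro sl2_eqI) (simp_all add: ent_zero)
  then show ?thesis using \<Phi>_nsum[OF g(1), of "CHAR('a)"] g(1) M_p by (simp add: \<Phi>_0)
qed

text \<open>The largest subgroup of the kernel that is normal in SL2(B). It contains
  \<open>E (\<iota> f)\<close> and can be divided out of congruence subgroups on which \<Phi> is not
  defined.\<close>

definition N :: "'a poly fract sl2 set" where
  "N = {c \<in> Lv (\<iota> f). \<forall>g \<in> Lv 1. \<Phi> (g + c - g) = \<one>\<^bsub>M\<^esub>}"

lemma N_Lv: "c \<in> N \<Longrightarrow> c \<in> Lv (\<iota> f)"
  by (simp add: N_def)

lemma N_kernel: "c \<in> N \<Longrightarrow> \<Phi> c = \<one>\<^bsub>M\<^esub>"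
  unfolding N_def by (auto dest!: bspec[of _ _ 0])

lemma N_conj: assumes "c \<in> N" "g \<in> Lv 1" shows "g + c - g \<in> N"
proof -
  have "\<Phi> (h + (g + c - g) - h) = \<one>\<^bsub>M\<^esub>" if "h \<in> Lv 1" for h
  proof -
    have "h + (g + c - g) - h = (h + g) + c - (h + g)"
      by (simp add: add.assoc minus_add diff_conv_add_uminus del: add_uminus_conv_diff)
    then show ?thesis using assms that by (simp add: N_def)
  qed
  then show ?thesis using assms Lv_conj by (simp add: N_def)
qed

lemma N_0: "0 \<in> N"
  by (simp add: N_def \<Phi>_0)

lemma N_add: assumes "c \<in> N" "d \<in> N" shows "c + d \<in> N"
  using assms unfolding N_def by (simp add: conj_add \<Phi>_add Lv_conj)

lemma N_uminus: assumes "c \<in> N" shows "- c \<in> N"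
proof -
  have "\<Phi> (g + - c - g) = \<one>\<^bsub>M\<^esub>" if g: "g \<in> Lv 1" for g
  proof -
    have "c \<in> Lv (\<iota> f)" using assms by (rule N_Lv)
    then have L: "g + c - g \<in> Lv (\<iota> f)" "g + - c - g \<in> Lv (\<iota> f)" by (intro Lv_conj g Lv_uminus; assumption)+
    have "(g + c - g) + (g + - c - g) = 0" unfolding conj_add[symmetric] by simp
    then have "\<Phi> (g + c - g) \<otimes>\<^bsub>M\<^esub> \<Phi> (g + - c - g) = \<one>\<^bsub>M\<^esub>" using \<Phi>_add[OF L] \<Phi>_0 by simp
    moreover have "\<Phi> (g + c - g) = \<one>\<^bsub>M\<^esub>" using assms g by (simp add: N_def)
    ultimately show ?thesis using L by simp
  qed
  then show ?thesis using assms by (simp add: N_def)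
qed

lemma E_N: "g \<in> E (\<iota> f) \<Longrightarrow> g \<in> N"
proof (induction rule: E.induct)
  case (E_step g h)
  have "g \<in> N" unfolding N_def using E_step Lv_conj \<Phi>_unipotent by (auto simp: trace_conj)
  with E_step show ?case by (simp add: N_add)
qed (rule N_0)

lemma e12_N: "x \<in> J (\<iota> f) \<Longrightarrow> e12 x \<in> N" and e21_N: "x \<in> J (\<iota> f) \<Longrightarrow> e21 x \<in> N"
  by (simp_all add: E_N e12_E e21_E)

section \<open>The quotient at a single prime power\<close>

context
  fixes s f2 :: "'a poly" and k :: nat
  assumes s: "Factorial_Ring.irreducible s" and k: "k > 0" and f_eq: "f = s ^ k * f2" and s_f2: "\<not> s dvd f2"
begin

lemma m_f2: "Rings.coprime (s ^ k) f2"
  using poly_coprime_power[of f2 s k] s_f2 poly_coprime_iff_prime[OF s] by (simp add: coprime_commute)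

lemma cop_pi: "Rings.coprime (s ^ k) \<pi>" "Rings.coprime f2 \<pi>"
  using f_pi by (simp_all add: f_eq poly_coprime_mult_left)

lemma Lv_f_sub: "Lv (\<iota> f) \<subseteq> Lv (\<iota> f2)" "Lv (\<iota> f) \<subseteq> Lv (\<iota> (s ^ k))"
  by (intro Lv_mono J_iota_I; simp add: f_eq)+

lemma Lv_f_Int: assumes "g \<in> Lv (\<iota> (s ^ k))" "g \<in> Lv (\<iota> f2)" shows "g \<in> Lv (\<iota> f)"
  using assms J_coprime_Int[OF m_f2] unfolding Lv_def f_eq by simp

definition G where "G = grp (Lv (\<iota> f2))"

lemma group_G: "group G"
  unfolding G_def by (rule group_grp) simp_all

lemma inv_G: assumes "x \<in> Lv (\<iota> f2)" shows "inv\<^bsub>G\<^esub> x = - x"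
  using group.inv_equality[OF group_G, of "- x" x] assms by (simp add: G_def)

lemma normal_N: "N \<lhd> G"
proof -
  have "subgroup N G"
  proof (rule group.subgroupI[OF group_G])
    show "N \<subseteq> carrier G" using N_Lv Lv_f_sub by (auto simp: G_def)
    show "N \<noteq> {}" using N_0 by auto
    fix a assume a: "a \<in> N"
    then have "a \<in> Lv (\<iota> f2)" using N_Lv Lv_f_sub by blast
    then show "inv\<^bsub>G\<^esub> a \<in> N" using a by (simp add: inv_G N_uminus)
    fix b assume "b \<in> N"
    then show "a \<otimes>\<^bsub>G\<^esub> b \<in> N" using a by (simp add: G_def N_add)
  qed
  moreover have "x \<otimes>\<^bsub>G\<^esub> h \<otimes>\<^bsub>G\<^esub> inv\<^bsub>G\<^esub> x \<in> N" if "x \<in> carrier G" "h \<in> N" for x h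
  proof -
    have x: "x \<in> Lv (\<iota> f2)" using that by (simp add: G_def)
    then have "x \<in> Lv 1" using Lv_subset_1[OF B_iota] by blast
    from N_conj[OF that(2) this] show ?thesis unfolding inv_G[OF x] by (simp add: G_def)
  qed
  ultimately show ?thesis by (simp add: group.normal_inv_iff[OF group_G])
qed

definition Q where "Q = G Mod N"

definition \<kappa> where "\<kappa> g = N #>\<^bsub>G\<^esub> g"

lemma group_Q: "group Q"
  unfolding Q_def by (rule normal.factorgroup_is_group[OF normal_N])

lemma \<kappa>_hom: "g \<in> Lv (\<iota> f2) \<Longrightarrow> h \<in> Lv (\<iota> f2) \<Longrightarrow> \<kappa> (g + h) = \<kappa> g \<otimes>\<^bsub>Q\<^esub> \<kappa> h"
  using normal.rcos_sum[OF normal_N, of g h] by (simp add: \<kappa>_def Q_def G_def FactGroup_def)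

lemma carrier_Q: "carrier Q = \<kappa> ` Lv (\<iota> f2)"
  by (auto simp: Q_def FactGroup_def RCOSETS_def \<kappa>_def G_def)

lemma \<kappa>_closed [simp]: "g \<in> Lv (\<iota> f2) \<Longrightarrow> \<kappa> g \<in> carrier Q"
  by (simp add: carrier_Q)

lemma \<kappa>_set: "\<kappa> g = (\<lambda>n. n + g) ` N"
  by (auto simp: \<kappa>_def r_coset_def G_def)

lemma \<kappa>_eq_iff: "\<kappa> g = \<kappa> h \<longleftrightarrow> g - h \<in> N"
proof
  assume "\<kappa> g = \<kappa> h"
  moreover have "g \<in> \<kappa> g" unfolding \<kappa>_set using N_0 by (intro image_eqI[of _ _ 0]) simp_all
  ultimately obtain n where "n \<in> N" "g = n + h" by (auto simp: \<kappa>_set)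
  then show "g - h \<in> N" by simp
next
  assume n: "g - h \<in> N"
  show "\<kappa> g = \<kappa> h"
  proof
    show "\<kappa> g \<subseteq> \<kappa> h"
    proof
      fix x assume "x \<in> \<kappa> g"
      then obtain n' where "n' \<in> N" "x = n' + g" by (auto simp: \<kappa>_set)
      then show "x \<in> \<kappa> h" unfolding \<kappa>_set using n N_add
        by (intro image_eqI[of _ _ "n' + (g - h)"]) (simp_all add: add.assoc)
    qed
    show "\<kappa> h \<subseteq> \<kappa> g"
    proof
      fix x assume "x \<in> \<kappa> h"
      then obtain n' where n': "n' \<in> N" "x = n' + h" by (auto simp: \<kappa>_set)
      have "n' - (g - h) \<in> N"
        using N_add[OF n'(1) N_uminus[OF n]] by (simp only: add_uminus_conv_diff)
      moreover have "x = n' - (g - h) + g" using n'(2) by (simp add: diff_conv_add_uminus minus_add add.assoc del: add_uminus_conv_diff)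
      ultimately show "x \<in> \<kappa> g" unfolding \<kappa>_set by blast
    qed
  qed
qed

lemma \<kappa>_one: "\<kappa> 0 = \<one>\<^bsub>Q\<^esub>"
proof -
  interpret Q: group Q by (rule group_Q)
  have "\<kappa> 0 \<otimes>\<^bsub>Q\<^esub> \<kappa> 0 = \<kappa> 0" using \<kappa>_hom[of 0 0] by simp
  then show ?thesis by simp
qed

lemma \<kappa>_eq_one: "\<kappa> g = \<one>\<^bsub>Q\<^esub> \<longleftrightarrow> g \<in> N"
  using \<kappa>_eq_iff[of g 0] by (simp add: \<kappa>_one)

lemma \<kappa>_inv: "g \<in> Lv (\<iota> f2) \<Longrightarrow> inv\<^bsub>Q\<^esub> (\<kappa> g) = \<kappa> (- g)"
  using \<kappa>_hom[of "- g" g] group.inv_equality[OF group_Q, of "\<kappa> (- g)" "\<kappa> g"] by (simp add: \<kappa>_one)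

text \<open>Well defined on cosets, since the elements of N are congruent to 1 modulo f and hence
  modulo s^k.\<close>

definition rel where
  "rel C a b c d \<longleftrightarrow> (\<exists>g \<in> Lv (\<iota> f2). C = \<kappa> g \<and> ent11 g - \<iota> a \<in> J (\<iota> (s ^ k)) \<and> ent12 g - \<iota> b \<in> J (\<iota> (s ^ k))
     \<and> ent21 g - \<iota> c \<in> J (\<iota> (s ^ k)) \<and> ent22 g - \<iota> d \<in> J (\<iota> (s ^ k)))"

lemma J_cong_mult:
  assumes "x - \<iota> a \<in> J (\<iota> m)" "y - \<iota> b \<in> J (\<iota> m)" "y \<in> B"
  shows "x * y - \<iota> (a * b) \<in> J (\<iota> m)"
proof -
  have "x * y - \<iota> (a * b) = (x - \<iota> a) * y + \<iota> a * (y - \<iota> b)" by (simp add: algebra_simps)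
  then show ?thesis using assms by (simp add: J_B_mult J_mult_B)
qed

lemma J_cong_add:
  assumes "x - \<iota> a \<in> J (\<iota> m)" "y - \<iota> b \<in> J (\<iota> m)"
  shows "x + y - \<iota> (a + b) \<in> J (\<iota> m)"
proof -
  have "x + y - \<iota> (a + b) = (x - \<iota> a) + (y - \<iota> b)" by simp
  then show ?thesis using assms by (metis J_add)
qed

lemma Lv_entries: "g \<in> Lv (\<iota> h) \<Longrightarrow> ent11 g \<in> B \<and> ent12 g \<in> B \<and> ent21 g \<in> B \<and> ent22 g \<in> B"
  using Lv_subset_1[OF B_iota] Lv_1 by blast

lemma rel_cong':
  assumes "rel C a b c d" "[a = a'] (mod s ^ k)" "[b = b'] (mod s ^ k)" "[c = c'] (mod s ^ k)" "[d = d'] (mod s ^ k)"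
  shows "rel C a' b' c' d'"
proof -
  have "x - \<iota> v \<in> J (\<iota> (s ^ k))" if "x - \<iota> u \<in> J (\<iota> (s ^ k))" "[u = v] (mod s ^ k)" for x u v
  proof -
    have "\<iota> u - \<iota> v \<in> J (\<iota> (s ^ k))" using that(2) J_iota_cong[OF cop_pi(1)] by blast
    from J_add[OF that(1) this] show ?thesis by simp
  qed
  with assms show ?thesis unfolding rel_def by blast
qed

lemma rel_unique':
  assumes "rel C a b c d" "rel C a' b' c' d'"
  shows "[a = a'] (mod s ^ k) \<and> [b = b'] (mod s ^ k) \<and> [c = c'] (mod s ^ k) \<and> [d = d'] (mod s ^ k)"
proof -
  obtain g where g: "g \<in> Lv (\<iota> f2)" "C = \<kappa> g" "ent11 g - \<iota> a \<in> J (\<iota> (s ^ k))" "ent12 g - \<iota> b \<in> J (\<iota> (s ^ k))"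
     "ent21 g - \<iota> c \<in> J (\<iota> (s ^ k))" "ent22 g - \<iota> d \<in> J (\<iota> (s ^ k))" using assms(1) unfolding rel_def by blast
  obtain h where h: "h \<in> Lv (\<iota> f2)" "C = \<kappa> h" "ent11 h - \<iota> a' \<in> J (\<iota> (s ^ k))" "ent12 h - \<iota> b' \<in> J (\<iota> (s ^ k))"
     "ent21 h - \<iota> c' \<in> J (\<iota> (s ^ k))" "ent22 h - \<iota> d' \<in> J (\<iota> (s ^ k))" using assms(2) unfolding rel_def by blast
  define n where "n = g - h"
  have "\<kappa> g = \<kappa> h" using g(2) h(2) by simp
  then have "n \<in> N" by (simp only: \<kappa>_eq_iff n_def)
  then have n: "n \<in> Lv (\<iota> (s ^ k))" using N_Lv Lv_f_sub by blast
  have gn: "g = n + h" by (simp add: n_def)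
  have nJ: "ent11 n - 1 \<in> J (\<iota> (s ^ k))" "ent12 n \<in> J (\<iota> (s ^ k))" "ent21 n \<in> J (\<iota> (s ^ k))" "ent22 n - 1 \<in> J (\<iota> (s ^ k))"
    using n by (simp_all add: Lv_def)
  note hB = Lv_entries[OF h(1)]
  have "ent11 g - ent11 h = (ent11 n - 1) * ent11 h + ent12 n * ent21 h"
    "ent12 g - ent12 h = (ent11 n - 1) * ent12 h + ent12 n * ent22 h"
    "ent21 g - ent21 h = ent21 n * ent11 h + (ent22 n - 1) * ent21 h"
    "ent22 g - ent22 h = ent21 n * ent12 h + (ent22 n - 1) * ent22 h"
    unfolding gn by (simp_all add: ent_plus algebra_simps)
  then have d: "ent11 g - ent11 h \<in> J (\<iota> (s ^ k))" "ent12 g - ent12 h \<in> J (\<iota> (s ^ k))"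
    "ent21 g - ent21 h \<in> J (\<iota> (s ^ k))" "ent22 g - ent22 h \<in> J (\<iota> (s ^ k))"
    using nJ hB by (metis J_add J_B_mult)+
  have "[u = v] (mod s ^ k)" if "x - \<iota> u \<in> J (\<iota> (s ^ k))" "y - \<iota> v \<in> J (\<iota> (s ^ k))" "x - y \<in> J (\<iota> (s ^ k))" for x y u v
  proof -
    have "\<iota> u - \<iota> v = (x - y) - (x - \<iota> u) + (y - \<iota> v)" by simp
    then have "\<iota> u - \<iota> v \<in> J (\<iota> (s ^ k))" using that by (metis J_add J_diff)
    then show ?thesis using J_iota_cong[OF cop_pi(1)] by blast
  qed
  then show ?thesis using g h d by meson
qed

lemma rel_mult':
  assumes "rel C a b c d" "rel C' a' b' c' d'"
  shows "rel (C \<otimes>\<^bsub>Q\<^esub> C') (a * a' + b * c') (a * b' + b * d') (c * a' + d * c') (c * b' + d * d')"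
proof -
  obtain g where g: "g \<in> Lv (\<iota> f2)" "C = \<kappa> g" "ent11 g - \<iota> a \<in> J (\<iota> (s ^ k))" "ent12 g - \<iota> b \<in> J (\<iota> (s ^ k))"
     "ent21 g - \<iota> c \<in> J (\<iota> (s ^ k))" "ent22 g - \<iota> d \<in> J (\<iota> (s ^ k))" using assms(1) unfolding rel_def by blast
  obtain h where h: "h \<in> Lv (\<iota> f2)" "C' = \<kappa> h" "ent11 h - \<iota> a' \<in> J (\<iota> (s ^ k))" "ent12 h - \<iota> b' \<in> J (\<iota> (s ^ k))"
     "ent21 h - \<iota> c' \<in> J (\<iota> (s ^ k))" "ent22 h - \<iota> d' \<in> J (\<iota> (s ^ k))" using assms(2) unfolding rel_def by blast
  note hB = Lv_entries[OF h(1)]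
  show ?thesis unfolding rel_def
  proof (intro bexI[of _ "g + h"] conjI)
    show "C \<otimes>\<^bsub>Q\<^esub> C' = \<kappa> (g + h)" using g h by (simp add: \<kappa>_hom)
    show "g + h \<in> Lv (\<iota> f2)" using g h by simp
  qed (unfold ent_plus, (intro J_cong_add J_cong_mult; use g h hB in blast)+)
qed

lemma rel_inv': assumes "rel C a b c d" shows "rel (inv\<^bsub>Q\<^esub> C) d (- b) (- c) a"
proof -
  obtain g where g: "g \<in> Lv (\<iota> f2)" "C = \<kappa> g" "ent11 g - \<iota> a \<in> J (\<iota> (s ^ k))" "ent12 g - \<iota> b \<in> J (\<iota> (s ^ k))"
     "ent21 g - \<iota> c \<in> J (\<iota> (s ^ k))" "ent22 g - \<iota> d \<in> J (\<iota> (s ^ k))" using assms(1) unfolding rel_def by blast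
  have neg: "- x - \<iota> (- u) = - (x - \<iota> u)" for x u by simp
  show ?thesis unfolding rel_def
    by (intro bexI[of _ "- g"] conjI; (unfold ent_uminus neg)?) (use g \<kappa>_inv in \<open>simp_all del: minus_diff_eq\<close>)
qed

lemma \<epsilon>_ex: "\<exists>\<epsilon>. [\<epsilon> = 1] (mod s ^ k) \<and> [\<epsilon> = 0] (mod f2)"
  using poly_crt[OF m_f2] by blast

text \<open>The idempotent of A/f that belongs to s^k: multiplication by it keeps the residue at s
  and makes the residue modulo f2 zero.\<close>

definition \<epsilon> where "\<epsilon> = (SOME \<epsilon>. [\<epsilon> = 1] (mod s ^ k) \<and> [\<epsilon> = 0] (mod f2))"

lemma \<epsilon>: "[\<epsilon> = 1] (mod s ^ k)" "f2 dvd \<epsilon>"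
  using someI_ex[OF \<epsilon>_ex] by (simp_all add: \<epsilon>_def cong_0_iff)

definition ge where "ge x = \<kappa> (e12 (\<iota> (\<epsilon> * x)))"
definition ge' where "ge' x = \<kappa> (e21 (\<iota> (\<epsilon> * x)))"

lemma e_Lv: "f2 dvd x \<Longrightarrow> e12 (\<iota> x) \<in> Lv (\<iota> f2)" "f2 dvd x \<Longrightarrow> e21 (\<iota> x) \<in> Lv (\<iota> f2)"
  using J_iota_I by (simp_all add: e12_Lv e21_Lv)

lemma \<kappa>_e_cong:
  assumes "[x = y] (mod s ^ k)" "f2 dvd x" "f2 dvd y"
  shows "\<kappa> (e12 (\<iota> x)) = \<kappa> (e12 (\<iota> y))" "\<kappa> (e21 (\<iota> x)) = \<kappa> (e21 (\<iota> y))"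
proof -
  have "f dvd x - y" unfolding f_eq using assms by (intro poly_coprime_mult_dvd[OF m_f2]) (simp_all add: cong_iff_dvd_diff)
  then have "\<iota> x - \<iota> y \<in> J (\<iota> f)" using J_iota_I[of f "x - y"] by simp
  from e12_N[OF this] e21_N[OF this]
  show "\<kappa> (e12 (\<iota> x)) = \<kappa> (e12 (\<iota> y))" "\<kappa> (e21 (\<iota> x)) = \<kappa> (e21 (\<iota> y))"
    unfolding \<kappa>_eq_iff diff_conv_add_uminus e12_uminus[symmetric] e21_uminus[symmetric] e12_add[symmetric] e21_add[symmetric]
    by simp_all
qed

text \<open>Only modulo s^k is z a unit. Choosing a representative y prime to s, f2 and
  \<open>\<pi>\<close> brings the relation within reach of \<open>weyl_relation\<close>, which holds
  over B up to \<open>E (\<iota> f)\<close>, a subgroup of N.\<close>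

lemma W_rel':
  assumes z: "[z * z' = 1] (mod s ^ k)"
  shows "(ge z \<otimes>\<^bsub>Q\<^esub> ge' (- z') \<otimes>\<^bsub>Q\<^esub> ge z) \<otimes>\<^bsub>Q\<^esub> ge x = ge' (- (z'^2 * x)) \<otimes>\<^bsub>Q\<^esub> (ge z \<otimes>\<^bsub>Q\<^esub> ge' (- z') \<otimes>\<^bsub>Q\<^esub> ge z)"
proof -
  let ?m = "s ^ k"
  have "Rings.coprime ?m (f2 * \<pi>)" using m_f2 cop_pi by (simp add: poly_coprime_mult_right)
  from poly_crt[OF this] obtain y where y: "[y = z] (mod ?m)" "[y = 1] (mod f2 * \<pi>)" by blast
  have yz: "[y * z' = 1] (mod ?m)" using y(1) z by (meson cong_scalar_right cong_trans)
  have cop_cong: "Rings.coprime x q" if "[x = 1] (mod q)" for x q :: "'a poly"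
    using that cong_sym coprime_1_left coprime_cong_cong_left by metis
  have "Rings.coprime (y * z') ?m" using yz by (rule cop_cong)
  then have ym: "Rings.coprime y ?m" by (simp add: poly_coprime_mult_left)
  have yf: "Rings.coprime y (f2 * \<pi>)" using y(2) by (rule cop_cong)
  then have y\<pi>: "Rings.coprime y \<pi>" "Rings.coprime y f2" by (simp_all add: poly_coprime_mult_right)
  have y0: "y \<noteq> 0" using y\<pi>(1) irr_pi by (auto simp: Factorial_Ring.irreducible_def)
  \<comment> \<open>\<delta> plays the role of \<epsilon>, with the additional divisibility by y^4;
    c1 and c2 are \<delta>/y and \<delta>/y^2, so all entries of the relation are
    polynomials.\<close>
  have "Rings.coprime ?m (f2 * y^4)"
    using m_f2 ym by (simp add: poly_coprime_mult_right poly_coprime_power coprime_commute)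
  from poly_crt[OF this] obtain \<delta> where \<delta>: "[\<delta> = 1] (mod ?m)" "[\<delta> = 0] (mod f2 * y^4)" by blast
  then have \<delta>': "f2 * y^4 dvd \<delta>" by (simp add: cong_0_iff)
  then obtain d where d: "\<delta> = f2 * y^4 * d" by (elim dvdE)
  define c1 where "c1 = f2 * y^3 * d"
  define c2 where "c2 = f2 * y^2 * d"
  have c: "\<delta> = y * c1" "\<delta> = y^2 * c2" by (simp_all add: d c1_def c2_def power2_eq_square power3_eq_cube power4_eq_xxxx)
  have fc: "f2 dvd c1" "f2 dvd c2" "f2 dvd \<delta>" by (simp_all add: c1_def c2_def d)
  have cancel: "[a = b] (mod ?m)" if "[y * a = y * b] (mod ?m)" for a b
  proof -
    have "[(z' * y) * a = (z' * y) * b] (mod ?m)" using cong_scalar_left[OF that, of z'] by (simp add: mult.assoc)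
    moreover have "[(z' * y) * a = 1 * a] (mod ?m)" "[(z' * y) * b = 1 * b] (mod ?m)"
      using yz by (intro cong_scalar_right; simp add: mult.commute)+
    ultimately show ?thesis by (simp add: cong_def)
  qed
  have k1: "\<kappa> (e12 (\<iota> (\<delta> * y))) = ge z"
  proof -
    have "[\<delta> * y = 1 * z] (mod ?m)" by (rule cong_mult[OF \<delta>(1) y(1)])
    moreover have "[\<epsilon> * z = 1 * z] (mod ?m)" by (rule cong_scalar_right[OF \<epsilon>(1)])
    ultimately have "[\<delta> * y = \<epsilon> * z] (mod ?m)" by (metis cong_sym cong_trans)
    then show ?thesis unfolding ge_def using fc \<epsilon> by (intro \<kappa>_e_cong) auto
  qed
  have k2: "\<kappa> (e21 (\<iota> (- c1))) = ge' (- z')"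
  proof -
    have "[y * c1 = y * (\<epsilon> * z')] (mod ?m)"
    proof -
      have "[\<epsilon> * (y * z') = 1 * 1] (mod ?m)" using \<epsilon> yz by (intro cong_mult)
      then show ?thesis using \<delta>(1) unfolding c(1)[symmetric] by (metis cong_sym cong_trans mult.left_commute mult_1)
    qed
    from cancel[OF this] have "[- c1 = \<epsilon> * - z'] (mod ?m)" by (simp add: cong_minus_minus_iff)
    then show ?thesis unfolding ge'_def using fc \<epsilon> by (intro \<kappa>_e_cong) auto
  qed
  have k3: "\<kappa> (e12 (\<iota> (\<delta> * x))) = ge x"
  proof -
    have "[\<delta> = \<epsilon>] (mod ?m)" using \<delta> \<epsilon> by (metis cong_sym cong_trans)
    then show ?thesis unfolding ge_def using fc \<epsilon> by (intro \<kappa>_e_cong cong_scalar_right) auto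
  qed
  have k4: "\<kappa> (e21 (\<iota> (- (c2 * x)))) = ge' (- (z'^2 * x))"
  proof -
    have "[y * (y * c2) = y * (y * (\<epsilon> * z'^2))] (mod ?m)"
    proof -
      have "[\<epsilon> * (y * z')^2 = 1 * 1^2] (mod ?m)" using \<epsilon> yz by (intro cong_mult cong_pow)
      then have "[\<epsilon> * (y * z')^2 = \<delta>] (mod ?m)" using \<delta>(1) by (metis cong_sym cong_trans mult_1 one_power2)
      moreover have "\<epsilon> * (y * z')^2 = y * (y * (\<epsilon> * z'^2))" "\<delta> = y * (y * c2)"
        using c(2) by (simp_all add: power2_eq_square ac_simps)
      ultimately show ?thesis by (simp add: cong_sym)
    qed
    from cancel[OF cancel[OF this]] have "[c2 * x = \<epsilon> * z'^2 * x] (mod ?m)" by (rule cong_scalar_right)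
    then have "[- (c2 * x) = \<epsilon> * - (z'^2 * x)] (mod ?m)" by (simp add: cong_minus_minus_iff mult.assoc)
    then show ?thesis unfolding ge'_def using fc \<epsilon> by (intro \<kappa>_e_cong) auto
  qed
  have mf: "Rings.coprime (?m * f2) \<pi>" using f_pi by (simp add: f_eq)
  have yn: "\<iota> y \<noteq> 0" using y0 by simp
  define w where "w = e12 (\<iota> (\<delta> * y)) + e21 (\<iota> (- c1)) + e12 (\<iota> (\<delta> * y))"
  have r1: "- \<iota> \<delta> / \<iota> y = \<iota> (- c1)" using yn by (simp add: c(1))
  have r2: "- (\<iota> \<delta> * \<iota> x) / (\<iota> y)^2 = \<iota> (- (c2 * x))" using yn by (simp add: c(2) power2_eq_square)
  obtain h where h: "h \<in> E (\<iota> f)" "e21 (\<iota> (- (c2 * x))) = w + e12 (\<iota> (\<delta> * x)) - w + h"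
    using weyl_relation[OF m_f2 mf ym y\<pi>(1) y0 \<delta>(1) \<delta>', of x] unfolding r1 r2 w_def f_eq by auto
  define h' where "h' = - w + h + w"
  have L: "e12 (\<iota> (\<delta> * y)) \<in> Lv (\<iota> f2)" "e21 (\<iota> (- c1)) \<in> Lv (\<iota> f2)" "e12 (\<iota> (\<delta> * x)) \<in> Lv (\<iota> f2)"
    "e21 (\<iota> (- (c2 * x))) \<in> Lv (\<iota> f2)"
    using fc by (auto intro!: e_Lv simp del: to_fract_mult to_fract_uminus)
  then have wL: "w \<in> Lv (\<iota> f2)" unfolding w_def by (intro Lv_add B_iota)
  then have w1: "w \<in> Lv 1" using Lv_subset_1[OF B_iota] by blast
  have h': "h' \<in> N" unfolding h'_def using E_conj'[OF w1 h(1)] by (rule E_N)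
  have "e21 (\<iota> (- (c2 * x))) + w = w + e12 (\<iota> (\<delta> * x)) + h'"
    unfolding h(2) h'_def by (simp add: add.assoc diff_conv_add_uminus del: add_uminus_conv_diff)
  moreover have "w + e12 (\<iota> (\<delta> * x)) \<in> Lv 1" using Lv_add[OF B_iota wL L(3)] Lv_subset_1[OF B_iota] by blast
  from N_conj[OF h' this] have "\<kappa> (w + e12 (\<iota> (\<delta> * x)) + h') = \<kappa> (w + e12 (\<iota> (\<delta> * x)))"
    by (simp only: \<kappa>_eq_iff)
  ultimately have "\<kappa> (e21 (\<iota> (- (c2 * x))) + w) = \<kappa> (w + e12 (\<iota> (\<delta> * x)))" by simp
  moreover have "\<kappa> w = ge z \<otimes>\<^bsub>Q\<^esub> ge' (- z') \<otimes>\<^bsub>Q\<^esub> ge z"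
    unfolding w_def using L by (simp only: \<kappa>_hom Lv_add B_iota k1 k2)
  ultimately show ?thesis using L wL by (simp only: \<kappa>_hom k3 k4)
qed

lemma rel_kernel_rep: assumes "rel C 1 0 0 1" shows "\<exists>g \<in> Lv (\<iota> f). C = \<kappa> g"
proof -
  obtain g where g: "g \<in> Lv (\<iota> f2)" "C = \<kappa> g" "ent11 g - \<iota> 1 \<in> J (\<iota> (s ^ k))" "ent12 g - \<iota> 0 \<in> J (\<iota> (s ^ k))"
     "ent21 g - \<iota> 0 \<in> J (\<iota> (s ^ k))" "ent22 g - \<iota> 1 \<in> J (\<iota> (s ^ k))" using assms(1) unfolding rel_def by blast
  then have "g \<in> Lv (\<iota> (s ^ k))" by (simp add: Lv_def)
  then show ?thesis using g Lv_f_Int by blast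
qed

lemma \<Phi>_conj_nsum: "g \<in> Lv 1 \<Longrightarrow> c \<in> Lv (\<iota> f) \<Longrightarrow> g + nsum n c - g = nsum n (g + c - g)"
  by (induction n) (simp_all add: conj_add)

text \<open>Membership in N is a family of equations in M, one for each conjugating element; each
  can be divided by n there. This transports the torsion hypotheses from M to the noncommutative
  quotient.\<close>

lemma torsion':
  assumes g: "g \<in> Lv (\<iota> f)" and n: "nsum n g \<in> N"
    and tf: "\<And>x. x \<in> carrier M \<Longrightarrow> x [^]\<^bsub>M\<^esub> n = \<one>\<^bsub>M\<^esub> \<Longrightarrow> x = \<one>\<^bsub>M\<^esub>"
  shows "g \<in> N"
proof -
  have "\<Phi> (c + g - c) = \<one>\<^bsub>M\<^esub>" if c: "c \<in> Lv 1" for c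
  proof (rule tf)
    have L: "c + g - c \<in> Lv (\<iota> f)" using c g by (rule Lv_conj)
    then show "\<Phi> (c + g - c) \<in> carrier M" by simp
    have "\<Phi> (nsum n (c + g - c)) = \<one>\<^bsub>M\<^esub>" using n c g by (simp add: N_def flip: \<Phi>_conj_nsum)
    then show "\<Phi> (c + g - c) [^]\<^bsub>M\<^esub> n = \<one>\<^bsub>M\<^esub>" using \<Phi>_nsum[OF L] by simp
  qed
  with g show ?thesis by (simp add: N_def)
qed

lemma \<kappa>_nsum: "g \<in> Lv (\<iota> f) \<Longrightarrow> \<kappa> (nsum n g) = \<kappa> g [^]\<^bsub>Q\<^esub> n"
proof (induction n)
  case 0
  then show ?case using group.is_monoid[OF group_Q] by (simp add: \<kappa>_one monoid.nat_pow_0)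
next
  case (Suc n)
  then have "g \<in> Lv (\<iota> f2)" "nsum n g \<in> Lv (\<iota> f2)" using nsum_Lv Lv_f_sub by blast+
  then show ?case using Suc monoid.nat_pow_Suc2[OF group.is_monoid[OF group_Q], of "\<kappa> g" n]
    by (simp add: \<kappa>_hom del: Group.nat_pow_Suc)
qed

lemma local_symbols_Q: "local_symbols Q s k ge ge' rel (s ^ k)"
proof -
  interpret Q: group Q by (rule group_Q)
  show ?thesis
  proof
    show "Factorial_Ring.irreducible s" "0 < k" "3 < CARD('a)" "s ^ k = s ^ k" using s k card by simp_all
    show "ge x \<in> carrier Q" "ge' x \<in> carrier Q" for x
      using \<epsilon> by (auto simp: ge_def ge'_def e_Lv simp del: to_fract_mult)
    show "ge (x + y) = ge x \<otimes>\<^bsub>Q\<^esub> ge y" "ge' (x + y) = ge' x \<otimes>\<^bsub>Q\<^esub> ge' y" for x y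
      unfolding ge_def ge'_def distrib_left to_fract_add e12_add e21_add
      using \<epsilon> by (auto simp: \<kappa>_hom e_Lv simp del: to_fract_mult)
    show "ge x = \<one>\<^bsub>Q\<^esub>" "ge' x = \<one>\<^bsub>Q\<^esub>" if x: "s ^ k dvd x" for x
    proof -
      have "[\<epsilon> * x = 0] (mod s ^ k)" using x by (simp add: cong_0_iff)
      from \<kappa>_e_cong[OF this] \<epsilon>(2) show "ge x = \<one>\<^bsub>Q\<^esub>" "ge' x = \<one>\<^bsub>Q\<^esub>"
        unfolding ge_def ge'_def by (simp_all add: \<kappa>_one)
    qed
    show "rel (ge x) 1 x 0 1" "rel (ge' x) 1 0 x 1" for x
    proof -
      have "[\<epsilon> * x = 1 * x] (mod s ^ k)" using \<epsilon>(1) by (rule cong_scalar_right)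
      then have "\<iota> (\<epsilon> * x) - \<iota> x \<in> J (\<iota> (s ^ k))" using J_iota_cong[OF cop_pi(1), of "\<epsilon> * x" x] by (simp only: mult_1)
      then show "rel (ge x) 1 x 0 1" "rel (ge' x) 1 0 x 1"
        unfolding rel_def ge_def ge'_def using \<epsilon>(2) e_Lv[of "\<epsilon> * x"]
        by (auto intro!: bexI simp del: to_fract_mult)
    qed
    show "rel \<one>\<^bsub>Q\<^esub> 1 0 0 1" unfolding rel_def by (intro bexI[of _ 0]) (simp_all add: \<kappa>_one ent_zero)
    fix C assume C: "C \<in> carrier Q" "rel C 1 0 0 1"
    obtain g where g: "g \<in> Lv (\<iota> f)" "C = \<kappa> g" using rel_kernel_rep[OF C(2)] by blast
    have tor: "C = \<one>\<^bsub>Q\<^esub>" if "C [^]\<^bsub>Q\<^esub> n = \<one>\<^bsub>Q\<^esub>" "\<And>x. x \<in> carrier M \<Longrightarrow> x [^]\<^bsub>M\<^esub> n = \<one>\<^bsub>M\<^esub> \<Longrightarrow> x = \<one>\<^bsub>M\<^esub>" for n :: nat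
      using that torsion'[OF g(1), of n] g \<kappa>_nsum[OF g(1), of n] by (simp add: \<kappa>_eq_one)
    show "C = \<one>\<^bsub>Q\<^esub>" if "C \<otimes>\<^bsub>Q\<^esub> C = \<one>\<^bsub>Q\<^esub>"
    proof (rule tor[of 2])
      show "C [^]\<^bsub>Q\<^esub> (2::nat) = \<one>\<^bsub>Q\<^esub>" using that C(1) by (simp add: numeral_2_eq_2)
      show "x = \<one>\<^bsub>M\<^esub>" if "x \<in> carrier M" "x [^]\<^bsub>M\<^esub> (2::nat) = \<one>\<^bsub>M\<^esub>" for x
        using M_2[OF that(1)] that by (simp add: numeral_2_eq_2)
    qed
    show "C = \<one>\<^bsub>Q\<^esub>" if "C [^]\<^bsub>Q\<^esub> CHAR('a) = \<one>\<^bsub>Q\<^esub>"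
      by (rule tor[OF that M_p])
  qed (assumption | rule W_rel' rel_mult' rel_inv' rel_unique' | erule rel_cong')+
qed

text \<open>Modulo N the entries of the letters can be moved into A, so c becomes a word in
  \<open>ge\<close> and \<open>ge'\<close>. It reduces to the identity modulo s^k, and
  \<open>kernel_trivial\<close> puts c into N.\<close>

lemma \<Phi>_local:
  assumes c: "c \<in> Fg (\<iota> f2)" "c \<in> Lv (\<iota> f)" shows "\<Phi> c = \<one>\<^bsub>M\<^esub>"
proof -
  interpret L: local_symbols Q s k ge ge' rel "s ^ k" by (rule local_symbols_Q)
  have gen: "\<kappa> (e12 x) \<in> range ge" "\<kappa> (e21 x) \<in> range ge'" if x: "x \<in> J (\<iota> f2)" for x
  proof -
    obtain a where a: "x - \<iota> a \<in> J (\<iota> f)" using B_approx[OF f_pi J_iota_B[OF x]] by blast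
    have "J (\<iota> f) \<subseteq> J (\<iota> f2)" by (rule J_dvd) (simp add: f_eq)
    from J_diff[OF x subsetD[OF this a]] have "\<iota> a \<in> J (\<iota> f2)" by simp
    then have fa: "f2 dvd a" by (simp only: J_iota_iff[OF cop_pi(2)])
    have "e12 x - e12 (\<iota> a) \<in> N" "e21 x - e21 (\<iota> a) \<in> N"
      using e12_N[OF a] e21_N[OF a]
      unfolding diff_conv_add_uminus e12_uminus[symmetric] e21_uminus[symmetric] e12_add[symmetric] e21_add[symmetric]
      by simp_all
    then have "\<kappa> (e12 x) = \<kappa> (e12 (\<iota> a))" "\<kappa> (e21 x) = \<kappa> (e21 (\<iota> a))" by (simp_all add: \<kappa>_eq_iff)
    moreover have "[a = \<epsilon> * a] (mod s ^ k)" using cong_scalar_right[OF \<epsilon>(1), of a] by (simp add: cong_sym)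
    from \<kappa>_e_cong[OF this fa] fa have "\<kappa> (e12 (\<iota> a)) = ge a" "\<kappa> (e21 (\<iota> a)) = ge' a"
      by (simp_all add: ge_def ge'_def del: to_fract_mult)
    ultimately show "\<kappa> (e12 x) \<in> range ge" "\<kappa> (e21 x) \<in> range ge'" by simp_all
  qed
  have "\<kappa> c \<in> L.Y" using c(1)
  proof (induction rule: Fg.induct)
    case Fg_0
    then show ?case by (simp add: \<kappa>_one generate.one)
  next
    case (Fg_12 x h)
    then have "h \<in> Lv (\<iota> f2)" using Fg_Lv by simp
    moreover have "\<kappa> (e12 x) \<in> L.Y" using gen[OF Fg_12(1)] by (auto intro: generate.incl)
    ultimately show ?case using Fg_12 by (simp add: \<kappa>_hom e12_Lv generate.eng)
  next
    case (Fg_21 x h)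
    then have "h \<in> Lv (\<iota> f2)" using Fg_Lv by simp
    moreover have "\<kappa> (e21 x) \<in> L.Y" using gen[OF Fg_21(1)] by (auto intro: generate.incl)
    ultimately show ?case using Fg_21 by (simp add: \<kappa>_hom e21_Lv generate.eng)
  qed
  moreover have "rel (\<kappa> c) 1 0 0 1"
    using c(2) Lv_f_sub unfolding rel_def by (intro bexI[of _ c]) (auto simp: Lv_def)
  ultimately have "\<kappa> c = \<one>\<^bsub>Q\<^esub>" by (rule L.kernel_trivial)
  then show ?thesis by (simp add: \<kappa>_eq_one N_kernel)
qed

end

end

section \<open>Generation by integral matrices and their conjugates\<close>

context s_arith
begin

definition Ga :: "'a poly \<Rightarrow> 'a poly fract sl2 set" where
  "Ga n = {g. \<exists>a b c d. ent11 g = \<iota> a \<and> ent12 g = \<iota> b \<and> ent21 g = \<iota> c \<and> ent22 g = \<iota> d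
     \<and> n dvd a - 1 \<and> n dvd b \<and> n dvd c \<and> n dvd d - 1}"

lemma Ga_I: "ent11 g = \<iota> a \<Longrightarrow> ent12 g = \<iota> b \<Longrightarrow> ent21 g = \<iota> c \<Longrightarrow> ent22 g = \<iota> d \<Longrightarrow>
   n dvd a - 1 \<Longrightarrow> n dvd b \<Longrightarrow> n dvd c \<Longrightarrow> n dvd d - 1 \<Longrightarrow> g \<in> Ga n"
  unfolding Ga_def by blast

lemma Ga_E:
  assumes "g \<in> Ga n"
  obtains a b c d where "ent11 g = \<iota> a" "ent12 g = \<iota> b" "ent21 g = \<iota> c" "ent22 g = \<iota> d"
    "n dvd a - 1" "n dvd b" "n dvd c" "n dvd d - 1" "a * d - b * c = 1"
proof -
  obtain a b c d where *: "ent11 g = \<iota> a" "ent12 g = \<iota> b" "ent21 g = \<iota> c" "ent22 g = \<iota> d"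
    "n dvd a - 1" "n dvd b" "n dvd c" "n dvd d - 1" using assms unfolding Ga_def by blast
  have "\<iota> (a * d - b * c) = \<iota> 1" using det_ent[of g] by (simp add: *)
  then have "a * d - b * c = 1" by (simp only: to_fract_eq_iff)
  with * show ?thesis by (rule that)
qed

lemma Ga_0: "0 \<in> Ga n"
  by (rule Ga_I[of _ 1 0 0 1]) (simp_all add: ent_zero)

lemma Ga_add:
  assumes "g \<in> Ga n" "h \<in> Ga n" shows "g + h \<in> Ga n"
proof -
  from assms(1) obtain a b c d where g: "ent11 g = \<iota> a" "ent12 g = \<iota> b" "ent21 g = \<iota> c" "ent22 g = \<iota> d"
    "n dvd a - 1" "n dvd b" "n dvd c" "n dvd d - 1" by (rule Ga_E)
  from assms(2) obtain a' b' c' d' where h: "ent11 h = \<iota> a'" "ent12 h = \<iota> b'" "ent21 h = \<iota> c'" "ent22 h = \<iota> d'"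
    "n dvd a' - 1" "n dvd b'" "n dvd c'" "n dvd d' - 1" by (rule Ga_E)
  show ?thesis
  proof (rule Ga_I)
    show "ent11 (g + h) = \<iota> (a * a' + b * c')" "ent12 (g + h) = \<iota> (a * b' + b * d')"
      "ent21 (g + h) = \<iota> (c * a' + d * c')" "ent22 (g + h) = \<iota> (c * b' + d * d')"
      by (simp_all add: ent_plus g h)
    have "a * a' + b * c' - 1 = (a - 1) * a' + (a' - 1) + b * c'"
      "c * b' + d * d' - 1 = c * b' + (d - 1) * d' + (d' - 1)" by (simp_all add: algebra_simps)
    then show "n dvd a * a' + b * c' - 1" "n dvd c * b' + d * d' - 1"
      using g h by (metis dvd_add dvd_mult2)+
    show "n dvd a * b' + b * d'" "n dvd c * a' + d * c'" using g h by (intro dvd_add; simp)+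
  qed
qed

lemma Ga_uminus: "g \<in> Ga n \<Longrightarrow> - g \<in> Ga n"
proof -
  assume "g \<in> Ga n"
  then obtain a b c d where g: "ent11 g = \<iota> a" "ent12 g = \<iota> b" "ent21 g = \<iota> c" "ent22 g = \<iota> d"
    "n dvd a - 1" "n dvd b" "n dvd c" "n dvd d - 1" by (rule Ga_E)
  show "- g \<in> Ga n" by (rule Ga_I[of _ d "- b" "- c" a]) (use g in \<open>simp_all add: ent_uminus\<close>)
qed

lemma Ga_Lv: "g \<in> Ga n \<Longrightarrow> g \<in> Lv (\<iota> n)"
proof -
  assume "g \<in> Ga n"
  then obtain a b c d where g: "ent11 g = \<iota> a" "ent12 g = \<iota> b" "ent21 g = \<iota> c" "ent22 g = \<iota> d"
    "n dvd a - 1" "n dvd b" "n dvd c" "n dvd d - 1" by (rule Ga_E)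
  then show ?thesis unfolding Lv_def using J_iota_I[of n "a - 1"] J_iota_I[of n "d - 1"] J_iota_I[of n b] J_iota_I[of n c]
    by simp
qed

text \<open>Conjugation by the inverse of \<open>diag(\<pi>, 1)\<close>.\<close>

definition tc :: "'a poly fract sl2 \<Rightarrow> 'a poly fract sl2" where
  "tc g = sl2 (ent11 g) (ent12 g / \<iota> \<pi>) (\<iota> \<pi> * ent21 g) (ent22 g)"

lemma ent_tc: "ent11 (tc g) = ent11 g" "ent12 (tc g) = ent12 g / \<iota> \<pi>" "ent21 (tc g) = \<iota> \<pi> * ent21 g"
  "ent22 (tc g) = ent22 g"
proof -
  have "ent11 g * ent22 g - ent12 g / \<iota> \<pi> * (\<iota> \<pi> * ent21 g) = 1" using det_ent[of g] by simp
  from ent_sl2[OF this] show "ent11 (tc g) = ent11 g" "ent12 (tc g) = ent12 g / \<iota> \<pi>"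
    "ent21 (tc g) = \<iota> \<pi> * ent21 g" "ent22 (tc g) = ent22 g" by (simp_all add: tc_def)
qed

lemma tc_0: "tc 0 = 0"
  by (rule sl2_eqI) (simp_all add: ent_tc ent_zero)

lemma tc_add: "tc (g + h) = tc g + tc h"
  by (rule sl2_eqI) (simp_all add: ent_tc ent_plus field_simps)

lemma tc_uminus: "tc (- g) = - tc g"
  by (rule sl2_eqI) (simp_all add: ent_tc ent_uminus)

lemma tc_e: "tc (e12 x) = e12 (x / \<iota> \<pi>)" "tc (e21 x) = e21 (\<iota> \<pi> * x)"
  by (rule sl2_eqI; simp add: ent_tc)+

lemma J_pi: "x \<in> J f \<Longrightarrow> x / \<iota> \<pi> \<in> J f" "x \<in> J f \<Longrightarrow> \<iota> \<pi> * x \<in> J f"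
  using J_B_mult[OF B_inverse_pi] J_mult_B[OF B_iota] by (simp_all add: divide_inverse)

lemma tc_Lv: "g \<in> Lv f \<Longrightarrow> tc g \<in> Lv f"
  by (simp add: Lv_def ent_tc J_pi)

lemma tc_Fg: "g \<in> Fg f \<Longrightarrow> tc g \<in> Fg f"
  by (induction rule: Fg.induct) (simp_all add: tc_0 tc_add tc_e J_pi Fg.Fg_12 Fg.Fg_21)

section \<open>Removing powers of \<open>\<pi>\<close> from the denominators\<close>

inductive_set Gen :: "'a poly \<Rightarrow> 'a poly fract sl2 set" for n where
  Gen_0: "0 \<in> Gen n"
| Gen_1: "g \<in> Ga n \<Longrightarrow> h \<in> Gen n \<Longrightarrow> g + h \<in> Gen n"
| Gen_2: "g \<in> Ga n \<Longrightarrow> h \<in> Gen n \<Longrightarrow> tc g + h \<in> Gen n"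

lemma Gen_add: "g \<in> Gen n \<Longrightarrow> h \<in> Gen n \<Longrightarrow> g + h \<in> Gen n"
  by (induction rule: Gen.induct) (simp_all add: add.assoc Gen_1 Gen_2)

lemma Gen_Ga: "g \<in> Ga n \<Longrightarrow> g \<in> Gen n" "g \<in> Ga n \<Longrightarrow> tc g \<in> Gen n"
  using Gen_1[OF _ Gen_0, of g n] Gen_2[OF _ Gen_0, of g n] by simp_all

text \<open>The matrix is singular modulo \<open>\<pi>\<close>; a kernel vector is (b, -a) or (d,
  -c), or anything if all entries vanish. As n and \<open>\<pi>\<close> are coprime, its direction
  is that of the first column of some matrix congruent to 1 modulo n.\<close>

lemma column_direction:
  assumes n: "Rings.coprime n \<pi>" and det: "\<pi> dvd a * d - b * c"
  shows "\<exists>g \<in> Ga n. \<exists>p r. ent11 g = \<iota> p \<and> ent21 g = \<iota> r \<and> \<pi> dvd a * p + b * r \<and> \<pi> dvd c * p + d * r"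
proof -
  have prime: "prime_elem \<pi>" using irr_pi by (rule field_poly_irreducible_imp_prime)
  have "\<exists>u v. \<not> (\<pi> dvd u \<and> \<pi> dvd v) \<and> \<pi> dvd a * u + b * v \<and> \<pi> dvd c * u + d * v"
  proof -
    have e: "a * b + b * - a = 0" "c * b + d * - a = - (a * d - b * c)" "a * d + b * - c = a * d - b * c"
      "c * d + d * - c = 0" by (simp_all add: algebra_simps)
    consider "\<not> (\<pi> dvd b \<and> \<pi> dvd - a)" | "\<not> (\<pi> dvd d \<and> \<pi> dvd - c)"
      | "\<pi> dvd a" "\<pi> dvd b" "\<pi> dvd c" "\<pi> dvd d" by auto
    then show ?thesis
    proof cases
      case 1
      moreover have "\<pi> dvd a * b + b * - a" "\<pi> dvd c * b + d * - a" unfolding e using det by (simp_all only: dvd_0_right dvd_minus_iff)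
      ultimately show ?thesis by blast
    next
      case 2
      moreover have "\<pi> dvd a * d + b * - c" "\<pi> dvd c * d + d * - c" unfolding e using det by simp_all
      ultimately show ?thesis by blast
    next
      case 3
      moreover have "\<not> \<pi> dvd 1" using prime by (simp add: prime_elem_not_unit)
      ultimately show ?thesis by (intro exI[of _ 1] exI[of _ 0]) simp
    qed
  qed
  then obtain u v where uv: "\<not> (\<pi> dvd u \<and> \<pi> dvd v)" "\<pi> dvd a * u + b * v" "\<pi> dvd c * u + d * v" by blast
  have crt: "\<exists>z. n dvd z \<and> [z = w] (mod \<pi>)" for w
    using poly_crt[OF n, of 0 w] by (auto simp: cong_0_iff)
  have fin: "\<pi> dvd x * p + y * r"
    if "[l * p = u] (mod \<pi>)" "[l * r = v] (mod \<pi>)" "\<not> \<pi> dvd l" "\<pi> dvd x * u + y * v" for x y l p r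
  proof -
    have "[x * (l * p) + y * (l * r) = x * u + y * v] (mod \<pi>)" using that by (intro cong_add cong_mult cong_refl)
    then have "\<pi> dvd x * (l * p) + y * (l * r)" using that(4) by (simp add: cong_dvd_iff)
    then have "\<pi> dvd l * (x * p + y * r)" by (simp add: algebra_simps)
    then show ?thesis using that(3) prime by (simp add: prime_elem_dvd_mult_iff)
  qed
  have inv: "\<exists>w. [u * w = 1] (mod \<pi>)" if "\<not> \<pi> dvd u" for u
    using poly_cong_inverse[of u \<pi>] poly_coprime_iff_prime[OF irr_pi, of u] that by (simp add: coprime_commute)
  show ?thesis
  proof (cases "\<pi> dvd u")
    case False
    obtain w where w: "[u * w = 1] (mod \<pi>)" using inv[OF False] ..
    obtain z where z: "n dvd z" "[z = w * v] (mod \<pi>)" using crt by blast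
    have "[u * z = u * (w * v)] (mod \<pi>)" using z(2) by (rule cong_scalar_left)
    moreover have "[u * w * v = 1 * v] (mod \<pi>)" using w by (rule cong_scalar_right)
    ultimately have uz: "[u * z = v] (mod \<pi>)" by (simp add: mult.assoc) (metis cong_trans)
    have "e21 (\<iota> z) \<in> Ga n" by (rule Ga_I[of _ 1 0 z 1]) (simp_all add: z)
    then show ?thesis using fin[of u 1 z] uz uv False
      by (intro bexI[of _ "e21 (\<iota> z)"] exI[of _ 1] exI[of _ z]) auto
  next
    case True
    then have v: "\<not> \<pi> dvd v" using uv by blast
    \<comment> \<open>With x y = -1 modulo \<open>\<pi>\<close>, the first column (1 + x y, y) of
      the product points in the direction (0, 1).\<close>
    obtain x where x: "n dvd x" "[x = - 1] (mod \<pi>)" using crt by blast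
    obtain y where y: "n dvd y" "[y = 1] (mod \<pi>)" using crt by blast
    have xy: "[x * y = - 1 * 1] (mod \<pi>)" using x y by (intro cong_mult)
    have "[1 + x * y = 1 + - 1 * 1] (mod \<pi>)" using xy by (rule cong_add[OF cong_refl])
    then have "\<pi> dvd 1 + x * y" by (simp add: cong_0_iff)
    then have 1: "[v * (1 + x * y) = u] (mod \<pi>)" using True unfolding cong_iff_dvd_diff by (intro dvd_diff dvd_mult)
    have 2: "[v * y = v] (mod \<pi>)" using cong_scalar_left[OF y(2), of v] by simp
    have "e12 (\<iota> x) + e21 (\<iota> y) \<in> Ga n"
      by (rule Ga_I[of _ "1 + x * y" x y 1]) (simp_all add: ent_plus x y)
    then show ?thesis using fin[OF 1 2 v] uv
      by (intro bexI[of _ "e12 (\<iota> x) + e21 (\<iota> y)"] exI[of _ "1 + x * y"] exI[of _ y]) (auto simp: ent_plus)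
  qed
qed

text \<open>The previous lemma with the columns exchanged; exchanging both coordinates of the matrix
  found there keeps it in \<open>Ga n\<close>.\<close>

lemma column_direction_2:
  assumes n: "Rings.coprime n \<pi>" and det: "\<pi> dvd a * d - b * c"
  shows "\<exists>g \<in> Ga n. \<exists>q t. ent12 g = \<iota> q \<and> ent22 g = \<iota> t \<and> \<pi> dvd a * q + b * t \<and> \<pi> dvd c * q + d * t"
proof -
  have "\<pi> dvd b * c - a * d" using det by (metis dvd_minus_iff minus_diff_eq)
  from column_direction[OF n this] obtain g p r where g: "g \<in> Ga n" "ent11 g = \<iota> p" "ent21 g = \<iota> r"
    "\<pi> dvd b * p + a * r" "\<pi> dvd d * p + c * r" by blast
  from g(1) obtain a' b' c' d' where g': "ent11 g = \<iota> a'" "ent12 g = \<iota> b'" "ent21 g = \<iota> c'" "ent22 g = \<iota> d'"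
    "n dvd a' - 1" "n dvd b'" "n dvd c'" "n dvd d' - 1" "a' * d' - b' * c' = 1" by (rule Ga_E)
  have eq: "a' = p" "c' = r" using g g' by simp_all
  have "\<iota> d' * \<iota> p - \<iota> r * \<iota> b' = \<iota> (a' * d' - b' * c')" by (simp add: eq mult.commute)
  then have det': "\<iota> d' * \<iota> p - \<iota> r * \<iota> b' = 1" by (simp only: g' to_fract_1)
  note e = ent_sl2[OF det']
  have "sl2 (\<iota> d') (\<iota> r) (\<iota> b') (\<iota> p) \<in> Ga n"
    by (rule Ga_I[of _ d' r b' p]) (use e g' eq in simp_all)
  then show ?thesis using g e
    by (intro bexI[of _ "sl2 (\<iota> d') (\<iota> r) (\<iota> b') (\<iota> p)"] exI[of _ r] exI[of _ p]) (simp_all add: add.commute)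
qed

lemma Lv_integral_Ga:
  assumes "Rings.coprime n \<pi>" "g \<in> Lv (\<iota> n)" "ent11 g = \<iota> a" "ent12 g = \<iota> b" "ent21 g = \<iota> c" "ent22 g = \<iota> d"
  shows "g \<in> Ga n"
proof (rule Ga_I)
  have "\<iota> (a - 1) \<in> J (\<iota> n)" "\<iota> b \<in> J (\<iota> n)" "\<iota> c \<in> J (\<iota> n)" "\<iota> (d - 1) \<in> J (\<iota> n)"
    using assms by (simp_all add: Lv_def)
  then show "n dvd a - 1" "n dvd b" "n dvd c" "n dvd d - 1" by (simp_all only: J_iota_iff[OF assms(1)])
qed (fact assms)+

text \<open>Induction on the exponent of the denominator. A right factor u from \<open>Ga n\<close>
  makes the first column of the numerator divisible by \<open>\<pi>\<close>; a right factor
  \<open>tc x\<close> then does so for the second column without spoiling the first, and one power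
  of \<open>\<pi>\<close> cancels.\<close>

lemma Lv_Gen:
  assumes n: "Rings.coprime n \<pi>"
  shows "g \<in> Lv (\<iota> n) \<Longrightarrow> ent11 g * \<iota> \<pi> ^ k = \<iota> a \<Longrightarrow> ent12 g * \<iota> \<pi> ^ k = \<iota> b \<Longrightarrow>
    ent21 g * \<iota> \<pi> ^ k = \<iota> c \<Longrightarrow> ent22 g * \<iota> \<pi> ^ k = \<iota> d \<Longrightarrow> g \<in> Gen n"
proof (induction k arbitrary: g a b c d)
  case 0
  then show ?case using Lv_integral_Ga[OF n] Gen_Ga by simp
next
  case (Suc k)
  have "\<iota> (a * d - b * c) = (ent11 g * ent22 g - ent12 g * ent21 g) * (\<iota> \<pi> ^ Suc k * \<iota> \<pi> ^ Suc k)"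
    unfolding to_fract_diff to_fract_mult Suc.prems(2-5)[symmetric] by (simp add: algebra_simps)
  then have "\<iota> (a * d - b * c) = \<iota> (\<pi> ^ Suc k * \<pi> ^ Suc k)" by (simp only: det_ent mult_1 to_fract_mult to_fract_power)
  then have det: "a * d - b * c = \<pi> * (\<pi> * (\<pi> ^ k * \<pi> ^ k))" by (simp only: to_fract_eq_iff power_Suc mult_ac)
  obtain u p r where u: "u \<in> Ga n" "ent11 u = \<iota> p" "ent21 u = \<iota> r" "\<pi> dvd a * p + b * r" "\<pi> dvd c * p + d * r"
    using column_direction[OF n, of a d b c] det by auto
  from u(1) obtain p' q r' t where u': "ent11 u = \<iota> p'" "ent12 u = \<iota> q" "ent21 u = \<iota> r'" "ent22 u = \<iota> t"
    "p' * t - q * r' = 1" by (rule Ga_E)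
  have eq: "p' = p" "r' = r" using u u' by simp_all
  obtain a1 c1 where ac1: "a * p + b * r = \<pi> * a1" "c * p + d * r = \<pi> * c1" using u(4,5) by (elim dvdE)
  define b1 where "b1 = a * q + b * t"
  define d1 where "d1 = c * q + d * t"
  have "\<pi> * (a1 * d1 - b1 * c1) = (a * p + b * r) * d1 - b1 * (c * p + d * r)"
    unfolding ac1 by (simp add: algebra_simps)
  also have "\<dots> = (a * d - b * c) * (p' * t - q * r')" unfolding eq b1_def d1_def by (simp add: algebra_simps)
  also have "\<dots> = \<pi> * (\<pi> * (\<pi> ^ k * \<pi> ^ k))" by (simp add: u' det)
  finally have "a1 * d1 - b1 * c1 = \<pi> * (\<pi> ^ k * \<pi> ^ k)" by simp
  \<comment> \<open>Of the 2k + 2 factors \<open>\<pi>\<close> of the determinant the division has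
    spent only one, so the new matrix is singular modulo \<open>\<pi>\<close> even for k =
    0.\<close>
  then have "\<pi> dvd a1 * d1 - b1 * c1" by simp
  from column_direction_2[OF n this] obtain x q2 t2 where
    x: "x \<in> Ga n" "ent12 x = \<iota> q2" "ent22 x = \<iota> t2" "\<pi> dvd a1 * q2 + b1 * t2" "\<pi> dvd c1 * q2 + d1 * t2" by blast
  from x(1) obtain p2 q2' r2 t2' where x': "ent11 x = \<iota> p2" "ent12 x = \<iota> q2'" "ent21 x = \<iota> r2" "ent22 x = \<iota> t2'" by (rule Ga_E)
  obtain b2 d2 where bd2: "a1 * q2 + b1 * t2 = \<pi> * b2" "c1 * q2 + d1 * t2 = \<pi> * d2" using x(4,5) by (elim dvdE)
  define y where "y = g + u + tc x"
  have "y \<in> Lv (\<iota> n)" unfolding y_def using Suc.prems(1) u(1) x(1) by (simp add: Ga_Lv tc_Lv)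
  moreover have "ent11 y * \<iota> \<pi> ^ k = \<iota> (a1 * p2 + b1 * r2) \<and> ent12 y * \<iota> \<pi> ^ k = \<iota> b2 \<and>
      ent21 y * \<iota> \<pi> ^ k = \<iota> (c1 * p2 + d1 * r2) \<and> ent22 y * \<iota> \<pi> ^ k = \<iota> d2"
  proof -
    define K where "K = \<iota> \<pi> ^ k"
    have pn: "\<iota> \<pi> \<noteq> 0" by simp
    have S: "ent11 g * K * \<iota> \<pi> = \<iota> a" "ent12 g * K * \<iota> \<pi> = \<iota> b" "ent21 g * K * \<iota> \<pi> = \<iota> c" "ent22 g * K * \<iota> \<pi> = \<iota> d"
      using Suc.prems(2-5) by (simp_all add: K_def ac_simps)
    have gu: "ent11 (g + u) * K * \<iota> \<pi> = \<iota> (\<pi> * a1)" "ent12 (g + u) * K * \<iota> \<pi> = \<iota> b1"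
      "ent21 (g + u) * K * \<iota> \<pi> = \<iota> (\<pi> * c1)" "ent22 (g + u) * K * \<iota> \<pi> = \<iota> d1"
      unfolding ac1[symmetric] b1_def d1_def to_fract_add to_fract_mult S[symmetric] ent_plus u(2,3) u'(2,4)
      by (simp_all add: algebra_simps)
    have gu': "ent11 (g + u) * K = \<iota> a1" "ent21 (g + u) * K = \<iota> c1" using gu(1,3) pn by (simp_all add: mult.commute)
    have 1: "ent11 y * K = \<iota> (a1 * p2 + b1 * r2)" "ent21 y * K = \<iota> (c1 * p2 + d1 * r2)"
      unfolding y_def ent_plus(1,3)[of "g + u"] ent_tc x' to_fract_add to_fract_mult gu'[symmetric] gu(2,4)[symmetric]
      by (simp_all add: algebra_simps)
    have "ent12 y * K * \<iota> \<pi> = \<iota> (\<pi> * b2)" "ent22 y * K * \<iota> \<pi> = \<iota> (\<pi> * d2)"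
      unfolding bd2[symmetric] y_def ent_plus(2,4)[of "g + u"] ent_tc x(2,3) to_fract_add to_fract_mult
        gu'[symmetric] gu(2,4)[symmetric] using pn
      by (simp_all add: field_simps)
    then have "ent12 y * K = \<iota> b2" "ent22 y * K = \<iota> d2" using pn by (simp_all add: mult.commute)
    with 1 show ?thesis by (simp add: K_def)
  qed
  ultimately have y: "y \<in> Gen n" using Suc.IH by blast
  have "g = y + (tc (- x) + - u)"
    by (simp add: y_def tc_uminus add.assoc diff_conv_add_uminus del: add_uminus_conv_diff)
  then show ?case using Gen_add[OF y Gen_add[OF Gen_Ga(2) Gen_Ga(1)]] Ga_uminus u(1) x(1) by metis
qed

lemma common_denominator:
  assumes "x \<in> B" "y \<in> B" "z \<in> B" "w \<in> B"
  shows "\<exists>k a b c d. x * \<iota> \<pi> ^ k = \<iota> a \<and> y * \<iota> \<pi> ^ k = \<iota> b \<and> z * \<iota> \<pi> ^ k = \<iota> c \<and> w * \<iota> \<pi> ^ k = \<iota> d"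
proof -
  obtain a i b j c l d m where *: "x * \<iota> \<pi> ^ i = \<iota> a" "y * \<iota> \<pi> ^ j = \<iota> b" "z * \<iota> \<pi> ^ l = \<iota> c" "w * \<iota> \<pi> ^ m = \<iota> d"
    using assms unfolding B_def by blast
  have "x * \<iota> \<pi> ^ (i + j + l + m) = \<iota> (a * \<pi> ^ (j + l + m))"
    "y * \<iota> \<pi> ^ (i + j + l + m) = \<iota> (b * \<pi> ^ (i + l + m))"
    "z * \<iota> \<pi> ^ (i + j + l + m) = \<iota> (c * \<pi> ^ (i + j + m))"
    "w * \<iota> \<pi> ^ (i + j + l + m) = \<iota> (d * \<pi> ^ (i + j + l))"
    by (simp_all add: power_add to_fract_power *[symmetric])
  then show ?thesis by blast
qed

theorem Lv_subset_Gen: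
  assumes n: "Rings.coprime n \<pi>" shows "Lv (\<iota> n) \<subseteq> Gen n"
proof
  fix g assume g: "g \<in> Lv (\<iota> n)"
  then have "g \<in> Lv 1" using Lv_subset_1[OF B_iota] by blast
  then obtain k a b c d where "ent11 g * \<iota> \<pi> ^ k = \<iota> a" "ent12 g * \<iota> \<pi> ^ k = \<iota> b"
    "ent21 g * \<iota> \<pi> ^ k = \<iota> c" "ent22 g * \<iota> \<pi> ^ k = \<iota> d"
    using common_denominator[of "ent11 g" "ent12 g" "ent21 g" "ent22 g"] unfolding Lv_1 by blast
  with g show "g \<in> Gen n" by (rule Lv_Gen[OF n])
qed

section \<open>SL2(B) is generated by elementary matrices\<close>

lemma dg_Fg:
  assumes u: "u \<in> B" "inverse u \<in> B" "u \<noteq> 0" shows "dg u \<in> Fg 1"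
proof -
  have "dg u = - e21 (- ((1 - u) * 1 * 1 / u)) + (e21 1 + e12 (1 - u) - e21 1) + - e12 ((1 - u) / u)"
    unfolding unit_decomposition[of "1 - u" 1 u, OF _ u(3), simplified] by (simp add: add.assoc)
  also have "\<dots> \<in> Fg 1" unfolding diff_conv_add_uminus
    using u by (intro Fg_add Fg_uminus Fg_e12 Fg_e21) (simp_all add: divide_inverse)
  finally show ?thesis .
qed

text \<open>Euclid's algorithm on the first column. The measure again ranks 0 below the nonzero
  constants; at 0 the matrix is upper triangular, with a diagonal part covered by
  \<open>dg_Fg\<close>.\<close>

lemma Ga_Fg: "g \<in> Ga 1 \<Longrightarrow> ent21 g = \<iota> c \<Longrightarrow> g \<in> Fg 1"
proof (induction "if c = 0 then 0 else Suc (degree c)" arbitrary: g c rule: less_induct)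
  case less
  obtain a b c' d where g: "ent11 g = \<iota> a" "ent12 g = \<iota> b" "ent21 g = \<iota> c'" "ent22 g = \<iota> d" "a * d - b * c' = 1"
    using less.prems(1) by (rule Ga_E)
  have c': "c' = c" using g less.prems by simp
  show ?case
  proof (cases "c = 0")
    case True
    then have ad: "\<iota> a * \<iota> d = 1" using g(5) c' by (simp flip: to_fract_mult)
    then have an: "\<iota> a \<noteq> 0" and d: "inverse (\<iota> a) = \<iota> d" by (auto simp: inverse_unique)
    have "g = dg (\<iota> a) + e12 (\<iota> d * \<iota> b)"
      using an ad by (intro sl2_eqI) (simp_all add: ent_plus g c' True d mult.assoc[symmetric])
    also have "\<dots> \<in> Fg 1" using an d by (intro Fg_add dg_Fg Fg_e12) simp_all
    finally show ?thesis .
  next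
    case False
    define q where "q = a div c"
    \<comment> \<open>The Weyl element with rows (0, 1) and (-1, 0), which exchanges the rows after
      each division.\<close>
    define w where "w = e12 1 + e21 (- 1) + e12 (1 :: 'a poly fract)"
    define h where "h = w + (e12 (\<iota> (- q)) + g)"
    have w: "w \<in> Fg 1" unfolding w_def by (intro Fg_add Fg_e12 Fg_e21) simp_all
    have we: "ent11 w = 0" "ent12 w = 1" "ent21 w = - 1" "ent22 w = 0" by (simp_all add: w_def ent_plus)
    have e: "ent11 h = \<iota> c" "ent12 h = \<iota> d" "ent21 h = \<iota> (- (a mod c))" "ent22 h = \<iota> (- (b - q * d))"
    proof -
      have "a mod c = a - q * c" by (simp add: q_def minus_div_mult_eq_mod)
      then show "ent11 h = \<iota> c" "ent12 h = \<iota> d" "ent21 h = \<iota> (- (a mod c))" "ent22 h = \<iota> (- (b - q * d))"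
        unfolding h_def by (simp_all add: ent_plus we g c')
    qed
    then have "h \<in> Ga 1" by (rule Ga_I) simp_all
    moreover have "(if - (a mod c) = 0 then 0 else Suc (degree (- (a mod c)))) < (if c = 0 then 0 else Suc (degree c))"
      using False degree_mod_less[OF False, of a] by auto
    ultimately have "h \<in> Fg 1" using less.hyps e(3) by blast
    moreover have "e12 (\<iota> (- q)) \<in> Fg 1" by (rule Fg_e12) simp
    moreover have "g = - e12 (\<iota> (- q)) + (- w + h)" by (simp add: h_def)
    ultimately show ?thesis using w Fg_add Fg_uminus by metis
  qed
qed

theorem Lv_1_Fg: "Lv 1 \<subseteq> Fg 1"
proof
  fix g assume "g \<in> Lv 1"
  then have "g \<in> Gen 1" using Lv_subset_Gen[of 1] by auto
  then show "g \<in> Fg 1"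
  proof (induction rule: Gen.induct)
    case (Gen_1 g h)
    then show ?case using Ga_Fg by (metis Fg_add Ga_E)
  next
    case (Gen_2 g h)
    then show ?case using Ga_Fg tc_Fg by (metis Fg_add Ga_E)
  qed simp
qed

end

section \<open>Induction on the primes of the level\<close>

lemma poly_split_prime_power:
  fixes f s :: "'a::field poly"
  assumes "Factorial_Ring.irreducible s" "f \<noteq> 0"
  shows "\<exists>k f'. f = s ^ k * f' \<and> \<not> s dvd f'"
  using assms(2)
proof (induction "degree f" arbitrary: f rule: less_induct)
  case less
  show ?case
  proof (cases "s dvd f")
    case True
    then obtain g where g: "f = s * g" by (elim dvdE)
    have "\<not> is_unit s" "s \<noteq> 0" using assms(1) by (auto simp: Factorial_Ring.irreducible_def)
    then have "degree s > 0" by (simp add: is_unit_iff_degree)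
    then have "degree g < degree f" "g \<noteq> 0" using less.prems \<open>s \<noteq> 0\<close> by (auto simp: g degree_mult_eq)
    from less.hyps[OF this] obtain k f' where "g = s ^ k * f'" "\<not> s dvd f'" by blast
    then show ?thesis by (intro exI[of _ "Suc k"] exI[of _ f']) (simp add: g mult.assoc)
  next
    case False
    then show ?thesis by (intro exI[of _ 0] exI[of _ f]) simp
  qed
qed

context s_arith
begin

text \<open>Each letter is a letter of level \<open>m * g\<close> times one of level
  \<open>f1 * g\<close>. Adding a letter at the front, its part of level \<open>m * g\<close> has to
  cross the word c2; the levels m and \<open>f1 * g\<close> are coprime, so by
  \<open>near_Fg\<close> this costs only an element of \<open>E\<close>.\<close>

lemma Fg_split:
  assumes m: "Rings.coprime m f1" "Rings.coprime m g" and pi: "Rings.coprime (m * (f1 * g)) \<pi>"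
    and c: "c \<in> Fg (\<iota> g)"
  shows "\<exists>c2 c1 h. c2 \<in> Fg (\<iota> (f1 * g)) \<and> c1 \<in> Fg (\<iota> (m * g)) \<and> h \<in> E (\<iota> (m * (f1 * g))) \<and> c = c2 + (c1 + h)"
proof -
  define f where "f = m * (f1 * g)"
  have mf: "Rings.coprime m (f1 * g)" using m by (simp add: poly_coprime_mult_right)
  have step: "\<exists>c2' c1' h'. c2' \<in> Fg (\<iota> (f1 * g)) \<and> c1' \<in> Fg (\<iota> (m * g)) \<and> h' \<in> E (\<iota> f) \<and>
      (w2 + w1) + (c2 + (c1 + h)) = c2' + (c1' + h')"
    if c2: "c2 \<in> Fg (\<iota> (f1 * g))" and c1: "c1 \<in> Fg (\<iota> (m * g))" and h: "h \<in> E (\<iota> f)"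
      and w2: "w2 \<in> Fg (\<iota> (f1 * g))" and w1: "w1 \<in> Fg (\<iota> (m * g))" and near: "near (\<iota> f) w1 c2" for c2 c1 h w2 w1
  proof (intro exI conjI)
    define r where "r = - w1 + (- c2 + (w1 + c2 - w1)) + w1"
    have L1: "w1 \<in> Lv 1" "c1 \<in> Lv 1" using w1 c1 Fg_Lv1[OF B_iota] by blast+
    have r: "r \<in> E (\<iota> f)" unfolding r_def using near L1 by (intro E_conj') (auto simp: near_def)
    show "w2 + c2 \<in> Fg (\<iota> (f1 * g))" "w1 + c1 \<in> Fg (\<iota> (m * g))" using w1 w2 c1 c2 by simp_all
    show "(- c1 + r + c1) + h \<in> E (\<iota> f)" using E_conj'[OF L1(2) r] h by (rule E_add)
    show "(w2 + w1) + (c2 + (c1 + h)) = (w2 + c2) + ((w1 + c1) + ((- c1 + r + c1) + h))"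
      by (simp add: r_def add.assoc minus_add diff_conv_add_uminus del: add_uminus_conv_diff)
  qed
  have sub: "J (\<iota> (m * g)) \<subseteq> J (\<iota> m)" by (rule J_dvd) simp
  have "\<exists>c2 c1 h. c2 \<in> Fg (\<iota> (f1 * g)) \<and> c1 \<in> Fg (\<iota> (m * g)) \<and> h \<in> E (\<iota> f) \<and> c = c2 + (c1 + h)" using c
  proof (induction rule: Fg.induct)
    case Fg_0
    show ?case by (rule exI[of _ 0])+ simp
  next
    case (Fg_12 x c)
    from Fg_12.IH obtain c2 c1 h where *: "c2 \<in> Fg (\<iota> (f1 * g))" "c1 \<in> Fg (\<iota> (m * g))" "h \<in> E (\<iota> f)"
      "c = c2 + (c1 + h)" by blast
    obtain x1 x2 where x: "x1 \<in> J (\<iota> (m * g))" "x2 \<in> J (\<iota> (f1 * g))" "x = x1 + x2"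
      using J_split[OF m(1) Fg_12.hyps(1)] by blast
    have "x1 \<in> J (\<iota> m)" using sub x(1) by blast
    from near_Fg(1)[OF mf pi this *(1)] have near: "near (\<iota> f) (e12 x1) c2" by (simp only: f_def)
    have "e12 x = e12 x2 + e12 x1" by (simp add: x(3) add.commute flip: e12_add)
    with step[OF *(1-3) Fg_e12[OF x(2)] Fg_e12[OF x(1)] near] show ?case unfolding *(4) by simp
  next
    case (Fg_21 x c)
    from Fg_21.IH obtain c2 c1 h where *: "c2 \<in> Fg (\<iota> (f1 * g))" "c1 \<in> Fg (\<iota> (m * g))" "h \<in> E (\<iota> f)"
      "c = c2 + (c1 + h)" by blast
    obtain x1 x2 where x: "x1 \<in> J (\<iota> (m * g))" "x2 \<in> J (\<iota> (f1 * g))" "x = x1 + x2"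
      using J_split[OF m(1) Fg_21.hyps(1)] by blast
    have "x1 \<in> J (\<iota> m)" using sub x(1) by blast
    from near_Fg(2)[OF mf pi this *(1)] have near: "near (\<iota> f) (e21 x1) c2" by (simp only: f_def)
    have "e21 x = e21 x2 + e21 x1" by (simp add: x(3) add.commute flip: e21_add)
    with step[OF *(1-3) Fg_e21[OF x(2)] Fg_e21[OF x(1)] near] show ?case unfolding *(4) by simp
  qed
  then show ?thesis by (simp only: f_def)
qed

end

context s_arith_hom
begin

lemma f_nz: "f \<noteq> 0"
  using f_pi irr_pi by (auto simp: Factorial_Ring.irreducible_def)

text \<open>
  If \<open>f1 = s\<^sup>k f1'\<close>, a word of level \<open>g\<close> is modulo \<open>E\<close> the product of a word of level \<open>f1' g\<close>, to which the result for a
  single prime applies, and a word of level \<open>s\<^sup>k g\<close>, to which the induction hypothesis for \<open>f1'\<close> applies.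
\<close>

lemma \<Phi>_Fg:
  assumes "f = f1 * g" "Rings.coprime f1 g" "c \<in> Fg (\<iota> g)" "c \<in> Lv (\<iota> f)"
  shows "\<Phi> c = \<one>\<^bsub>M\<^esub>"
  using assms
proof (induction "degree f1" arbitrary: f1 g c rule: less_induct)
  case less
  show ?case
  proof (cases "is_unit f1")
    case True
    then have "f dvd g" unfolding less.prems(1) by (simp add: mult_unit_dvd_iff')
    then have "Fg (\<iota> g) \<subseteq> Fg (\<iota> f)" by (intro Fg_mono J_iota_I)
    then show ?thesis using less.prems(3) Fg_E E_N N_kernel by blast
  next
    case False
    have nz: "f1 \<noteq> 0" using f_nz less.prems(1) by auto
    then obtain s where s: "Factorial_Ring.irreducible s" "s dvd f1" using poly_irreducible_factor False by blast
    obtain k f1' where f1: "f1 = s ^ k * f1'" "\<not> s dvd f1'" using poly_split_prime_power[OF s(1) nz] by blast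
    have k: "k > 0" using s f1 by (cases k) auto
    have f: "f = s ^ k * (f1' * g)" unfolding less.prems(1) f1 by (simp add: mult.assoc)
    have cop: "Rings.coprime (s ^ k) g" "Rings.coprime f1' g" using less.prems(2) unfolding f1(1) poly_coprime_mult_left by blast+
    have "Rings.coprime s g" using cop(1) k by (cases k) (auto simp: poly_coprime_mult_left)
    then have sg: "\<not> s dvd f1' * g"
      using f1(2) poly_coprime_iff_prime[OF s(1)] poly_coprime_mult_right by metis
    have cop': "Rings.coprime (s ^ k) f1'" "Rings.coprime f1' (s ^ k)"
      using f1(2) poly_coprime_iff_prime[OF s(1)] poly_coprime_power[of f1' s k] by (simp_all add: coprime_commute)
    obtain c2 c1 h where *: "c2 \<in> Fg (\<iota> (f1' * g))" "c1 \<in> Fg (\<iota> (s ^ k * g))" "h \<in> E (\<iota> f)" "c = c2 + (c1 + h)"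
      using Fg_split[OF cop'(1) cop(1) f_pi[unfolded f] less.prems(3)] unfolding f[symmetric] by blast
    have h: "h \<in> Lv (\<iota> f)" by (rule E_Lv[OF B_iota *(3)])
    have "c1 \<in> Lv (\<iota> (s ^ k * g))" using *(2) by (rule Fg_Lv[OF B_iota])
    moreover have "Lv (\<iota> (s ^ k * g)) \<subseteq> Lv (\<iota> (s ^ k))" by (intro Lv_mono J_iota_I) simp
    ultimately have "c1 \<in> Lv (\<iota> (s ^ k))" by blast
    moreover have "h \<in> Lv (\<iota> (s ^ k))" "c \<in> Lv (\<iota> (s ^ k))"
      using Lv_f_sub(2)[OF s(1) k f sg] h less.prems(4) by blast+
    \<comment> \<open>At s the factor c2 is trivial because c, c1 and h are; modulo f1' g it is so
      by construction. Hence c2, and with it c1, has the full level f.\<close>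
    moreover have "c2 = c - (c1 + h)" by (simp add: *(4))
    ultimately have "c2 \<in> Lv (\<iota> (s ^ k))" by simp
    moreover have "c2 \<in> Lv (\<iota> (f1' * g))" using *(1) by (rule Fg_Lv[OF B_iota])
    ultimately have c2: "c2 \<in> Lv (\<iota> f)" by (rule Lv_f_Int[OF s(1) k f sg])
    have "c1 = - c2 + c - h" by (simp add: *(4) add.assoc)
    then have c1: "c1 \<in> Lv (\<iota> f)" using c2 less.prems(4) h by simp
    have "\<not> is_unit s" "s \<noteq> 0" using s(1) by (auto simp: Factorial_Ring.irreducible_def)
    then have "degree (s ^ k) > 0" using k by (simp add: is_unit_iff_degree degree_power_eq)
    then have "degree f1' < degree f1" using nz unfolding f1(1) by (auto simp: degree_mult_eq)
    moreover have "f = f1' * (s ^ k * g)" unfolding f by (simp add: mult_ac)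
    moreover have "Rings.coprime f1' (s ^ k * g)" using cop cop' by (simp add: poly_coprime_mult_right)
    ultimately have "\<Phi> c1 = \<one>\<^bsub>M\<^esub>" using less.hyps *(2) c1 by blast
    moreover have "\<Phi> c2 = \<one>\<^bsub>M\<^esub>" by (rule \<Phi>_local[OF s(1) k f sg *(1) c2])
    moreover have "\<Phi> h = \<one>\<^bsub>M\<^esub>" using E_N[OF *(3)] by (rule N_kernel)
    ultimately show ?thesis unfolding *(4) using c1 c2 h by (simp add: \<Phi>_add)
  qed
qed

text \<open>The extreme case g = 1: every element of SL2(B) is an elementary word of level
  1.\<close>

theorem \<Phi>_trivial: assumes "c \<in> Lv (\<iota> f)" shows "\<Phi> c = \<one>\<^bsub>M\<^esub>"
proof -
  have "c \<in> Lv 1" using assms Lv_subset_1[OF B_iota] by blast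
  then have "c \<in> Fg (\<iota> 1)" using Lv_1_Fg by auto
  then show ?thesis using \<Phi>_Fg[of f 1] assms by simp
qed

end

section \<open>Gluing along the amalgam\<close>

text \<open>\<open>Ga n\<close> and its image under \<open>tc\<close> are the two factors of the
  amalgam. \<phi>2 is the homomorphism on the second factor, transported to \<open>Ga n\<close> by
  \<open>tc\<close>, and \<open>agree\<close> is compatibility on the intersection.\<close>

locale s_gluing = s_arith \<pi> + M: comm_group M
  for \<pi> :: "'a::{field, finite} poly" and M :: "('m, 'n) monoid_scheme" +
  fixes n :: "'a poly" and \<phi>1 \<phi>2 :: "'a poly fract sl2 \<Rightarrow> 'm"
  assumes n_pi: "Rings.coprime n \<pi>"
    and \<phi>1_closed [simp]: "g \<in> Ga n \<Longrightarrow> \<phi>1 g \<in> carrier M"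
    and \<phi>2_closed [simp]: "g \<in> Ga n \<Longrightarrow> \<phi>2 g \<in> carrier M"
    and \<phi>1_add: "g \<in> Ga n \<Longrightarrow> h \<in> Ga n \<Longrightarrow> \<phi>1 (g + h) = \<phi>1 g \<otimes>\<^bsub>M\<^esub> \<phi>1 h"
    and \<phi>2_add: "g \<in> Ga n \<Longrightarrow> h \<in> Ga n \<Longrightarrow> \<phi>2 (g + h) = \<phi>2 g \<otimes>\<^bsub>M\<^esub> \<phi>2 h"
    and agree: "g \<in> Ga n \<Longrightarrow> tc g \<in> Ga n \<Longrightarrow> \<phi>1 (tc g) = \<phi>2 g"
    and M_2: "x \<in> carrier M \<Longrightarrow> x \<otimes>\<^bsub>M\<^esub> x = \<one>\<^bsub>M\<^esub> \<Longrightarrow> x = \<one>\<^bsub>M\<^esub>"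
    and M_p: "x \<in> carrier M \<Longrightarrow> x [^]\<^bsub>M\<^esub> CHAR('a) = \<one>\<^bsub>M\<^esub> \<Longrightarrow> x = \<one>\<^bsub>M\<^esub>"
begin

text \<open>For g in \<open>Ga n\<close>, \<open>D\<close> holds if \<open>tc g\<close> is in
  \<open>Ga n\<close> again and \<open>D'\<close> if g is itself \<open>tc\<close> of such an
  element: the intersection of the factors seen from either side.\<close>

definition D where "D g \<longleftrightarrow> (\<exists>b. ent12 g = \<iota> (\<pi> * b))"
definition D' where "D' g \<longleftrightarrow> (\<exists>c. ent21 g = \<iota> (\<pi> * c))"

lemma D_tc: assumes "g \<in> Ga n" "D g" shows "tc g \<in> Ga n"
proof -
  obtain a b c d where g: "ent11 g = \<iota> a" "ent12 g = \<iota> b" "ent21 g = \<iota> c" "ent22 g = \<iota> d"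
    "n dvd a - 1" "n dvd b" "n dvd c" "n dvd d - 1" using assms(1) by (rule Ga_E)
  obtain b' where b': "ent12 g = \<iota> (\<pi> * b')" using assms(2) unfolding D_def by blast
  then have bb: "b = \<pi> * b'" using g by (simp only: to_fract_eq_iff)
  then have "n dvd b'" using g(6) n_pi poly_coprime_dvd_mult by blast
  moreover have "ent12 (tc g) = \<iota> b'" unfolding ent_tc g(2) bb by simp
  ultimately show ?thesis using g(1,3-8) by (intro Ga_I[of _ a b' "\<pi> * c" d]) (simp_all add: ent_tc)
qed

lemma D'_tc: assumes "g \<in> Ga n" "D' g" shows "\<exists>x \<in> Ga n. g = tc x"
proof -
  obtain a b c d where g: "ent11 g = \<iota> a" "ent12 g = \<iota> b" "ent21 g = \<iota> c" "ent22 g = \<iota> d"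
    "n dvd a - 1" "n dvd b" "n dvd c" "n dvd d - 1" "a * d - b * c = 1" using assms(1) by (rule Ga_E)
  obtain c' where c': "ent21 g = \<iota> (\<pi> * c')" using assms(2) unfolding D'_def by blast
  then have cc: "c = \<pi> * c'" using g by (simp only: to_fract_eq_iff)
  then have nc: "n dvd c'" using g(7) n_pi poly_coprime_dvd_mult by blast
  have "\<iota> (a * d - b * c) = 1" by (simp only: g to_fract_1)
  then have "\<iota> a * \<iota> d - \<iota> (\<pi> * b) * \<iota> c' = 1" by (simp add: cc mult_ac)
  note e = ent_sl2[OF this]
  have x: "sl2 (\<iota> a) (\<iota> (\<pi> * b)) (\<iota> c') (\<iota> d) \<in> Ga n"
    by (rule Ga_I[of _ a "\<pi> * b" c' d]) (use e g nc in simp_all)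
  have "g = tc (sl2 (\<iota> a) (\<iota> (\<pi> * b)) (\<iota> c') (\<iota> d))"
    by (rule sl2_eqI) (simp_all add: ent_tc e g cc del: to_fract_mult, simp_all)
  with x show ?thesis by blast
qed

section \<open>Values of words in the amalgam\<close>

lemma \<phi>1_0: "\<phi>1 0 = \<one>\<^bsub>M\<^esub>"
proof -
  have "\<phi>1 0 \<otimes>\<^bsub>M\<^esub> \<phi>1 0 = \<phi>1 0" using \<phi>1_add[of 0 0] Ga_0 by simp
  then show ?thesis using Ga_0 by simp
qed

lemma \<phi>2_0: "\<phi>2 0 = \<one>\<^bsub>M\<^esub>"
proof -
  have "\<phi>2 0 \<otimes>\<^bsub>M\<^esub> \<phi>2 0 = \<phi>2 0" using \<phi>2_add[of 0 0] Ga_0 by simp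
  then show ?thesis using Ga_0 by simp
qed

text \<open>The graph of the homomorphism under construction, taken as a relation. It is
  multiplicative by design, so uniqueness of the value has to be checked only over 0.\<close>

inductive P where
  P_0: "P 0 \<one>\<^bsub>M\<^esub>"
| P_1: "g \<in> Ga n \<Longrightarrow> P h m \<Longrightarrow> P (g + h) (\<phi>1 g \<otimes>\<^bsub>M\<^esub> m)"
| P_2: "g \<in> Ga n \<Longrightarrow> P h m \<Longrightarrow> P (tc g + h) (\<phi>2 g \<otimes>\<^bsub>M\<^esub> m)"

lemma P_closed: "P h m \<Longrightarrow> m \<in> carrier M"
  by (induction rule: P.induct) simp_all

lemma P_add: "P h m \<Longrightarrow> P h' m' \<Longrightarrow> P (h + h') (m \<otimes>\<^bsub>M\<^esub> m')"
proof (induction rule: P.induct)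
  case P_0
  then show ?case using P_closed by simp
next
  case (P_1 g h m)
  then show ?case using P.P_1 P_closed by (simp add: add.assoc M.m_assoc)
next
  case (P_2 g h m)
  then show ?case using P.P_2 P_closed by (simp add: add.assoc M.m_assoc)
qed

lemma P_gen: "g \<in> Ga n \<Longrightarrow> P g (\<phi>1 g)" "g \<in> Ga n \<Longrightarrow> P (tc g) (\<phi>2 g)"
  using P_1[OF _ P_0, of g] P_2[OF _ P_0, of g] by simp_all

lemma P_uminus: "P h m \<Longrightarrow> P (- h) (inv\<^bsub>M\<^esub> m)"
proof (induction rule: P.induct)
  case P_0
  then show ?case using P.P_0 by simp
next
  case (P_1 g h m)
  have "\<phi>1 g \<otimes>\<^bsub>M\<^esub> \<phi>1 (- g) = \<one>\<^bsub>M\<^esub>" using \<phi>1_add[of g "- g"] P_1 by (simp add: Ga_uminus \<phi>1_0)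
  then have "\<phi>1 (- g) = inv\<^bsub>M\<^esub> (\<phi>1 g)" using P_1 by (intro M.inv_equality[symmetric]) (simp_all add: Ga_uminus M.m_comm)
  then show ?case using P_add[OF P_1.IH P_gen(1)[OF Ga_uminus[OF P_1.hyps(1)]]] P_1 P_closed
    by (simp add: minus_add M.inv_mult M.m_comm)
next
  case (P_2 g h m)
  have "\<phi>2 g \<otimes>\<^bsub>M\<^esub> \<phi>2 (- g) = \<one>\<^bsub>M\<^esub>" using \<phi>2_add[of g "- g"] P_2 by (simp add: Ga_uminus \<phi>2_0)
  then have "\<phi>2 (- g) = inv\<^bsub>M\<^esub> (\<phi>2 g)" using P_2 by (intro M.inv_equality[symmetric]) (simp_all add: Ga_uminus M.m_comm)
  then show ?case using P_add[OF P_2.IH P_gen(2)[OF Ga_uminus[OF P_2.hyps(1)]]] P_2 P_closed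
    by (simp add: minus_add tc_uminus M.inv_mult M.m_comm)
qed

text \<open>Reduced words of the amalgam, with their value in \<open>M\<close>.\<close>

inductive Rw where
  Rw_0: "x \<in> Ga n \<Longrightarrow> g \<in> Ga n \<Longrightarrow> \<not> D x \<Longrightarrow> Rw (tc x + g) (\<phi>2 x \<otimes>\<^bsub>M\<^esub> \<phi>1 g)"
| Rw_1: "x \<in> Ga n \<Longrightarrow> g \<in> Ga n \<Longrightarrow> \<not> D x \<Longrightarrow> \<not> D' g \<Longrightarrow> Rw h m
    \<Longrightarrow> Rw (tc x + (g + h)) (\<phi>2 x \<otimes>\<^bsub>M\<^esub> (\<phi>1 g \<otimes>\<^bsub>M\<^esub> m))"

lemma Rw_closed: "Rw h m \<Longrightarrow> m \<in> carrier M"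
  by (induction rule: Rw.induct) simp_all

text \<open>The leading factor from \<open>Ga n\<close> is subject to no condition, which makes left
  multiplication by \<open>Ga n\<close> immediate.\<close>

definition Rd where
  "Rd h m \<longleftrightarrow> (h \<in> Ga n \<and> m = \<phi>1 h) \<or> (\<exists>g h' m'. g \<in> Ga n \<and> Rw h' m' \<and> h = g + h' \<and> m = \<phi>1 g \<otimes>\<^bsub>M\<^esub> m')"

lemma Rd_1: "h \<in> Ga n \<Longrightarrow> Rd h (\<phi>1 h)"
  by (simp add: Rd_def)

lemma Rd_2: "g \<in> Ga n \<Longrightarrow> Rw h m \<Longrightarrow> Rd (g + h) (\<phi>1 g \<otimes>\<^bsub>M\<^esub> m)"
  unfolding Rd_def by blast

lemma Rd_3: "Rw h m \<Longrightarrow> Rd h m"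
  using Rd_2[OF Ga_0, of h m] Rw_closed[of h m] by (simp add: \<phi>1_0)

lemma Rd_left: assumes "g \<in> Ga n" "Rd h m" shows "Rd (g + h) (\<phi>1 g \<otimes>\<^bsub>M\<^esub> m)"
  using assms(2) unfolding Rd_def[of h]
proof (elim disjE conjE exE)
  assume "h \<in> Ga n" "m = \<phi>1 h"
  then show ?thesis using assms(1) Rd_1[OF Ga_add[of g n h]] by (simp add: \<phi>1_add)
next
  fix g' h' m' assume *: "g' \<in> Ga n" "Rw h' m'" "h = g' + h'" "m = \<phi>1 g' \<otimes>\<^bsub>M\<^esub> m'"
  then show ?thesis using assms(1) Rd_2[OF Ga_add[of g n g'] *(2)] Rw_closed[OF *(2)]
    by (simp add: \<phi>1_add add.assoc M.m_assoc)
qed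

text \<open>The leading factors merge; if their product falls into the intersection, it is absorbed
  into the following factor from \<open>Ga n\<close>.\<close>

lemma Rd_tc_Rw: assumes "x \<in> Ga n" "Rw h m" shows "Rd (tc x + h) (\<phi>2 x \<otimes>\<^bsub>M\<^esub> m)"
  using assms(2)
proof cases
  case (Rw_0 y g)
  have xy: "x + y \<in> Ga n" using assms(1) Rw_0 by (simp add: Ga_add)
  have "tc x + h = tc (x + y) + g" "\<phi>2 x \<otimes>\<^bsub>M\<^esub> m = \<phi>2 (x + y) \<otimes>\<^bsub>M\<^esub> \<phi>1 g"
    using assms(1) Rw_0 by (simp_all add: tc_add add.assoc \<phi>2_add M.m_assoc)
  moreover have "Rd (tc (x + y) + g) (\<phi>2 (x + y) \<otimes>\<^bsub>M\<^esub> \<phi>1 g)"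
  proof (cases "D (x + y)")
    case True
    then show ?thesis using Rd_left[OF D_tc[OF xy True] Rd_1[OF \<open>g \<in> Ga n\<close>]] agree[OF xy D_tc[OF xy True]] by simp
  next
    case False
    then show ?thesis using Rw_0 xy by (intro Rd_3 Rw.Rw_0)
  qed
  ultimately show ?thesis by simp
next
  case (Rw_1 y g h' m')
  have xy: "x + y \<in> Ga n" using assms(1) Rw_1 by (simp add: Ga_add)
  have "tc x + h = tc (x + y) + (g + h')" "\<phi>2 x \<otimes>\<^bsub>M\<^esub> m = \<phi>2 (x + y) \<otimes>\<^bsub>M\<^esub> (\<phi>1 g \<otimes>\<^bsub>M\<^esub> m')"
    using assms(1) Rw_1 Rw_closed by (simp_all add: tc_add add.assoc \<phi>2_add M.m_assoc)
  moreover have "Rd (tc (x + y) + (g + h')) (\<phi>2 (x + y) \<otimes>\<^bsub>M\<^esub> (\<phi>1 g \<otimes>\<^bsub>M\<^esub> m'))"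
  proof (cases "D (x + y)")
    case True
    then show ?thesis
      using Rd_left[OF D_tc[OF xy True] Rd_2[OF \<open>g \<in> Ga n\<close> \<open>Rw h' m'\<close>]] agree[OF xy D_tc[OF xy True]] by simp
  next
    case False
    then show ?thesis using Rw_1 xy by (intro Rd_3 Rw.Rw_1)
  qed
  ultimately show ?thesis by simp
qed

lemma Rd_tc: assumes x: "x \<in> Ga n" and h: "Rd h m" shows "Rd (tc x + h) (\<phi>2 x \<otimes>\<^bsub>M\<^esub> m)"
proof (cases "D x")
  case True
  then show ?thesis using Rd_left[OF D_tc[OF x True] h] agree[OF x D_tc[OF x True]] by simp
next
  case False
  show ?thesis using h unfolding Rd_def[of h]
  proof (elim disjE conjE exE)
    assume "h \<in> Ga n" "m = \<phi>1 h"
    then show ?thesis using x False Rd_3[OF Rw_0] by simp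
  next
    fix g h' m' assume *: "g \<in> Ga n" "Rw h' m'" "h = g + h'" "m = \<phi>1 g \<otimes>\<^bsub>M\<^esub> m'"
    show ?thesis
    proof (cases "D' g")
      case True
      then obtain y where y: "y \<in> Ga n" "g = tc y" using D'_tc[OF *(1)] by blast
      have "\<phi>1 g = \<phi>2 y" using y *(1) agree by simp
      then have "tc x + h = tc (x + y) + h'" "\<phi>2 x \<otimes>\<^bsub>M\<^esub> m = \<phi>2 (x + y) \<otimes>\<^bsub>M\<^esub> m'"
        using y x * Rw_closed by (simp_all add: tc_add add.assoc \<phi>2_add M.m_assoc)
      then show ?thesis using Rd_tc_Rw[OF Ga_add[OF x y(1)] *(2)] by simp
    next
      case notD': False
      then show ?thesis unfolding *(3,4) using x * False by (intro Rd_3 Rw_1)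
    qed
  qed
qed

lemma P_Rd: "P h m \<Longrightarrow> Rd h m"
proof (induction rule: P.induct)
  case P_0
  show ?case using Rd_1[OF Ga_0] by (simp add: \<phi>1_0)
qed (simp_all add: Rd_left Rd_tc)

text \<open>
  Up to a power of \<open>\<pi>\<close>, a reduced word is an integral matrix which modulo \<open>\<pi>\<close> has a zero second row
  and a nonzero first row; so it cannot be an element of \<open>Ga n\<close>.
\<close>

definition T where
  "T h \<longleftrightarrow> (\<exists>j p q r t. ent11 h * \<iota> \<pi> ^ Suc j = \<iota> p \<and> ent12 h * \<iota> \<pi> ^ Suc j = \<iota> q
    \<and> ent21 h * \<iota> \<pi> ^ Suc j = \<iota> (\<pi> * r) \<and> ent22 h * \<iota> \<pi> ^ Suc j = \<iota> (\<pi> * t) \<and> \<not> (\<pi> dvd p \<and> \<pi> dvd q))"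

lemma T_not_Ga: assumes "T h" shows "h \<notin> Ga n"
proof
  assume "h \<in> Ga n"
  then obtain a b where ab: "ent11 h = \<iota> a" "ent12 h = \<iota> b" by (rule Ga_E)
  obtain j p q where *: "ent11 h * \<iota> \<pi> ^ Suc j = \<iota> p" "ent12 h * \<iota> \<pi> ^ Suc j = \<iota> q" "\<not> (\<pi> dvd p \<and> \<pi> dvd q)"
    using assms unfolding T_def by blast
  have "\<iota> (a * \<pi> ^ Suc j) = \<iota> p" "\<iota> (b * \<pi> ^ Suc j) = \<iota> q" unfolding *(1,2)[symmetric] ab by (simp_all add: to_fract_power)
  then have "a * \<pi> ^ Suc j = p" "b * \<pi> ^ Suc j = q" by (simp_all only: to_fract_eq_iff)
  then show False using *(3) by auto
qed

lemma prime_pi: "prime_elem \<pi>"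
  using irr_pi by (rule field_poly_irreducible_imp_prime)

text \<open>Modulo \<open>\<pi>\<close>, the matrix \<open>\<pi>\<close> times \<open>tc x\<close>
  has the single nonzero entry b, at the upper right. So the new first row is b times the old second
  row, and the new second row vanishes.\<close>

lemma T_step:
  assumes x: "x \<in> Ga n" "\<not> D x"
    and h: "ent11 h * \<iota> \<pi> ^ j = \<iota> p" "ent12 h * \<iota> \<pi> ^ j = \<iota> q" "ent21 h * \<iota> \<pi> ^ j = \<iota> r" "ent22 h * \<iota> \<pi> ^ j = \<iota> t"
    and rt: "\<not> (\<pi> dvd r \<and> \<pi> dvd t)"
  shows "T (tc x + h)"
proof -
  obtain a b c d where g: "ent11 x = \<iota> a" "ent12 x = \<iota> b" "ent21 x = \<iota> c" "ent22 x = \<iota> d" using x(1) by (rule Ga_E)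
  have b: "\<not> \<pi> dvd b" using x(2) g unfolding D_def by (auto elim!: dvdE)
  show ?thesis unfolding T_def
  proof (intro exI conjI)
    show "ent11 (tc x + h) * \<iota> \<pi> ^ Suc j = \<iota> (\<pi> * (a * p) + b * r)"
      "ent12 (tc x + h) * \<iota> \<pi> ^ Suc j = \<iota> (\<pi> * (a * q) + b * t)"
      "ent21 (tc x + h) * \<iota> \<pi> ^ Suc j = \<iota> (\<pi> * (\<pi> * c * p + d * r))"
      "ent22 (tc x + h) * \<iota> \<pi> ^ Suc j = \<iota> (\<pi> * (\<pi> * c * q + d * t))"
      unfolding to_fract_add to_fract_mult h[symmetric] ent_plus ent_tc g by (simp_all add: field_simps)
    show "\<not> (\<pi> dvd \<pi> * (a * p) + b * r \<and> \<pi> dvd \<pi> * (a * q) + b * t)"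
      using b rt prime_pi by (simp add: prime_elem_dvd_mult_iff dvd_add_right_iff)
  qed
qed

lemma Rw_T: "Rw h m \<Longrightarrow> T h"
proof (induction rule: Rw.induct)
  case (Rw_0 x g)
  obtain a b c d where g: "ent11 g = \<iota> a" "ent12 g = \<iota> b" "ent21 g = \<iota> c" "ent22 g = \<iota> d" "a * d - b * c = 1"
    using Rw_0(2) by (rule Ga_E)
  have "\<not> (\<pi> dvd c \<and> \<pi> dvd d)"
  proof
    assume "\<pi> dvd c \<and> \<pi> dvd d"
    then have "\<pi> dvd a * d - b * c" by simp
    then show False using prime_pi by (simp add: g prime_elem_not_unit)
  qed
  then show ?case using Rw_0 g by (intro T_step[of x g 0 a b c d]) simp_all
next
  case (Rw_1 x g h m)
  obtain a b c d where g: "ent11 g = \<iota> a" "ent12 g = \<iota> b" "ent21 g = \<iota> c" "ent22 g = \<iota> d" "a * d - b * c = 1"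
    using Rw_1(2) by (rule Ga_E)
  have c: "\<not> \<pi> dvd c" using Rw_1(4) g unfolding D'_def by (auto elim!: dvdE)
  obtain j p q r t where h: "ent11 h * \<iota> \<pi> ^ Suc j = \<iota> p" "ent12 h * \<iota> \<pi> ^ Suc j = \<iota> q"
    "ent21 h * \<iota> \<pi> ^ Suc j = \<iota> (\<pi> * r)" "ent22 h * \<iota> \<pi> ^ Suc j = \<iota> (\<pi> * t)" "\<not> (\<pi> dvd p \<and> \<pi> dvd q)"
    using Rw_1.IH unfolding T_def by blast
  show ?case
  proof (rule T_step[OF Rw_1(1,3)])
    show "ent11 (g + h) * \<iota> \<pi> ^ Suc j = \<iota> (a * p + b * (\<pi> * r))" "ent12 (g + h) * \<iota> \<pi> ^ Suc j = \<iota> (a * q + b * (\<pi> * t))"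
      "ent21 (g + h) * \<iota> \<pi> ^ Suc j = \<iota> (c * p + \<pi> * (d * r))" "ent22 (g + h) * \<iota> \<pi> ^ Suc j = \<iota> (c * q + \<pi> * (d * t))"
      unfolding to_fract_add to_fract_mult h(1-4)[unfolded to_fract_mult, symmetric] ent_plus g
        mult.left_commute[of "\<iota> \<pi>" "\<iota> d"]
      by (simp_all add: algebra_simps)
    show "\<not> (\<pi> dvd c * p + \<pi> * (d * r) \<and> \<pi> dvd c * q + \<pi> * (d * t))"
      using c h(5) prime_pi by (simp add: prime_elem_dvd_mult_iff dvd_add_left_iff)
  qed
qed

text \<open>A reduced form of 0 containing a factor \<open>tc x\<close> would place a reduced word
  in \<open>Ga n\<close>, against \<open>T_not_Ga\<close>.\<close>

lemma P_0_unique: assumes "P 0 m" shows "m = \<one>\<^bsub>M\<^esub>"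
proof -
  have "Rd 0 m" using assms by (rule P_Rd)
  then show ?thesis unfolding Rd_def
  proof (elim disjE conjE exE)
    fix g h m' assume *: "g \<in> Ga n" "Rw h m'" "0 = g + h"
    then have "h = - g" by (metis minus_unique)
    then show ?thesis using T_not_Ga[OF Rw_T[OF *(2)]] Ga_uminus[OF *(1)] by blast
  qed (simp add: \<phi>1_0)
qed

lemma P_unique: assumes "P h m" "P h m'" shows "m = m'"
proof -
  have "P 0 (m \<otimes>\<^bsub>M\<^esub> inv\<^bsub>M\<^esub> m')" using P_add[OF assms(1) P_uminus[OF assms(2)]] by simp
  then have "m \<otimes>\<^bsub>M\<^esub> inv\<^bsub>M\<^esub> m' = \<one>\<^bsub>M\<^esub>" by (rule P_0_unique)
  then show ?thesis using assms P_closed by (metis M.inv_closed M.inv_equality M.inv_inv)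
qed

lemma P_total: assumes "h \<in> Lv (\<iota> n)" shows "\<exists>m. P h m"
proof -
  have "h \<in> Gen n" using assms Lv_subset_Gen[OF n_pi] by blast
  then show ?thesis by (induction rule: Gen.induct) (blast intro: P.intros)+
qed

theorem gluing_trivial: assumes "g \<in> Ga n" shows "\<phi>1 g = \<one>\<^bsub>M\<^esub>" "\<phi>2 g = \<one>\<^bsub>M\<^esub>"
proof -
  define \<Phi> where "\<Phi> h = (THE m. P h m)" for h
  have \<Phi>: "\<Phi> h = m" if "P h m" for h m unfolding \<Phi>_def using that P_unique by blast
  have P\<Phi>: "P h (\<Phi> h)" if "h \<in> Lv (\<iota> n)" for h using P_total[OF that] \<Phi> by blast
  interpret H: s_arith_hom \<pi> M n \<Phi>
    using n_pi M_2 M_p P_closed[OF P\<Phi>] \<Phi>[OF P_add[OF P\<Phi> P\<Phi>]] by unfold_locales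
  show "\<phi>1 g = \<one>\<^bsub>M\<^esub>" using \<Phi>[OF P_gen(1)[OF assms]] H.\<Phi>_trivial[OF Ga_Lv[OF assms]] by simp
  show "\<phi>2 g = \<one>\<^bsub>M\<^esub>" using \<Phi>[OF P_gen(2)[OF assms]] H.\<Phi>_trivial[OF tc_Lv[OF Ga_Lv[OF assms]]] by simp
qed

end

section \<open>Torsion-free abelianizations and reduction modulo \<open>l\<close>\<close>

lemma quot_map_coset:
  assumes G: "N \<lhd> G" and H: "M \<lhd> H" and f: "f \<in> hom G H" "f ` N \<subseteq> M" and x: "x \<in> carrier G"
  shows "quot_map H M f (N #>\<^bsub>G\<^esub> x) = M #>\<^bsub>H\<^esub> f x"
proof -
  interpret N: normal N G by (rule G)
  interpret M: normal M H by (rule H)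
  have fx: "f x \<in> carrier H" using f(1) x by (rule hom_in_carrier)
  have MM: "m \<otimes>\<^bsub>H\<^esub> f y \<otimes>\<^bsub>H\<^esub> f x \<in> M #>\<^bsub>H\<^esub> f x" if "m \<in> M" "y \<in> N" for m y
    using that f(2) unfolding r_coset_def by blast
  have "m \<otimes>\<^bsub>H\<^esub> f (y \<otimes>\<^bsub>G\<^esub> x) = m \<otimes>\<^bsub>H\<^esub> f y \<otimes>\<^bsub>H\<^esub> f x" if "m \<in> M" "y \<in> N" for m y
    using that f x fx hom_in_carrier[OF f(1), of y] by (simp add: hom_mult[OF f(1)] M.m_assoc)
  then have "quot_map H M f (N #>\<^bsub>G\<^esub> x) \<subseteq> M #>\<^bsub>H\<^esub> f x"
    using MM unfolding quot_map_def set_mult_def r_coset_def[of G] by auto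
  moreover have "M #>\<^bsub>H\<^esub> f x \<subseteq> quot_map H M f (N #>\<^bsub>G\<^esub> x)"
    using N.rcos_self[OF x N.subgroup_axioms] unfolding quot_map_def set_mult_def r_coset_def[of H] by blast
  ultimately show ?thesis by blast
qed

lemma quot_map_hom:
  assumes G: "N \<lhd> G" and H: "M \<lhd> H" and f: "f \<in> hom G H" "f ` N \<subseteq> M"
  shows "quot_map H M f \<in> hom (G Mod N) (H Mod M)"
proof -
  interpret N: normal N G by (rule G)
  interpret M: normal M H by (rule H)
  have fc: "f x \<in> carrier H" if "x \<in> carrier G" for x using f(1) that by (rule hom_in_carrier)
  show ?thesis
  proof (rule homI)
    fix C assume "C \<in> carrier (G Mod N)"
    then show "quot_map H M f C \<in> carrier (H Mod M)"
      using quot_map_coset[OF assms] fc by (auto simp: carrier_FactGroup)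
  next
    fix C D assume "C \<in> carrier (G Mod N)" "D \<in> carrier (G Mod N)"
    then obtain x y where "x \<in> carrier G" "C = N #>\<^bsub>G\<^esub> x" "y \<in> carrier G" "D = N #>\<^bsub>G\<^esub> y"
      by (auto simp: carrier_FactGroup)
    then show "quot_map H M f (C \<otimes>\<^bsub>G Mod N\<^esub> D) = quot_map H M f C \<otimes>\<^bsub>H Mod M\<^esub> quot_map H M f D"
      using fc by (simp add: N.rcos_sum M.rcos_sum quot_map_coset[OF assms] hom_mult[OF f(1)])
  qed
qed

section \<open>Functoriality of the torsion-free abelianization\<close>

lemma derived_hom:
  assumes "group G" "group H" "f \<in> hom G H"
  shows "f ` derived G (carrier G) \<subseteq> derived H (carrier H)"
proof -
  interpret group_hom G H f using assms by (simp add: group_hom_def group_hom_axioms_def)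
  have "derived H (f ` carrier G) \<subseteq> derived H (carrier H)" by (rule H.mono_derived) auto
  then show ?thesis using derived_img[of "carrier G"] by simp
qed

lemma abelianization_comm_group: "group G \<Longrightarrow> comm_group (abelianization G)"
  unfolding abelianization_def by (rule group.derived_quot_is_comm_group)

lemma subgroup_torsion: fixes G (structure) assumes "comm_group G" shows "subgroup (torsion G) G"
proof -
  interpret comm_group G by (rule assms)
  show ?thesis
  proof (rule subgroupI)
    have "\<one> [^] (1::nat) = \<one>" by simp
    then have "\<one> \<in> torsion G" unfolding torsion_def by (intro CollectI conjI exI[of _ "1::nat"]) auto
    then show "torsion G \<noteq> {}" by blast
  next
    fix a assume "a \<in> torsion G"
    then obtain k :: nat where "a \<in> carrier G" "k > 0" "a [^] k = \<one>" by (auto simp: torsion_def)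
    then show "inv a \<in> torsion G" by (auto simp: torsion_def nat_pow_inv)
  next
    fix a b assume "a \<in> torsion G" "b \<in> torsion G"
    then obtain k m :: nat where *: "a \<in> carrier G" "k > 0" "a [^] k = \<one>" "b \<in> carrier G" "m > 0" "b [^] m = \<one>"
      by (auto simp: torsion_def)
    have "a [^] (k * m) = \<one>" using * nat_pow_pow[of a k m] by simp
    moreover have "b [^] (k * m) = \<one>" using * nat_pow_pow[of b m k] by (simp add: mult.commute)
    ultimately have "(a \<otimes> b) [^] (k * m) = \<one>" using * by (simp add: nat_pow_distrib)
    then show "a \<otimes> b \<in> torsion G" using * unfolding torsion_def by (intro CollectI conjI exI[of _ "k * m"]) auto
  qed (auto simp: torsion_def)
qed

lemma hom_nat_pow:
  assumes "group G" "group H" "f \<in> hom G H" "x \<in> carrier G"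
  shows "f (x [^]\<^bsub>G\<^esub> (k::nat)) = f x [^]\<^bsub>H\<^esub> k"
proof -
  interpret group_hom G H f using assms by (simp add: group_hom_def group_hom_axioms_def)
  show ?thesis using assms(4) by (rule hom_nat_pow)
qed

lemma torsion_hom:
  assumes "group G" "group H" "f \<in> hom G H" shows "f ` torsion G \<subseteq> torsion H"
proof
  fix y assume "y \<in> f ` torsion G"
  then obtain x and k :: nat where x: "x \<in> carrier G" "k > 0" "x [^]\<^bsub>G\<^esub> k = \<one>\<^bsub>G\<^esub>" "y = f x" by (auto simp: torsion_def)
  have "f x [^]\<^bsub>H\<^esub> k = \<one>\<^bsub>H\<^esub>" using hom_nat_pow[OF assms x(1), of k] hom_one[OF assms(3,1,2)] x(3) by simp
  then show "y \<in> torsion H" using x hom_in_carrier[OF assms(3) x(1)] by (auto simp: torsion_def)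
qed

lemma free_ab_comm_group: assumes "group G" shows "comm_group (free_ab G)"
proof -
  interpret A: comm_group "abelianization G" using assms by (rule abelianization_comm_group)
  show ?thesis unfolding free_ab_def
    by (intro A.abelian_FactGroup subgroup_torsion A.comm_group_axioms)
qed

definition free_ab_class :: "('a, 'k) monoid_scheme \<Rightarrow> 'a \<Rightarrow> 'a set set" where
  "free_ab_class G x = torsion (abelianization G) #>\<^bsub>abelianization G\<^esub> (derived G (carrier G) #>\<^bsub>G\<^esub> x)"

lemma carrier_abelianization:
  "carrier (abelianization G) = (\<lambda>x. derived G (carrier G) #>\<^bsub>G\<^esub> x) ` carrier G"
  by (simp add: abelianization_def carrier_FactGroup)

lemma carrier_free_ab: "carrier (free_ab G) = free_ab_class G ` carrier G"
  by (simp add: free_ab_def carrier_FactGroup carrier_abelianization image_image free_ab_class_def)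

lemma abelianization_normal: "group G \<Longrightarrow> derived G (carrier G) \<lhd> G"
  by (rule group.derived_self_is_normal)

lemma torsion_normal: "group G \<Longrightarrow> torsion (abelianization G) \<lhd> abelianization G"
  by (intro comm_group.subgroup_imp_normal subgroup_torsion abelianization_comm_group)

lemma free_ab_class_mult:
  assumes "group G" "x \<in> carrier G" "y \<in> carrier G"
  shows "free_ab_class G (x \<otimes>\<^bsub>G\<^esub> y) = free_ab_class G x \<otimes>\<^bsub>free_ab G\<^esub> free_ab_class G y"
proof -
  interpret D: normal "derived G (carrier G)" G using assms(1) by (rule abelianization_normal)
  interpret N: normal "torsion (abelianization G)" "abelianization G" using assms(1) by (rule torsion_normal)
  have "derived G (carrier G) #>\<^bsub>G\<^esub> (x \<otimes>\<^bsub>G\<^esub> y)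
      = (derived G (carrier G) #>\<^bsub>G\<^esub> x) \<otimes>\<^bsub>abelianization G\<^esub> (derived G (carrier G) #>\<^bsub>G\<^esub> y)"
    using assms by (simp add: abelianization_def D.rcos_sum)
  then show ?thesis using assms
    by (simp add: free_ab_class_def free_ab_def N.rcos_sum carrier_abelianization)
qed

lemma abelianization_map_coset:
  assumes "group G" "group H" "f \<in> hom G H" "x \<in> carrier G"
  shows "abelianization_map H f (derived G (carrier G) #>\<^bsub>G\<^esub> x) = derived H (carrier H) #>\<^bsub>H\<^esub> f x"
  unfolding abelianization_map_def
  using assms by (intro quot_map_coset abelianization_normal derived_hom)

lemma abelianization_map_hom:
  assumes "group G" "group H" "f \<in> hom G H"
  shows "abelianization_map H f \<in> hom (abelianization G) (abelianization H)"
  unfolding abelianization_map_def abelianization_def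
  using assms by (intro quot_map_hom abelianization_normal derived_hom)

lemma free_ab_map_class:
  assumes "group G" "group H" "f \<in> hom G H" "x \<in> carrier G"
  shows "free_ab_map H f (free_ab_class G x) = free_ab_class H (f x)"
proof -
  have grp: "group (abelianization G)" "group (abelianization H)"
    using abelianization_comm_group assms(1,2) by (auto simp: comm_group_def)
  have "derived G (carrier G) #>\<^bsub>G\<^esub> x \<in> carrier (abelianization G)" using assms(4) by (simp add: carrier_abelianization)
  from quot_map_coset[OF torsion_normal[OF assms(1)] torsion_normal[OF assms(2)] abelianization_map_hom[OF assms(1-3)]
    torsion_hom[OF grp abelianization_map_hom[OF assms(1-3)]] this]
  show ?thesis by (simp add: free_ab_map_def free_ab_class_def abelianization_map_coset[OF assms])
qed

section \<open>Reduction modulo \<open>l\<close>\<close>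

lemma subgroup_powers: fixes G (structure) assumes "comm_group G" shows "subgroup (powers l G) G"
proof -
  interpret comm_group G by (rule assms)
  show ?thesis
  proof (rule subgroupI)
    fix a assume "a \<in> powers l G"
    then obtain x where x: "x \<in> carrier G" "a = x [^] l" by (auto simp: powers_def)
    then have "inv a = inv x [^] l" by (simp add: nat_pow_inv)
    then show "inv a \<in> powers l G" using x by (auto simp: powers_def)
  next
    fix a b assume "a \<in> powers l G" "b \<in> powers l G"
    then obtain x y where x: "x \<in> carrier G" "a = x [^] l" "y \<in> carrier G" "b = y [^] l" by (auto simp: powers_def)
    then have "a \<otimes> b = (x \<otimes> y) [^] l" by (simp add: nat_pow_distrib)
    then show "a \<otimes> b \<in> powers l G" using x by (auto simp: powers_def)
  qed (auto simp: powers_def)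
qed

lemma powers_normal: "comm_group G \<Longrightarrow> powers l G \<lhd> G"
  by (intro comm_group.subgroup_imp_normal subgroup_powers)

lemma powers_hom:
  assumes "group G" "group H" "f \<in> hom G H" shows "f ` powers l G \<subseteq> powers l H"
  using hom_nat_pow[OF assms] hom_in_carrier[OF assms(3)] by (auto simp: powers_def)

lemma tensor_mod_comm_group: assumes "comm_group G" shows "comm_group (tensor_mod l G)"
proof -
  interpret comm_group G by (rule assms)
  show ?thesis unfolding tensor_mod_def by (intro abelian_FactGroup subgroup_powers assms)
qed

lemma tensor_mod_pow:
  fixes G (structure)
  assumes "comm_group G" "C \<in> carrier (tensor_mod l G)"
  shows "C [^]\<^bsub>tensor_mod l G\<^esub> l = \<one>\<^bsub>tensor_mod l G\<^esub>"
proof -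
  interpret comm_group G by (rule assms)
  interpret P: normal "powers l G" G using assms(1) by (rule powers_normal)
  obtain x where x: "x \<in> carrier G" "C = powers l G #> x"
    using assms(2) by (auto simp: tensor_mod_def carrier_FactGroup)
  have "x [^] l \<in> powers l G" using x by (simp add: powers_def)
  then show ?thesis using x(1) P.subgroup_axioms
    by (simp add: x(2) tensor_mod_def P.FactGroup_pow coset_join2 P.subset)
qed

lemma eq_one_if_coprime_powers:
  fixes G (structure)
  assumes "group G" "x \<in> carrier G" "x [^]\<^bsub>G\<^esub> k = \<one>\<^bsub>G\<^esub>" "x [^]\<^bsub>G\<^esub> m = \<one>\<^bsub>G\<^esub>"
    "Rings.coprime k (m::nat)"
  shows "x = \<one>\<^bsub>G\<^esub>"
proof -
  interpret group G by (rule assms)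
  have "ord x dvd k" "ord x dvd m" using assms by (simp_all add: pow_eq_id)
  then have "ord x dvd 1" using assms(5) coprime_common_divisor by blast
  then have "x [^] (1::nat) = \<one>" using assms(2) by (subst pow_eq_id) auto
  then show ?thesis using assms(2) by simp
qed

section \<open>Matrices and ideals\<close>

definition mat2 :: "'r \<Rightarrow> 'r \<Rightarrow> 'r \<Rightarrow> 'r \<Rightarrow> ('r::zero) ^ 2 ^ 2" where
  "mat2 a b c d = vector [vector [a, b], vector [c, d]]"

lemma mat2_nth [simp]:
  "mat2 a b c d $ 1 $ 1 = a" "mat2 a b c d $ 1 $ 2 = b" "mat2 a b c d $ 2 $ 1 = c" "mat2 a b c d $ 2 $ 2 = d"
  by (simp_all add: mat2_def)

lemma mat2_eq_iff: "g = h \<longleftrightarrow> g $ 1 $ 1 = h $ 1 $ 1 \<and> g $ 1 $ 2 = h $ 1 $ 2 \<and> g $ 2 $ 1 = h $ 2 $ 1 \<and> g $ 2 $ 2 = h $ 2 $ 2"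
  for g h :: "'r ^ 2 ^ 2"
  by (auto simp: vec_eq_iff forall_2)

lemma mat2_mult_nth: "(g ** h) $ i $ j = g $ i $ 1 * h $ 1 $ j + g $ i $ 2 * h $ 2 $ j"
  for g h :: "'r::comm_ring_1 ^ 2 ^ 2"
  by (simp add: matrix_matrix_mult_def sum_2)

lemma mat1_nth: "(mat 1 :: 'r::comm_ring_1 ^ 2 ^ 2) $ 1 $ 1 = 1" "(mat 1 :: 'r ^ 2 ^ 2) $ 1 $ 2 = 0"
   "(mat 1 :: 'r ^ 2 ^ 2) $ 2 $ 1 = 0" "(mat 1 :: 'r ^ 2 ^ 2) $ 2 $ 2 = 1"
  by (simp_all add: mat_def)

lemma frac_matrix_mult: "frac_matrix (g ** h) = frac_matrix g ** frac_matrix h"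
  for g h :: "'a::field poly ^ 2 ^ 2"
  by (simp add: mat2_eq_iff mat2_mult_nth)

lemma frac_matrix_eq_iff: "frac_matrix g = frac_matrix h \<longleftrightarrow> g = h"
  by (simp add: mat2_eq_iff)

text \<open>The equation \<open>k ** g = g ** h\<close> replaces inverses over the fraction field,
  so conjugations can be verified over the polynomial ring.\<close>

lemma conj_by_eq:
  fixes g h k :: "'a::field poly ^ 2 ^ 2"
  assumes "det g \<noteq> 0" "k ** g = g ** h" shows "conj_by g h = k"
proof -
  have "det (frac_matrix g) = to_fract (det g)" by (simp add: det_2)
  then have "invertible (frac_matrix g)" using assms(1) by (simp add: invertible_det_nz)
  then have inv: "frac_matrix g ** matrix_inv (frac_matrix g) = mat 1"
    unfolding invertible_def matrix_inv_def by (rule someI2_ex) simp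
  have "frac_matrix g ** frac_matrix h ** matrix_inv (frac_matrix g) = frac_matrix k ** (frac_matrix g ** matrix_inv (frac_matrix g))"
    by (simp only: frac_matrix_mult[symmetric] assms(2)[symmetric]) (simp only: frac_matrix_mult matrix_mul_assoc)
  then have "frac_matrix g ** frac_matrix h ** matrix_inv (frac_matrix g) = frac_matrix k" by (simp only: inv matrix_mul_rid)
  then show ?thesis unfolding conj_by_def by (simp add: frac_matrix_eq_iff)
qed

lemma conj_by_S: "conj_by S_matrix h = mat2 (h $ 2 $ 2) (- h $ 2 $ 1) (- h $ 1 $ 2) (h $ 1 $ 1)"
  by (rule conj_by_eq) (simp_all add: S_matrix_def det_2 mat2_eq_iff mat2_mult_nth)

lemma conj_by_tau:
  assumes "monic_generator v = p" "p \<noteq> 0" "h $ 2 $ 1 = p * c"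
  shows "conj_by (tau_matrix v) h = mat2 (h $ 1 $ 1) (p * h $ 1 $ 2) c (h $ 2 $ 2)"
  using assms by (intro conj_by_eq) (simp_all add: tau_matrix_def det_2 mat2_eq_iff mat2_mult_nth mult.commute)

section \<open>Congruence subgroups as groups\<close>

lemma SL2_simps [simp]: "carrier SL2 = {g. det g = 1}" "monoid.mult SL2 = (**)" "one SL2 = mat 1"
  by (simp_all add: SL2_def)

lemma group_SL2_sub:
  assumes "Q \<subseteq> carrier SL2" "mat 1 \<in> Q" "\<And>g h. g \<in> Q \<Longrightarrow> h \<in> Q \<Longrightarrow> g ** h \<in> Q"
    "\<And>g. g \<in> Q \<Longrightarrow> mat2 (g $ 2 $ 2) (- g $ 1 $ 2) (- g $ 2 $ 1) (g $ 1 $ 1) \<in> Q"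
  shows "group (SL2_sub Q)"
proof (rule groupI)
  fix g assume "g \<in> carrier (SL2_sub Q)"
  then have g: "g \<in> Q" by simp
  then have "det g = 1" using assms(1) by auto
  then have "mat2 (g $ 2 $ 2) (- g $ 1 $ 2) (- g $ 2 $ 1) (g $ 1 $ 1) ** g = mat 1"
    by (simp add: mat2_eq_iff mat2_mult_nth mat1_nth det_2 algebra_simps)
  then show "\<exists>h \<in> carrier (SL2_sub Q). h \<otimes>\<^bsub>SL2_sub Q\<^esub> g = \<one>\<^bsub>SL2_sub Q\<^esub>" using assms(4)[OF g] by auto
qed (use assms in \<open>auto simp: matrix_mul_assoc\<close>)

lemma Gamma_full_iff:
  assumes "n = {x. \<nu> dvd x}"
  shows "g \<in> Gamma_full n \<longleftrightarrow> g $ 1 $ 1 * g $ 2 $ 2 - g $ 1 $ 2 * g $ 2 $ 1 = 1 \<and> \<nu> dvd g $ 1 $ 1 - 1 \<and> \<nu> dvd g $ 1 $ 2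
     \<and> \<nu> dvd g $ 2 $ 1 \<and> \<nu> dvd g $ 2 $ 2 - 1"
  using assms by (auto simp: Gamma_full_def det_2 forall_2 mat1_nth)

lemma dvd_mult_minus_one:
  fixes \<nu> a b :: "'r::comm_ring_1"
  assumes "\<nu> dvd a - 1" "\<nu> dvd b - 1" "\<nu> dvd c" shows "\<nu> dvd a * b + c - 1" "\<nu> dvd c + a * b - 1"
proof -
  have "a * b + c - 1 = (a - 1) * b + (b - 1) + c" "c + a * b - 1 = (a - 1) * b + (b - 1) + c"
    by (simp_all add: algebra_simps)
  then show "\<nu> dvd a * b + c - 1" "\<nu> dvd c + a * b - 1" using assms by (metis dvd_add dvd_mult2)+
qed

lemma Gamma_full_closed:
  assumes n: "n = {x. \<nu> dvd x}"
  shows "Gamma_full n \<subseteq> carrier SL2" "mat 1 \<in> Gamma_full n"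
    "g \<in> Gamma_full n \<Longrightarrow> h \<in> Gamma_full n \<Longrightarrow> g ** h \<in> Gamma_full n"
    "g \<in> Gamma_full n \<Longrightarrow> mat2 (g $ 2 $ 2) (- g $ 1 $ 2) (- g $ 2 $ 1) (g $ 1 $ 1) \<in> Gamma_full n"
proof -
  show "Gamma_full n \<subseteq> carrier SL2" by (auto simp: Gamma_full_def)
  show "mat 1 \<in> Gamma_full n" using n by (simp add: Gamma_full_def)
  show "g ** h \<in> Gamma_full n" if gh: "g \<in> Gamma_full n" "h \<in> Gamma_full n"
  proof -
    have "det (g ** h) = 1" using gh by (simp add: Gamma_full_def det_mul)
    then show ?thesis using gh dvd_mult_minus_one(1)[of \<nu> "g $ 1 $ 1" "h $ 1 $ 1" "g $ 1 $ 2 * h $ 2 $ 1"]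
        dvd_mult_minus_one(2)[of \<nu> "g $ 2 $ 2" "h $ 2 $ 2" "g $ 2 $ 1 * h $ 1 $ 2"]
      unfolding Gamma_full_iff[OF n] det_2 mat2_mult_nth by simp
  qed
  show "mat2 (g $ 2 $ 2) (- g $ 1 $ 2) (- g $ 2 $ 1) (g $ 1 $ 1) \<in> Gamma_full n" if "g \<in> Gamma_full n"
    using that unfolding Gamma_full_iff[OF n] by (simp add: mult.commute)
qed

lemma group_Gamma_full: "n = {x. \<nu> dvd x} \<Longrightarrow> group (SL2_sub (Gamma_full n))"
  by (rule group_SL2_sub) (fact Gamma_full_closed)+

lemma group_Gamma_lower:
  assumes n: "n = {x. \<nu> dvd x}" and v: "v = {x. p dvd x}"
  shows "group (SL2_sub (Gamma_lower v \<inter> Gamma_full n))"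
proof (rule group_SL2_sub)
  show "Gamma_lower v \<inter> Gamma_full n \<subseteq> carrier SL2" "mat 1 \<in> Gamma_lower v \<inter> Gamma_full n"
    using Gamma_full_closed(1,2)[OF n] by (auto simp: Gamma_lower_def v mat1_nth)
next
  fix g h assume gh: "g \<in> Gamma_lower v \<inter> Gamma_full n" "h \<in> Gamma_lower v \<inter> Gamma_full n"
  then show "g ** h \<in> Gamma_lower v \<inter> Gamma_full n" using Gamma_full_closed(3)[OF n, of g h]
    by (auto simp: Gamma_lower_def v mat2_mult_nth det_mul)
next
  fix g assume "g \<in> Gamma_lower v \<inter> Gamma_full n"
  then show "mat2 (g $ 2 $ 2) (- g $ 1 $ 2) (- g $ 2 $ 1) (g $ 1 $ 1) \<in> Gamma_lower v \<inter> Gamma_full n"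
    using Gamma_full_closed(4)[OF n, of g] by (auto simp: Gamma_lower_def v det_2 mult.commute)
qed

lemma group_Gamma_upper:
  assumes n: "n = {x. \<nu> dvd x}" and v: "v = {x. p dvd x}"
  shows "group (SL2_sub (Gamma_upper v \<inter> Gamma_full n))"
proof (rule group_SL2_sub)
  show "Gamma_upper v \<inter> Gamma_full n \<subseteq> carrier SL2" "mat 1 \<in> Gamma_upper v \<inter> Gamma_full n"
    using Gamma_full_closed(1,2)[OF n] by (auto simp: Gamma_upper_def v mat1_nth)
next
  fix g h assume gh: "g \<in> Gamma_upper v \<inter> Gamma_full n" "h \<in> Gamma_upper v \<inter> Gamma_full n"
  then show "g ** h \<in> Gamma_upper v \<inter> Gamma_full n" using Gamma_full_closed(3)[OF n, of g h]
    by (auto simp: Gamma_upper_def v mat2_mult_nth det_mul)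
next
  fix g assume "g \<in> Gamma_upper v \<inter> Gamma_full n"
  then show "mat2 (g $ 2 $ 2) (- g $ 1 $ 2) (- g $ 2 $ 1) (g $ 1 $ 1) \<in> Gamma_upper v \<inter> Gamma_full n"
    using Gamma_full_closed(4)[OF n, of g] by (auto simp: Gamma_upper_def v det_2 mult.commute)
qed

text \<open>Conjugation by S, an involution because S^2 = -1.\<close>

definition sigma :: "'a::field poly ^ 2 ^ 2 \<Rightarrow> 'a poly ^ 2 ^ 2" where
  "sigma h = mat2 (h $ 2 $ 2) (- h $ 2 $ 1) (- h $ 1 $ 2) (h $ 1 $ 1)"

lemma sigma_sigma [simp]: "sigma (sigma h) = h"
  by (simp add: sigma_def mat2_eq_iff)

lemma sigma_mult: "sigma (g ** h) = sigma g ** sigma h"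
  by (simp add: sigma_def mat2_eq_iff mat2_mult_nth algebra_simps)

lemma conj_by_S': "conj_by S_matrix = sigma"
  by (simp add: fun_eq_iff conj_by_S sigma_def)

lemma sigma_Gamma_full: "n = {x. \<nu> dvd x} \<Longrightarrow> h \<in> Gamma_full n \<Longrightarrow> sigma h \<in> Gamma_full n"
  by (simp add: Gamma_full_iff sigma_def mult.commute)

lemma sigma_lower_upper:
  assumes n: "n = {x. \<nu> dvd x}" and v: "v = {x. p dvd x}"
  shows "h \<in> Gamma_lower v \<inter> Gamma_full n \<Longrightarrow> sigma h \<in> Gamma_upper v \<inter> Gamma_full n"
    "h \<in> Gamma_upper v \<inter> Gamma_full n \<Longrightarrow> sigma h \<in> Gamma_lower v \<inter> Gamma_full n"
  using sigma_Gamma_full[OF n, of h] by (auto simp: Gamma_lower_def Gamma_upper_def v Gamma_full_def) (simp_all add: sigma_def)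

section \<open>Generators of ideals\<close>

lemma divisors_eq_PIdl: "PIdl\<^bsub>poly_ring_A\<^esub> p = {x. p dvd x}"
  by (auto simp: cgenideal_def ring_of_type_algebra_def dvd_def mult.commute)

lemma ideal_principal:
  assumes "ideal n (poly_ring_A :: 'a::field poly ring)" "n \<noteq> {0}" shows "\<exists>\<nu>. \<nu> \<noteq> 0 \<and> n = {x. \<nu> dvd x}"
proof -
  interpret ideal n "poly_ring_A :: 'a poly ring" by (rule assms)
  have zero: "0 \<in> n" using additive_subgroup.zero_closed[OF additive_subgroup_axioms] by (simp add: ring_of_type_algebra_def)
  have add: "a + b \<in> n" if "a \<in> n" "b \<in> n" for a b using additive_subgroup.a_closed[OF additive_subgroup_axioms that] by (simp add: ring_of_type_algebra_def)
  have mult: "a * x \<in> n" if "a \<in> n" for a x using I_r_closed[OF that, of x] by (simp add: ring_of_type_algebra_def)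
  obtain x where x: "x \<in> n" "x \<noteq> 0" using zero assms(2) by auto
  define \<nu> where "\<nu> = (ARG_MIN degree y. y \<in> n \<and> y \<noteq> 0)"
  have \<nu>: "\<nu> \<in> n" "\<nu> \<noteq> 0" and min: "\<And>y. y \<in> n \<Longrightarrow> y \<noteq> 0 \<Longrightarrow> degree \<nu> \<le> degree y"
    unfolding \<nu>_def using arg_min_nat_lemma[of "\<lambda>y. y \<in> n \<and> y \<noteq> 0" x degree] x by auto
  have "\<nu> dvd y" if y: "y \<in> n" for y
  proof -
    have "y mod \<nu> = y + \<nu> * (- (y div \<nu>))" by (simp add: minus_mult_div_eq_mod[symmetric])
    then have "y mod \<nu> \<in> n" using add[OF y mult[OF \<nu>(1)]] by metis
    then have "y mod \<nu> = 0" using min degree_mod_less[OF \<nu>(2), of y] by force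
    then show ?thesis by (simp add: dvd_eq_mod_eq_0)
  qed
  then show ?thesis using \<nu> mult by (auto elim!: dvdE)
qed

lemma primeideal_generator:
  assumes "primeideal v (poly_ring_A :: 'a::field poly ring)" "v \<noteq> {0}"
  shows "\<exists>p. Factorial_Ring.irreducible p \<and> v = {x. p dvd x} \<and> monic_generator v = p"
proof -
  interpret primeideal v "poly_ring_A :: 'a poly ring" by (rule assms)
  obtain r where r: "r \<noteq> 0" "v = {x. r dvd x}" using ideal_principal[OF is_ideal assms(2)] by blast
  define p where "p = Polynomial.smult (inverse (Polynomial.lead_coeff r)) r"
  have p: "p \<noteq> 0" "Polynomial.lead_coeff p = 1" "v = {x. p dvd x}" using r by (simp_all add: p_def smult_dvd_iff)
  have "\<not> is_unit p" using I_notcarr p(3) dvd_unit_imp_unit by (fastforce simp: ring_of_type_algebra_def)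
  moreover have "is_unit a \<or> is_unit b" if ab: "p = a * b" for a b
  proof -
    have "a * b \<in> v" by (simp add: p(3) ab)
    then have "a \<in> v \<or> b \<in> v" using I_prime[of a b] by (simp add: ring_of_type_algebra_def)
    then show ?thesis using ab p(1,3) dvd_mult_cancel_left[of a b 1] dvd_mult_cancel_right[of a b 1] by auto
  qed
  ultimately have irr: "Factorial_Ring.irreducible p" using p(1) by (simp add: Factorial_Ring.irreducible_def)
  have "monic_generator v = p" unfolding monic_generator_def
  proof (rule the_equality)
    show "Polynomial.lead_coeff p = 1 \<and> Factorial_Ring.irreducible p \<and> v = PIdl\<^bsub>poly_ring_A\<^esub> p"
      using irr p by (simp add: divisors_eq_PIdl)
  next
    fix q :: "'a poly"
    assume q: "Polynomial.lead_coeff q = 1 \<and> Factorial_Ring.irreducible q \<and> v = PIdl\<^bsub>poly_ring_A\<^esub> q"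
    then have "{x. q dvd x} = {x. p dvd x}" using p(3) by (simp add: divisors_eq_PIdl)
    then have "q dvd p" "p dvd q" by (metis dvd_refl mem_Collect_eq)+
    then obtain c d where c: "p = q * c" and d: "q = p * d" by (elim dvdE)
    then have "p * (d * c) = p * 1" by (simp add: mult.assoc[symmetric])
    then have "d * c = 1" using p(1) by (simp only: mult_cancel_left) simp
    then have "is_unit c" by (metis dvd_triv_right)
    then obtain u where u: "c = [:u:]" using is_unit_poly_iff by blast
    moreover have "Polynomial.lead_coeff c = 1" using c p(2) q by (simp add: Polynomial.lead_coeff_mult)
    ultimately show "q = p" using c by (simp add: one_pCons)
  qed
  then show ?thesis using irr p(3) by blast
qed

section \<open>The cokernel\<close>

locale congruence_setting = s_arith \<pi> for \<pi> :: "'a::{field, finite} poly" +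
  fixes n v :: "'a poly set" and \<nu> :: "'a poly"
  assumes n: "n = {x. \<nu> dvd x}" and v: "v = {x. \<pi> dvd x}" and gen: "monic_generator v = \<pi>"
    and \<nu>_pi: "Rings.coprime \<nu> \<pi>"
begin

abbreviation "G0 \<equiv> SL2_sub (Gamma_lower v \<inter> Gamma_full n)"
abbreviation "G1 \<equiv> SL2_sub (Gamma_upper v \<inter> Gamma_full n)"
abbreviation "Gn \<equiv> SL2_sub (Gamma_full n)"
abbreviation "F \<equiv> free_ab Gn"

lemma groups: "group G0" "group G1" "group Gn"
  by (rule group_Gamma_lower[OF n v] group_Gamma_upper[OF n v] group_Gamma_full[OF n])+

lemma tau_lower:
  assumes "h \<in> Gamma_lower v \<inter> Gamma_full n"
  obtains c where "h $ 2 $ 1 = \<pi> * c" "conj_by (tau_matrix v) h = mat2 (h $ 1 $ 1) (\<pi> * h $ 1 $ 2) c (h $ 2 $ 2)"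
    "\<nu> dvd c"
proof -
  obtain c where c: "h $ 2 $ 1 = \<pi> * c" using assms by (auto simp: Gamma_lower_def v)
  have "\<nu> dvd \<pi> * c" using assms unfolding c[symmetric] Int_iff Gamma_full_iff[OF n] by blast
  then have "\<nu> dvd c" using \<nu>_pi poly_coprime_dvd_mult by blast
  with c conj_by_tau[OF gen pi_nz c] show ?thesis by (rule that)
qed

lemma tau_hom: "conj_by (tau_matrix v) \<in> hom G0 G1"
proof (rule homI)
  fix h assume "h \<in> carrier G0"
  then have h: "h \<in> Gamma_lower v \<inter> Gamma_full n" by simp
  obtain c where c: "h $ 2 $ 1 = \<pi> * c" "conj_by (tau_matrix v) h = mat2 (h $ 1 $ 1) (\<pi> * h $ 1 $ 2) c (h $ 2 $ 2)"
    "\<nu> dvd c" using h by (rule tau_lower)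
  have "conj_by (tau_matrix v) h \<in> Gamma_full n" using h c(1,3) unfolding Int_iff Gamma_full_iff[OF n] c(2) by (simp add: mult_ac)
  moreover from this have "det (conj_by (tau_matrix v) h) = 1" by (simp add: Gamma_full_def)
  moreover have "conj_by (tau_matrix v) h $ 1 $ 2 \<in> v" by (subst c(2)) (simp add: v)
  ultimately show "conj_by (tau_matrix v) h \<in> carrier G1" by (simp add: Gamma_upper_def)
next
  fix g h assume gh: "g \<in> carrier G0" "h \<in> carrier G0"
  then have g: "g \<in> Gamma_lower v \<inter> Gamma_full n" and h: "h \<in> Gamma_lower v \<inter> Gamma_full n" by simp_all
  obtain c where c: "g $ 2 $ 1 = \<pi> * c" "conj_by (tau_matrix v) g = mat2 (g $ 1 $ 1) (\<pi> * g $ 1 $ 2) c (g $ 2 $ 2)"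
    using g by (rule tau_lower)
  obtain d where d: "h $ 2 $ 1 = \<pi> * d" "conj_by (tau_matrix v) h = mat2 (h $ 1 $ 1) (\<pi> * h $ 1 $ 2) d (h $ 2 $ 2)"
    using h by (rule tau_lower)
  have "(g ** h) $ 2 $ 1 = \<pi> * (c * h $ 1 $ 1 + g $ 2 $ 2 * d)" by (simp add: mat2_mult_nth c d algebra_simps)
  from conj_by_tau[OF gen pi_nz this]
  show "conj_by (tau_matrix v) (g \<otimes>\<^bsub>G0\<^esub> h) = conj_by (tau_matrix v) g \<otimes>\<^bsub>G1\<^esub> conj_by (tau_matrix v) h"
    by (simp add: c d mat2_eq_iff mat2_mult_nth algebra_simps)
qed

lemma sigma_hom: "sigma \<in> hom G0 G1" "sigma \<in> hom G1 G0" "sigma \<in> hom Gn Gn"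
  using sigma_lower_upper[OF n v] sigma_Gamma_full[OF n] by (auto intro!: homI simp: sigma_mult)

text \<open>As \<open>sigma\<close> is an involution, the map it induces is injective on classes.
  This disposes of \<open>inv_into\<close> and describes w_v on representatives.\<close>

lemma atkin_lehner_class:
  assumes h: "h \<in> carrier G0"
  shows "atkin_lehner v n (free_ab_class G0 h) = free_ab_class G0 (sigma (conj_by (tau_matrix v) h))"
proof -
  define k where "k = conj_by (tau_matrix v) h"
  have k: "k \<in> carrier G1" unfolding k_def using tau_hom h by (rule hom_in_carrier)
  have sk: "sigma k \<in> carrier G0" using sigma_hom(2) k by (rule hom_in_carrier)
  have inj: "inj_on (free_ab_map G1 sigma) (carrier (free_ab G0))"
  proof (rule inj_on_inverseI)
    fix x assume "x \<in> carrier (free_ab G0)"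
    then obtain g where g: "g \<in> carrier G0" "x = free_ab_class G0 g" unfolding carrier_free_ab by blast
    have "sigma g \<in> carrier G1" using sigma_hom(1) g(1) by (rule hom_in_carrier)
    then show "free_ab_map G0 sigma (free_ab_map G1 sigma x) = x"
      by (simp only: g(2) free_ab_map_class[OF groups(1,2) sigma_hom(1) g(1)]
          free_ab_map_class[OF groups(2,1) sigma_hom(2)] sigma_sigma)
  qed
  have "free_ab_map G1 sigma (free_ab_class G0 (sigma k)) = free_ab_class G1 k"
    using free_ab_map_class[OF groups(1,2) sigma_hom(1) sk] by simp
  moreover have "free_ab_class G0 (sigma k) \<in> carrier (free_ab G0)" unfolding carrier_free_ab using sk by (rule imageI)
  ultimately have "inv_into (carrier (free_ab G0)) (free_ab_map G1 sigma) (free_ab_class G1 k) = free_ab_class G0 (sigma k)"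
    using inv_into_f_f[OF inj] by metis
  then show ?thesis unfolding atkin_lehner_def conj_by_S' free_ab_map_class[OF groups(1,2) tau_hom h] k_def .
qed

lemma alpha_class:
  assumes h: "h \<in> carrier G0"
  shows "alpha_map v n (free_ab_class G0 h) = (free_ab_class Gn h, free_ab_class Gn (sigma (conj_by (tau_matrix v) h)))"
proof -
  have incl: "(\<lambda>g. g) \<in> hom G0 Gn" by (rule homI) auto
  have "sigma (conj_by (tau_matrix v) h) \<in> carrier G0"
    using hom_in_carrier[OF sigma_hom(2) hom_in_carrier[OF tau_hom h]] .
  then show ?thesis unfolding alpha_map_def inclusion_map_def atkin_lehner_class[OF h]
    using h by (simp only: free_ab_map_class[OF groups(1,3) incl])
qed

lemma free_ab_class_closed: "g \<in> carrier G \<Longrightarrow> free_ab_class G g \<in> carrier (free_ab G)"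
  unfolding carrier_free_ab by (rule imageI)

lemma comm_groups: "comm_group (free_ab G0)" "comm_group F" "comm_group (F \<times>\<times> F)"
proof -
  show "comm_group (free_ab G0)" "comm_group F" using groups by (simp_all only: free_ab_comm_group)
  then interpret F: comm_group F by simp
  interpret FF: group "F \<times>\<times> F" by (rule DirProd_group) (rule F.is_group)+
  show "comm_group (F \<times>\<times> F)" by (rule FF.group_comm_groupI) (auto simp: F.m_comm)
qed

lemma alpha_hom: "alpha_map v n \<in> hom (free_ab G0) (F \<times>\<times> F)"
proof (rule homI)
  fix x assume "x \<in> carrier (free_ab G0)"
  then obtain g where g: "g \<in> carrier G0" "x = free_ab_class G0 g" unfolding carrier_free_ab by blast
  have "sigma (conj_by (tau_matrix v) g) \<in> carrier G0"
    using hom_in_carrier[OF sigma_hom(2) hom_in_carrier[OF tau_hom g(1)]] .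
  then show "alpha_map v n x \<in> carrier (F \<times>\<times> F)" using g(1)
    by (simp add: g(2) alpha_class[OF g(1)] free_ab_class_closed)
next
  fix x y assume "x \<in> carrier (free_ab G0)" "y \<in> carrier (free_ab G0)"
  then obtain g h where g: "g \<in> carrier G0" "x = free_ab_class G0 g" and h: "h \<in> carrier G0" "y = free_ab_class G0 h"
    unfolding carrier_free_ab by blast
  define \<omega> where "\<omega> k = sigma (conj_by (tau_matrix v) k)" for k
  have \<omega>: "\<omega> k \<in> carrier G0" if "k \<in> carrier G0" for k
    unfolding \<omega>_def using hom_in_carrier[OF sigma_hom(2) hom_in_carrier[OF tau_hom that]] .
  have G0n: "k \<in> carrier Gn" if "k \<in> carrier G0" for k using that by simp
  have gh: "g \<otimes>\<^bsub>G0\<^esub> h \<in> carrier G0" using g h groups(1) by (intro monoid.m_closed) (auto simp: group_def)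
  have "\<omega> (g \<otimes>\<^bsub>G0\<^esub> h) = \<omega> g \<otimes>\<^bsub>Gn\<^esub> \<omega> h"
    unfolding \<omega>_def hom_mult[OF tau_hom g(1) h(1)]
      hom_mult[OF sigma_hom(2) hom_in_carrier[OF tau_hom g(1)] hom_in_carrier[OF tau_hom h(1)]] by simp
  moreover have "g \<otimes>\<^bsub>G0\<^esub> h = g \<otimes>\<^bsub>Gn\<^esub> h" by simp
  ultimately show "alpha_map v n (x \<otimes>\<^bsub>free_ab G0\<^esub> y) = alpha_map v n x \<otimes>\<^bsub>F \<times>\<times> F\<^esub> alpha_map v n y"
    unfolding g(2) h(2) free_ab_class_mult[OF groups(1) g(1) h(1), symmetric]
      alpha_class[OF gh] alpha_class[OF g(1)] alpha_class[OF h(1)] mult_DirProd \<omega>_def[symmetric]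
    using free_ab_class_mult[OF groups(3) G0n[OF g(1)] G0n[OF h(1)]]
      free_ab_class_mult[OF groups(3) G0n[OF \<omega>[OF g(1)]] G0n[OF \<omega>[OF h(1)]]] by simp
qed

section \<open>Passage from integral elements of \<open>sl2\<close> to matrices\<close>

definition to_mat :: "'a poly fract sl2 \<Rightarrow> 'a poly ^ 2 ^ 2" where
  "to_mat g = mat2 (inv_into UNIV \<iota> (ent11 g)) (inv_into UNIV \<iota> (ent12 g)) (inv_into UNIV \<iota> (ent21 g)) (inv_into UNIV \<iota> (ent22 g))"

lemma to_mat:
  assumes "ent11 g = \<iota> a" "ent12 g = \<iota> b" "ent21 g = \<iota> c" "ent22 g = \<iota> d" shows "to_mat g = mat2 a b c d"
proof -
  have "inj \<iota>" by (rule injI) simp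
  then show ?thesis by (simp add: to_mat_def assms)
qed

lemma to_mat_closed: "g \<in> Ga \<nu> \<Longrightarrow> to_mat g \<in> carrier Gn"
  by (erule Ga_E) (simp add: to_mat Gamma_full_iff[OF n])

lemma to_mat_add: assumes "g \<in> Ga \<nu>" "h \<in> Ga \<nu>" shows "to_mat (g + h) = to_mat g ** to_mat h"
proof -
  from assms(1) obtain a b c d where g: "ent11 g = \<iota> a" "ent12 g = \<iota> b" "ent21 g = \<iota> c" "ent22 g = \<iota> d" by (rule Ga_E)
  from assms(2) obtain a' b' c' d' where h: "ent11 h = \<iota> a'" "ent12 h = \<iota> b'" "ent21 h = \<iota> c'" "ent22 h = \<iota> d'" by (rule Ga_E)
  have "to_mat (g + h) = mat2 (a * a' + b * c') (a * b' + b * d') (c * a' + d * c') (c * b' + d * d')"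
    by (rule to_mat) (simp_all add: ent_plus g h)
  then show ?thesis by (simp add: to_mat[OF g] to_mat[OF h] mat2_eq_iff mat2_mult_nth)
qed

lemma to_mat_surj: assumes "k \<in> carrier Gn" shows "\<exists>g \<in> Ga \<nu>. to_mat g = k"
proof -
  have k: "k $ 1 $ 1 * k $ 2 $ 2 - k $ 1 $ 2 * k $ 2 $ 1 = 1 \<and> \<nu> dvd k $ 1 $ 1 - 1 \<and> \<nu> dvd k $ 1 $ 2
     \<and> \<nu> dvd k $ 2 $ 1 \<and> \<nu> dvd k $ 2 $ 2 - 1" using assms by (simp add: Gamma_full_iff[OF n])
  then have "\<iota> (k $ 1 $ 1 * k $ 2 $ 2 - k $ 1 $ 2 * k $ 2 $ 1) = 1" by simp
  then have "\<iota> (k $ 1 $ 1) * \<iota> (k $ 2 $ 2) - \<iota> (k $ 1 $ 2) * \<iota> (k $ 2 $ 1) = 1" by simp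
  note e = ent_sl2[OF this]
  have "sl2 (\<iota> (k $ 1 $ 1)) (\<iota> (k $ 1 $ 2)) (\<iota> (k $ 2 $ 1)) (\<iota> (k $ 2 $ 2)) \<in> Ga \<nu>"
    by (rule Ga_I[OF e]) (use k in simp_all)
  moreover have "to_mat (sl2 (\<iota> (k $ 1 $ 1)) (\<iota> (k $ 1 $ 2)) (\<iota> (k $ 2 $ 1)) (\<iota> (k $ 2 $ 2))) = k"
    unfolding to_mat[OF e] by (simp add: mat2_eq_iff)
  ultimately show ?thesis by blast
qed

text \<open>\<open>tc\<close> conjugates by the inverse of diag(\<pi>, 1), and conjugation by
  \<open>tau_matrix v\<close> undoes it.\<close>

lemma to_mat_tc:
  assumes g: "g \<in> Ga \<nu>" "tc g \<in> Ga \<nu>"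
  shows "to_mat (tc g) \<in> carrier G0" "conj_by (tau_matrix v) (to_mat (tc g)) = to_mat g"
proof -
  obtain a b c d where e: "ent11 g = \<iota> a" "ent12 g = \<iota> b" "ent21 g = \<iota> c" "ent22 g = \<iota> d" using g(1) by (rule Ga_E)
  obtain b' where b': "ent12 (tc g) = \<iota> b'" using g(2) by (rule Ga_E)
  then have "\<iota> b = \<iota> (\<pi> * b')" by (simp add: ent_tc e field_simps)
  then have b: "b = \<pi> * b'" by (simp only: to_fract_eq_iff)
  have t: "to_mat (tc g) = mat2 a b' (\<pi> * c) d" using b' by (intro to_mat) (simp_all add: ent_tc e)
  have "to_mat (tc g) \<in> Gamma_full n" using to_mat_closed[OF g(2)] by simp
  then show "to_mat (tc g) \<in> carrier G0" using Gamma_full_closed(1)[OF n] by (auto simp: Gamma_lower_def v t)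
  show "conj_by (tau_matrix v) (to_mat (tc g)) = to_mat g"
    using conj_by_tau[OF gen pi_nz, of "to_mat (tc g)" c] by (simp add: t to_mat[OF e] b)
qed

theorem alpha_surjective_mod:
  assumes l: "Factorial_Ring.prime (l :: nat)" "\<not> l dvd 2 * CARD('a)"
  shows "tensor_mod_map l (F \<times>\<times> F) (alpha_map v n) \<in> epi (tensor_mod l (free_ab G0)) (tensor_mod l (F \<times>\<times> F))"
proof -
  define T where "T = tensor_mod l (F \<times>\<times> F)"
  define t where "t x = powers l (F \<times>\<times> F) #>\<^bsub>F \<times>\<times> F\<^esub> x" for x
  define f where "f = tensor_mod_map l (F \<times>\<times> F) (alpha_map v n)"
  define I where "I = f ` carrier (tensor_mod l (free_ab G0))"
  interpret F: comm_group F by (rule comm_groups)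
  interpret FF: comm_group "F \<times>\<times> F" by (rule comm_groups)
  interpret F0: comm_group "free_ab G0" by (rule comm_groups)
  interpret T: comm_group T unfolding T_def by (rule tensor_mod_comm_group) (rule comm_groups)
  interpret T0: comm_group "tensor_mod l (free_ab G0)" by (rule tensor_mod_comm_group) (rule comm_groups)
  note normals = powers_normal[OF comm_groups(1), of l] powers_normal[OF comm_groups(3), of l]
    and pw = powers_hom[OF F0.is_group FF.is_group alpha_hom, of l]
  have f_hom: "f \<in> hom (tensor_mod l (free_ab G0)) T"
    unfolding f_def T_def tensor_mod_def tensor_mod_map_def by (rule quot_map_hom[OF normals alpha_hom pw])
  have f_class: "f (powers l (free_ab G0) #>\<^bsub>free_ab G0\<^esub> x) = t (alpha_map v n x)" if "x \<in> carrier (free_ab G0)" for x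
    unfolding f_def tensor_mod_map_def t_def by (rule quot_map_coset[OF normals alpha_hom pw that])
  interpret f: group_hom "tensor_mod l (free_ab G0)" T f
    by (simp add: group_hom_def group_hom_axioms_def f_hom T.is_group T0.is_group)
  have I_sub: "subgroup I T" unfolding I_def by (rule f.img_is_subgroup)
  interpret I: normal I T by (rule T.subgroup_imp_normal[OF I_sub])
  define M where "M = T Mod I"
  interpret M: comm_group M unfolding M_def by (rule T.abelian_FactGroup[OF I_sub])
  interpret P: normal "powers l (F \<times>\<times> F)" "F \<times>\<times> F" by (rule normals(2))
  define q where "q x = I #>\<^bsub>T\<^esub> t x" for x
  have carrier_T: "carrier T = t ` carrier (F \<times>\<times> F)" by (simp add: T_def tensor_mod_def carrier_FactGroup t_def image_image)
  have t_mult: "t (x \<otimes>\<^bsub>F \<times>\<times> F\<^esub> y) = t x \<otimes>\<^bsub>T\<^esub> t y" if "x \<in> carrier (F \<times>\<times> F)" "y \<in> carrier (F \<times>\<times> F)" for x y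
    using that by (simp only: T_def tensor_mod_def t_def mult_FactGroup P.rcos_sum)
  have t_closed: "t x \<in> carrier T" if "x \<in> carrier (F \<times>\<times> F)" for x unfolding carrier_T using that by (rule imageI)
  have carrier_M: "carrier M = q ` carrier (F \<times>\<times> F)" by (simp only: M_def carrier_FactGroup carrier_T q_def[abs_def] image_image)
  have q_mult: "q (x \<otimes>\<^bsub>F \<times>\<times> F\<^esub> y) = q x \<otimes>\<^bsub>M\<^esub> q y" if "x \<in> carrier (F \<times>\<times> F)" "y \<in> carrier (F \<times>\<times> F)" for x y
    using that by (simp only: M_def q_def mult_FactGroup t_mult I.rcos_sum t_closed)
  have q_closed: "q x \<in> carrier M" if "x \<in> carrier (F \<times>\<times> F)" for x unfolding carrier_M using that by (rule imageI)
  have q_pair: "q (x, \<one>\<^bsub>F\<^esub>) \<in> carrier M" "q (\<one>\<^bsub>F\<^esub>, x) \<in> carrier M"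
    "q (x \<otimes>\<^bsub>F\<^esub> y, \<one>\<^bsub>F\<^esub>) = q (x, \<one>\<^bsub>F\<^esub>) \<otimes>\<^bsub>M\<^esub> q (y, \<one>\<^bsub>F\<^esub>)"
    "q (\<one>\<^bsub>F\<^esub>, x \<otimes>\<^bsub>F\<^esub> y) = q (\<one>\<^bsub>F\<^esub>, x) \<otimes>\<^bsub>M\<^esub> q (\<one>\<^bsub>F\<^esub>, y)"
    "q (x, y) = q (x, \<one>\<^bsub>F\<^esub>) \<otimes>\<^bsub>M\<^esub> q (\<one>\<^bsub>F\<^esub>, y)" if "x \<in> carrier F" "y \<in> carrier F" for x y
    using q_closed[of "(x, \<one>\<^bsub>F\<^esub>)"] q_closed[of "(\<one>\<^bsub>F\<^esub>, x)"] q_mult[of "(x, \<one>\<^bsub>F\<^esub>)" "(y, \<one>\<^bsub>F\<^esub>)"]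
      q_mult[of "(\<one>\<^bsub>F\<^esub>, x)" "(\<one>\<^bsub>F\<^esub>, y)"] q_mult[of "(x, \<one>\<^bsub>F\<^esub>)" "(\<one>\<^bsub>F\<^esub>, y)"] that
    by simp_all
  have q_alpha: "q (alpha_map v n x) = \<one>\<^bsub>M\<^esub>" if x: "x \<in> carrier (free_ab G0)" for x
  proof -
    have tI: "t (alpha_map v n x) \<in> I" unfolding I_def f_class[OF x, symmetric] tensor_mod_def carrier_FactGroup
      using x by (intro imageI)
    show ?thesis unfolding q_def M_def one_FactGroup by (rule T.coset_join2[OF I.mem_carrier[OF tI] I_sub tI])
  qed
  have exponent: "x [^]\<^bsub>M\<^esub> l = \<one>\<^bsub>M\<^esub>" if "x \<in> carrier M" for x
  proof -
    note x = that
    obtain y where y: "y \<in> carrier T" "x = I #>\<^bsub>T\<^esub> y" using x unfolding M_def carrier_FactGroup by blast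
    have "y [^]\<^bsub>T\<^esub> l = \<one>\<^bsub>T\<^esub>" using y(1) tensor_mod_pow[OF comm_groups(3)] by (simp only: T_def)
    then show ?thesis
      by (simp only: y(2) M_def I.FactGroup_pow[OF y(1)] T.coset_mult_one[OF I.subset] one_FactGroup)
  qed
  \<comment> \<open>The characteristic divides q, so l is prime to 2 and p, and a group of exponent
    l has neither 2-torsion nor p-torsion.\<close>
  have "\<not> l dvd 2" "\<not> l dvd CHAR('a)"
    using l(2) CHAR_dvd_CARD[where 'a = 'a] by (meson dvd_mult dvd_mult2 dvd_trans)+
  then have "Rings.coprime l 2" "Rings.coprime l CHAR('a)" using prime_imp_coprime[OF l(1)] by blast+
  then have cop: "Rings.coprime 2 l" "Rings.coprime CHAR('a) l" by (simp_all only: coprime_commute)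
  define c where "c g = free_ab_class Gn g" for g
  have c: "c g \<in> carrier F" if "g \<in> carrier Gn" for g unfolding c_def using that by (rule free_ab_class_closed)
  have c_mult: "c (g ** h) = c g \<otimes>\<^bsub>F\<^esub> c h" if "g \<in> carrier Gn" "h \<in> carrier Gn" for g h
    using free_ab_class_mult[OF groups(3) that] by (simp add: c_def)
  have sig: "sigma g \<in> carrier Gn" if "g \<in> carrier Gn" for g using sigma_hom(3) that by (rule hom_in_carrier)
  define \<phi>1 where "\<phi>1 g = q (c (to_mat g), \<one>\<^bsub>F\<^esub>)" for g
  \<comment> \<open>With \<open>sigma\<close> inserted, \<psi> g is the contribution of the second
    component of \<alpha> at the class of \<open>tc g\<close>. That q kills the image of \<alpha>
    then reads \<phi>1 (tc g) \<psi> g = 1, which is why \<phi>2 is the inverse of \<psi>.\<close>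
  define \<psi> where "\<psi> g = q (\<one>\<^bsub>F\<^esub>, c (sigma (to_mat g)))" for g
  define \<phi>2 where "\<phi>2 g = inv\<^bsub>M\<^esub> \<psi> g" for g
  have \<phi>1_closed: "\<phi>1 g \<in> carrier M" if "g \<in> Ga \<nu>" for g
    unfolding \<phi>1_def by (rule q_pair(1)[OF c F.one_closed]) (rule to_mat_closed[OF that])
  have \<psi>_closed: "\<psi> g \<in> carrier M" if "g \<in> Ga \<nu>" for g
    unfolding \<psi>_def by (rule q_pair(2)[OF c F.one_closed]) (rule sig[OF to_mat_closed[OF that]])
  have \<phi>1_mult: "\<phi>1 (g + h) = \<phi>1 g \<otimes>\<^bsub>M\<^esub> \<phi>1 h" if "g \<in> Ga \<nu>" "h \<in> Ga \<nu>" for g h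
    unfolding \<phi>1_def to_mat_add[OF that] c_mult[OF to_mat_closed[OF that(1)] to_mat_closed[OF that(2)]]
    by (rule q_pair(3)[OF c c]) (rule to_mat_closed[OF that(1)] to_mat_closed[OF that(2)])+
  have \<psi>_mult: "\<psi> (g + h) = \<psi> g \<otimes>\<^bsub>M\<^esub> \<psi> h" if "g \<in> Ga \<nu>" "h \<in> Ga \<nu>" for g h
    unfolding \<psi>_def to_mat_add[OF that] sigma_mult c_mult[OF sig[OF to_mat_closed[OF that(1)]] sig[OF to_mat_closed[OF that(2)]]]
    by (rule q_pair(4)[OF c c]) (rule sig to_mat_closed[OF that(1)] to_mat_closed[OF that(2)])+
  have agree: "\<phi>1 (tc g) = \<phi>2 g" if g: "g \<in> Ga \<nu>" "tc g \<in> Ga \<nu>" for g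
  proof -
    have "q (alpha_map v n (free_ab_class G0 (to_mat (tc g)))) = \<one>\<^bsub>M\<^esub>"
      by (rule q_alpha[OF free_ab_class_closed[OF to_mat_tc(1)[OF g]]])
    then have "q (c (to_mat (tc g)), c (sigma (to_mat g))) = \<one>\<^bsub>M\<^esub>"
      unfolding alpha_class[OF to_mat_tc(1)[OF g]] to_mat_tc(2)[OF g] c_def .
    then have "\<phi>1 (tc g) \<otimes>\<^bsub>M\<^esub> \<psi> g = \<one>\<^bsub>M\<^esub>"
      unfolding \<phi>1_def \<psi>_def q_pair(5)[OF c[OF to_mat_closed[OF g(2)]] c[OF sig[OF to_mat_closed[OF g(1)]]]] .
    then show ?thesis unfolding \<phi>2_def using \<psi>_closed[OF g(1)] \<phi>1_closed[OF g(2)] by (rule M.inv_equality[symmetric])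
  qed
  have M_2: "x = \<one>\<^bsub>M\<^esub>" if "x \<in> carrier M" "x \<otimes>\<^bsub>M\<^esub> x = \<one>\<^bsub>M\<^esub>" for x
  proof -
    have "x [^]\<^bsub>M\<^esub> (2::nat) = \<one>\<^bsub>M\<^esub>" using that by (simp add: numeral_2_eq_2)
    then show ?thesis by (rule eq_one_if_coprime_powers[OF M.is_group that(1) _ exponent[OF that(1)] cop(1)])
  qed
  have M_p: "x = \<one>\<^bsub>M\<^esub>" if "x \<in> carrier M" "x [^]\<^bsub>M\<^esub> CHAR('a) = \<one>\<^bsub>M\<^esub>" for x
    by (rule eq_one_if_coprime_powers[OF M.is_group that exponent[OF that(1)] cop(2)])
  have \<phi>2_closed: "\<phi>2 g \<in> carrier M" if "g \<in> Ga \<nu>" for g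
    unfolding \<phi>2_def by (rule M.inv_closed[OF \<psi>_closed[OF that]])
  have \<phi>2_mult: "\<phi>2 (g + h) = \<phi>2 g \<otimes>\<^bsub>M\<^esub> \<phi>2 h" if "g \<in> Ga \<nu>" "h \<in> Ga \<nu>" for g h
    unfolding \<phi>2_def \<psi>_mult[OF that] by (rule M.inv_mult[OF \<psi>_closed[OF that(1)] \<psi>_closed[OF that(2)]])
  have "s_gluing \<pi> M \<nu> \<phi>1 \<phi>2"
    by (intro s_gluing.intro s_gluing_axioms.intro s_arith_axioms M.comm_group_axioms;
      fact \<nu>_pi \<phi>1_closed \<phi>2_closed \<phi>1_mult \<phi>2_mult agree M_2 M_p)
  note trivial = s_gluing.gluing_trivial[OF this]
  have q1: "q (c g, \<one>\<^bsub>F\<^esub>) = \<one>\<^bsub>M\<^esub>" if "g \<in> carrier Gn" for g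
    using to_mat_surj[OF that] trivial(1) unfolding \<phi>1_def by blast
  have q2: "q (\<one>\<^bsub>F\<^esub>, c g) = \<one>\<^bsub>M\<^esub>" if g: "g \<in> carrier Gn" for g
  proof -
    obtain x where x: "x \<in> Ga \<nu>" "to_mat x = sigma g" using to_mat_surj[OF sig[OF g]] by blast
    have "\<psi> x = \<one>\<^bsub>M\<^esub>" using trivial(2)[OF x(1)] \<psi>_closed[OF x(1)] unfolding \<phi>2_def
      by (metis M.inv_inv M.inv_one)
    then show ?thesis by (simp add: \<psi>_def x(2))
  qed
  have "carrier T \<subseteq> I"
  proof
    fix y assume "y \<in> carrier T"
    then obtain g h where gh: "g \<in> carrier Gn" "h \<in> carrier Gn" "y = t (c g, c h)"
      unfolding carrier_T carrier_DirProd carrier_free_ab c_def by blast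
    have "q (c g, c h) = q (c g, \<one>\<^bsub>F\<^esub>) \<otimes>\<^bsub>M\<^esub> q (\<one>\<^bsub>F\<^esub>, c h)"
      by (rule q_pair(5)[OF c[OF gh(1)] c[OF gh(2)]])
    then have "I #>\<^bsub>T\<^esub> y = \<one>\<^bsub>M\<^esub>" by (simp add: q1[OF gh(1)] q2[OF gh(2)] gh(3) flip: q_def)
    then have "I #>\<^bsub>T\<^esub> y = I" by (simp add: M_def)
    then show "y \<in> I" using T.rcos_self[OF \<open>y \<in> carrier T\<close> I_sub] by simp
  qed
  then have "f ` carrier (tensor_mod l (free_ab G0)) = carrier T" using I.subset unfolding I_def by blast
  then show ?thesis using f_hom unfolding epi_def T_def f_def by blast
qed

end

theorem theorem2p2p1:
  fixes n v :: "'a::{field, finite} poly set" and l :: nat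
  assumes "CARD('a) > 4"
    and "ideal n poly_ring_A" and "n \<noteq> {0}"
    and "primeideal v poly_ring_A" and "v \<noteq> {0}"
    and "v \<notin> divisor_support n"
    and "Factorial_Ring.prime l" and "\<not> l dvd 2 * CARD('a)"
  shows "tensor_mod_map l (free_ab (SL2_sub (Gamma_full n)) \<times>\<times> free_ab (SL2_sub (Gamma_full n)))
           (alpha_map v n)
         \<in> epi (tensor_mod l (free_ab (SL2_sub (Gamma_lower v \<inter> Gamma_full n))))
               (tensor_mod l (free_ab (SL2_sub (Gamma_full n)) \<times>\<times> free_ab (SL2_sub (Gamma_full n))))"
proof -
  obtain \<nu> where \<nu>: "n = {x. \<nu> dvd x}" using ideal_principal[OF assms(2,3)] by blast
  obtain p where p: "Factorial_Ring.irreducible p" "v = {x. p dvd x}" "monic_generator v = p"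
    using primeideal_generator[OF assms(4,5)] by blast
  have "\<not> n \<subseteq> v" using assms(4-6) by (simp add: divisor_support_def)
  then have "\<not> p dvd \<nu>" unfolding \<nu> p(2) by (auto intro: dvd_trans)
  then have cop: "Rings.coprime \<nu> p" using poly_coprime_iff_prime[OF p(1), of \<nu>] coprime_commute by blast
  have "CARD('a) > 3" using assms(1) by simp
  then interpret congruence_setting p n v \<nu>
    by (intro congruence_setting.intro s_arith.intro congruence_setting_axioms.intro p \<nu> cop)
  show ?thesis using assms(7,8) by (rule alpha_surjective_mod)
qed

end
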